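(* Let $k\ge1$ and let $\chi_1,\dots,\chi_{k+1}$ be primitive Dirichlet characters. The Mordell–Tornheim $L$-function $$L_{MT}(\mathbf{s};\chi_1,\dots,\chi_{k+1})=\sum_{m_1,\dots,m_k\ge1}\frac{\chi_1(m_1)\cdots\chi_k(m_k)\chi_{k+1}(m_1+\dots+m_k)}{m_1^{s_1}\cdots m_k^{s_k}(m_1+\dots+m_k)^{s_{k+1}}},\qquad \mathbf s=(s_1,\dots,s_{k+1}),$$ can be analytically continued to a meromorphic function on $\mathbb{C}^{k+1}$ whose singularities lie in at most countably many explicitly computable hyperplanes. *)

theory Defs
  imports "HOL-Analysis.Analysis"
begin

text \<open>Dirichlet characters are regarded as functions on the natural numbers. The trivial character
  modulo 1 is a primitive character.\<close>

definition dirichlet_character :: "nat \<Rightarrow> (nat \<Rightarrow> complex) \<Rightarrow> bool" where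
  "dirichlet_character q X \<longleftrightarrow>
     q > 0 \<and> X 1 = 1 \<and>
     (\<forall>m n. X (m * n) = X m * X n) \<and>
     (\<forall>n. X (n + q) = X n) \<and>
     (\<forall>n. X n \<noteq> 0 \<longleftrightarrow> coprime n q)"

definition primitive_dirichlet_character :: "nat \<Rightarrow> (nat \<Rightarrow> complex) \<Rightarrow> bool" where
  "primitive_dirichlet_character q X \<longleftrightarrow>
     dirichlet_character q X \<and>
     \<not> (\<exists>d \<psi>. d dvd q \<and> d < q \<and> dirichlet_character d \<psi> \<and> (\<forall>n. coprime n q \<longrightarrow> X n = \<psi> n))"


definition holomorphic_several_on ::
    "(complex ^ 'n \<Rightarrow> complex) \<Rightarrow> (complex ^ 'n::finite) set \<Rightarrow> bool" where
  "holomorphic_several_on f U \<longleftrightarrow>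
     open U \<and>
     (\<forall>z\<in>U. \<exists>D. (f has_derivative D) (at z) \<and> (\<forall>c v. D (c *s v) = c * D v))"

text \<open>A meromorphic function is locally a quotient of holomorphic functions with a denominator that
  does not vanish identically on a connected neighbourhood. It is represented by a total function;
  its values at the zeros of the local denominators are not constrained.\<close>

definition meromorphic_several_on ::
    "(complex ^ 'n \<Rightarrow> complex) \<Rightarrow> (complex ^ 'n::finite) set \<Rightarrow> bool" where
  "meromorphic_several_on f U \<longleftrightarrow>
     open U \<and>
     (\<forall>p\<in>U. \<exists>V g h. p \<in> V \<and> V \<subseteq> U \<and> connected V \<and>
        holomorphic_several_on g V \<and> holomorphic_several_on h V \<and>
        (\<exists>z\<in>V. h z \<noteq> 0) \<and> (\<forall>z\<in>V. h z \<noteq> 0 \<longrightarrow> f z = g z / h z))"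

text \<open>Besides poles and points of indeterminacy, this contains points at which the chosen total
  function merely has a wrong value; a bound on this set is therefore also a bound on the
  singularities that are not removable.\<close>

definition singularities :: "(complex ^ 'n::finite \<Rightarrow> complex) \<Rightarrow> (complex ^ 'n) set" where
  "singularities f = {p. \<not> (\<exists>V. p \<in> V \<and> holomorphic_several_on f V)}"

definition complex_hyperplane :: "(complex ^ 'n::finite) set \<Rightarrow> bool" where
  "complex_hyperplane H \<longleftrightarrow> (\<exists>a b. a \<noteq> 0 \<and> H = {s. (\<Sum>i\<in>UNIV. a $ i * s $ i) = b})"


text \<open>With \<open>k\<close> the cardinality of the type \<open>'k\<close>, the index \<open>Some j\<close> ranges over \<open>1, \<dots>, k\<close>, and
  \<open>None\<close> is the index \<open>k + 1\<close>.\<close>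

definition MT_term ::
    "('k::finite option \<Rightarrow> nat \<Rightarrow> complex) \<Rightarrow> complex ^ ('k option) \<Rightarrow> ('k \<Rightarrow> nat) \<Rightarrow> complex" where
  "MT_term X s m =
     (\<Prod>j\<in>UNIV. X (Some j) (m j)) * X None (\<Sum>j\<in>UNIV. m j) /
     ((\<Prod>j\<in>UNIV. of_nat (m j) powr (s $ Some j)) * of_nat (\<Sum>j\<in>UNIV. m j) powr (s $ None))"

definition MT_domain ::
    "('k::finite option \<Rightarrow> nat \<Rightarrow> complex) \<Rightarrow> (complex ^ ('k option)) set" where
  "MT_domain X = {s. MT_term X s summable_on {m. \<forall>j. m j \<ge> 1}}"

definition L_MT ::
    "('k::finite option \<Rightarrow> nat \<Rightarrow> complex) \<Rightarrow> complex ^ ('k option) \<Rightarrow> complex" where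
  "L_MT X s = (\<Sum>\<^sub>\<infinity>m\<in>{m. \<forall>j. m j \<ge> 1}. MT_term X s m)"

text \<open>The product over \<open>j\<close> of the sums of \<open>f\<^sub>j(m) m\<^sup>-\<^sup>s e\<^sup>-\<^sup>m\<^sup>x\<close> (with \<open>s = s\<^sub>j\<close> and \<open>f\<^sub>j\<close> periodic) has an
  expansion at \<open>x = 0\<close> in powers of \<open>x\<close> with exponents \<open>l + \<Sum>j\<in>J. (s\<^sub>j - 1)\<close>. Its Mellin transform
  at \<open>s\<^bsub>k+1\<^esub>\<close> therefore has possible poles where \<open>s\<^bsub>k+1\<^esub> + l + \<Sum>j\<in>J. (s\<^sub>j - 1) = 0\<close>. Those
  with \<open>J = {}\<close> are cancelled by the factor \<open>1 / \<Gamma>(s\<^bsub>k+1\<^esub>)\<close>.\<close>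

definition MT_hyperplane :: "'k::finite set \<Rightarrow> nat \<Rightarrow> (complex ^ ('k option)) set" where
  "MT_hyperplane J l = {s. (\<Sum>j\<in>J. s $ Some j) + s $ None = of_nat (card J) - of_nat l}"

definition MT_hyperplanes :: "(complex ^ ('k::finite option)) set set" where
  "MT_hyperplanes = {MT_hyperplane J l | J l. J \<noteq> {}}"

end

theory Submission
  imports Defs "HOL-Complex_Analysis.Conformal_Mappings" "HOL-Real_Asymp.Real_Asymp"
begin

text \<open>Splitting the \<open>m\<^sub>j\<close> into residue classes reduces the claim to sums over arithmetic
  progressions \<open>t = a\<^sub>j + Q n\<close>. Such a multiple sum is \<open>1 / \<Gamma>(s\<^bsub>k+1\<^esub>)\<close> times the Mellin transform
  at \<open>s\<^bsub>k+1\<^esub>\<close> of \<open>\<Prod>\<^sub>j F\<^sub>j(x, s\<^sub>j)\<close> with \<open>F(x, s) = \<Sum> t\<^sup>-\<^sup>s e\<^sup>-\<^sup>t\<^sup>x\<close>. Near \<open>x = 0\<close>, for generic \<open>s\<close>, the function \<open>F\<close>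
  is a multiple of \<open>x\<^sup>s\<^sup>-\<^sup>1\<close> plus a smooth function. The operator \<open>x d/dx + 1 - s\<close> kills the singular term,
  so \<open>H = (x d/dx + 1 - s) F = (1 - s) F(x, s) - x F(x, s - 1)\<close> stays bounded at \<open>0\<close> for every \<open>s\<close>.
  Let \<open>M\<^sub>A\<close> be the normalised transform of the product in which \<open>F\<^sub>j\<close> is replaced by \<open>H\<^sub>j\<close> for \<open>j \<in> A\<close>.
  Integration by parts expresses \<open>(s\<^bsub>k+1\<^esub> + \<Sum>\<^bsub>j\<notin>A\<^esub> (s\<^sub>j - 1)) M\<^sub>A(s)\<close> by the \<open>M\<^bsub>A\<union>{j}\<^esub>(s)\<close> and by values of
  \<open>M\<^sub>A\<close> with \<open>s\<^bsub>k+1\<^esub>\<close> raised by \<open>1\<close> and some \<open>s\<^sub>i\<close>, \<open>i \<in> A\<close>, lowered by \<open>1\<close>; the latter costs no convergence.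
  Iterating the relation continues \<open>M\<^bsub>{}\<^esub>\<close> to the whole space, and only the linear
  forms defining the hyperplanes are ever divided by.\<close>

section \<open>Holomorphic functions of several variables\<close>

text \<open>\<open>F\<close> is never actually split into a singular and a smooth part: the
  coefficient of x^(s-1) is a multiple of Gamma(1-s), with poles at s = 1, 2, ..., where the two
  parts make sense only together, as a logarithmic term. Using the split would create spurious
  hyperplanes and destroy uniformity in \<open>s\<close>. The operator involves no division, and it
  turns the summand t^(-s) e^(-tx) into the derivative in \<open>t\<close> of t^(1-s) e^(-tx).
  Boundedness of \<open>H\<close> at 0 thus becomes a telescoping argument, with Taylor expansion
  playing the part of the Euler-Maclaurin formula. The hyperplanes arise as follows. The form
  divided by belongs to the set J of factors not yet replaced, and it is evaluated at a translate of
  \<open>s\<close>. A translation raises s_(k+1) by 1 and lowers one s_i by 1, so it changes a form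
  by 0 or 1; the number of times it changed is the parameter \<open>l\<close>.\<close>

definition holomorphic_at :: "(complex ^ 'n \<Rightarrow> complex) \<Rightarrow> complex ^ 'n::finite \<Rightarrow> bool" where
  "holomorphic_at f z \<longleftrightarrow> (\<exists>D. (f has_derivative D) (at z) \<and> (\<forall>c v. D (c *s v) = c * D v))"

lemma holomorphic_several_on_iff:
  "holomorphic_several_on f U \<longleftrightarrow> open U \<and> (\<forall>z\<in>U. holomorphic_at f z)"
  by (simp add: holomorphic_several_on_def holomorphic_at_def)

lemma holomorphic_at_const [intro]: "holomorphic_at (\<lambda>_. c) z"
  unfolding holomorphic_at_def by (intro exI[of _ "\<lambda>_. 0"]) auto

lemma holomorphic_at_coord [intro]: "holomorphic_at (\<lambda>s. s $ i) z"
  unfolding holomorphic_at_def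
  by (intro exI[of _ "\<lambda>s. s $ i"]) (auto intro!: bounded_linear_imp_has_derivative bounded_linear_vec_nth)

lemma holomorphic_at_add [intro]:
  assumes "holomorphic_at f z" "holomorphic_at g z" shows "holomorphic_at (\<lambda>s. f s + g s) z"
proof -
  from assms obtain D E where "(f has_derivative D) (at z)" "\<forall>c v. D (c *s v) = c * D v"
    "(g has_derivative E) (at z)" "\<forall>c v. E (c *s v) = c * E v"
    unfolding holomorphic_at_def by blast
  then show ?thesis unfolding holomorphic_at_def
    by (intro exI[of _ "\<lambda>v. D v + E v"]) (auto intro!: has_derivative_add simp: algebra_simps)
qed

lemma holomorphic_at_mult [intro]:
  assumes "holomorphic_at f z" "holomorphic_at g z" shows "holomorphic_at (\<lambda>s. f s * g s) z"
proof -
  from assms obtain D E where "(f has_derivative D) (at z)" "\<forall>c v. D (c *s v) = c * D v"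
    "(g has_derivative E) (at z)" "\<forall>c v. E (c *s v) = c * E v"
    unfolding holomorphic_at_def by blast
  then show ?thesis unfolding holomorphic_at_def
    by (intro exI[of _ "\<lambda>v. f z * E v + D v * g z"]) (auto intro!: has_derivative_eq_rhs[OF has_derivative_mult] simp: algebra_simps)
qed

lemma holomorphic_at_compose:
  assumes "holomorphic_at f z" "g field_differentiable at (f z)" shows "holomorphic_at (\<lambda>s. g (f s)) z"
proof -
  from assms obtain D d where D: "(f has_derivative D) (at z)" "\<forall>c v. D (c *s v) = c * D v"
    and d: "(g has_field_derivative d) (at (f z))"
    unfolding holomorphic_at_def field_differentiable_def by blast
  have "((\<lambda>s. g (f s)) has_derivative (\<lambda>v. d * D v)) (at z)"
    using has_derivative_compose[OF D(1) d[unfolded has_field_derivative_def]] by simp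
  then show ?thesis unfolding holomorphic_at_def using D(2)
    by (intro exI[of _ "\<lambda>v. d * D v"]) (auto simp: algebra_simps)
qed

lemma holomorphic_at_uminus [intro]: "holomorphic_at f z \<Longrightarrow> holomorphic_at (\<lambda>s. - f s) z"
  using holomorphic_at_mult[OF holomorphic_at_const[of "-1"], of f z] by simp

lemma holomorphic_at_diff [intro]: "holomorphic_at f z \<Longrightarrow> holomorphic_at g z \<Longrightarrow> holomorphic_at (\<lambda>s. f s - g s) z"
  using holomorphic_at_add[OF _ holomorphic_at_uminus, of f z g] by simp

lemma holomorphic_at_divide:
  assumes "holomorphic_at f z" "holomorphic_at g z" "g z \<noteq> 0" shows "holomorphic_at (\<lambda>s. f s / g s) z"
proof -
  have "inverse field_differentiable at (g z)"
    using assms(3) by (auto intro!: derivative_intros field_differentiable_inverse)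
  from holomorphic_at_mult[OF assms(1) holomorphic_at_compose[OF assms(2) this]]
  show ?thesis by (simp add: divide_inverse)
qed

lemma holomorphic_at_sum [intro]: "(\<And>i. i \<in> I \<Longrightarrow> holomorphic_at (f i) z) \<Longrightarrow> holomorphic_at (\<lambda>s. \<Sum>i\<in>I. f i s) z"
  by (induction I rule: infinite_finite_induct) auto

lemma holomorphic_at_prod [intro]: "(\<And>i. i \<in> I \<Longrightarrow> holomorphic_at (f i) z) \<Longrightarrow> holomorphic_at (\<lambda>s. \<Prod>i\<in>I. f i s) z"
  by (induction I rule: infinite_finite_induct) auto

lemma holomorphic_at_shift:
  assumes "holomorphic_at f (z + c)" shows "holomorphic_at (\<lambda>s. f (s + c)) z"
proof -
  from assms obtain D where D: "(f has_derivative D) (at (z + c))" "\<forall>c v. D (c *s v) = c * D v"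
    unfolding holomorphic_at_def by blast
  have "((\<lambda>s. s + c) has_derivative (\<lambda>v. v)) (at z)" by (auto intro!: derivative_eq_intros)
  from has_derivative_compose[OF this D(1)] D(2) show ?thesis
    unfolding holomorphic_at_def by blast
qed

lemma holomorphic_at_transform_open:
  assumes "holomorphic_at f z" "open U" "z \<in> U" "\<And>s. s \<in> U \<Longrightarrow> f s = g s" shows "holomorphic_at g z"
  using assms has_derivative_transform_within_open[of f _ z UNIV U g] unfolding holomorphic_at_def by blast

lemma holomorphic_at_isCont: "holomorphic_at f z \<Longrightarrow> isCont f z"
  unfolding holomorphic_at_def using has_derivative_continuous by blast

lemma norm_smult_vec: "norm (c *s v) = norm c * norm (v :: complex ^ 'n::finite)"
  by (simp add: norm_vec_def L2_set_right_distrib norm_mult)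

lemma has_derivative_line: "((\<lambda>w. p + w *s (v :: complex ^ 'n::finite)) has_derivative (\<lambda>w. w *s v)) (at (z::complex))"
proof -
  have "bounded_linear (\<lambda>w::complex. w *s v)"
    by (rule bounded_linear_intro[where K="norm v"])
       (auto simp: vec_eq_iff algebra_simps norm_smult_vec)
  from bounded_linear_imp_has_derivative[OF this] show ?thesis
    by (auto intro!: derivative_eq_intros)
qed

lemma holomorphic_at_line:
  fixes f :: "complex ^ 'n::finite \<Rightarrow> complex"
  assumes "(f has_derivative D) (at (p + z *s v))" "\<And>c v. D (c *s v) = c * D v"
  shows "((\<lambda>w. f (p + w *s v)) has_field_derivative D v) (at z)"
proof -
  have "D (w *s v) = D v * w" for w by (simp add: assms(2))
  with has_derivative_compose[OF has_derivative_line assms(1)] show ?thesis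
    unfolding has_field_derivative_def by (simp only:)
qed

lemma holomorphic_at_line_fd:
  assumes "holomorphic_at f (p + z *s v)"
  shows "(\<lambda>w. f (p + w *s v)) field_differentiable (at z)"
  using assms holomorphic_at_line unfolding holomorphic_at_def field_differentiable_def by blast

text \<open>A quadratic bound on the Taylor remainder that is proportional to a bound of the function
  can be integrated over a parameter; this gives differentiability under the integral.\<close>

lemma second_order_bound_disc:
  fixes g :: "complex \<Rightarrow> complex"
  assumes "r > 0" "g holomorphic_on ball 0 (4 * r)" "\<And>z. z \<in> ball 0 (4 * r) \<Longrightarrow> norm (g z) \<le> b"
    "(g has_field_derivative d) (at 0)" "norm z \<le> r"
  shows "norm (g z - g 0 - d * z) \<le> 2 * b / r\<^sup>2 * (norm z)\<^sup>2" "norm d \<le> b / r"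
proof -
  have hol: "g holomorphic_on ball w r" "continuous_on (cball w r) g" if "norm w \<le> r" for w
  proof -
    \<comment> \<open>The radius \<open>4 * r\<close> leaves room for a circle of radius
      \<open>r\<close> about every \<open>w\<close> with \<open>norm w \<le> r\<close>, as the
      Cauchy estimates below require.\<close>
    have s: "cball w r \<subseteq> ball 0 (4*r)"
    proof
      fix x assume "x \<in> cball w r"
      then have "norm (x - w) \<le> r" by (simp add: dist_norm norm_minus_commute)
      then have "norm x \<le> 2 * r" using that norm_triangle_ineq[of "x - w" w] by simp
      then show "x \<in> ball 0 (4 * r)" using assms(1) by simp
    qed
    show "continuous_on (cball w r) g"
      using assms(2) s holomorphic_on_imp_continuous_on continuous_on_subset by blast
    show "g holomorphic_on ball w r"
      using assms(2) s ball_subset_cball holomorphic_on_subset by (metis order_trans)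
  qed
  have C: "norm ((deriv ^^ n) g w) \<le> fact n * b / r ^ n" if "norm w \<le> r" for n w
  proof (rule Cauchy_inequality[OF hol[OF that] assms(1)])
    fix x assume "norm (w - x) = r"
    then have "norm x \<le> 2 * r" using that norm_triangle_ineq4[of w "w - x"] by simp
    then show "norm (g x) \<le> b" using assms(1,3) by simp
  qed
  have d: "d = deriv g 0" using assms(4) DERIV_imp_deriv by metis
  show "norm d \<le> b / r" using C[of 0 1] assms(1) d by simp
  have "norm ((deriv ^^ 0) g z - (\<Sum>i\<le>1. (deriv ^^ i) g 0 * (z - 0) ^ i / fact i)) \<le> (fact 2 * b / r ^ 2) * norm (z - 0) ^ Suc 1 / fact 1"
  proof (rule complex_Taylor[of "cball 0 r" 1 "\<lambda>i. (deriv ^^ i) g"])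
    fix i w assume "w \<in> cball (0::complex) r"
    then have "w \<in> ball 0 (4*r)" using assms(1) by auto
    then have "(deriv ^^ i) g field_differentiable at w"
      using assms(2) holomorphic_higher_deriv[of g "ball 0 (4*r)" i] holomorphic_on_imp_differentiable_at by blast
    then show "((deriv ^^ i) g has_field_derivative (deriv ^^ Suc i) g w) (at w within cball 0 r)"
      using field_differentiable_derivI has_field_derivative_at_within by fastforce
  next
    fix w assume "w \<in> cball (0::complex) r" then show "norm ((deriv ^^ Suc 1) g w) \<le> fact 2 * b / r ^ 2"
      using C[of w 2] by (simp add: numeral_2_eq_2)
  qed (use assms in auto)
  then show "norm (g z - g 0 - d * z) \<le> 2 * b / r\<^sup>2 * (norm z)\<^sup>2"
    using d by (simp add: power2_eq_square algebra_simps)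
qed

text \<open>Restriction to the complex line through \<open>p\<close> in the unit direction of
  \<open>v\<close> reduces this to one variable. Complex linearity of \<open>D\<close> makes
  \<open>D u\<close> the derivative of the restriction and carries the bounds back to
  \<open>D v\<close>.\<close>

lemma second_order_bound:
  fixes f :: "complex ^ 'n::finite \<Rightarrow> complex"
  assumes r: "r > 0" and hol: "\<And>s. s \<in> ball p (4 * r) \<Longrightarrow> holomorphic_at f s"
    and bd: "\<And>s. s \<in> ball p (4 * r) \<Longrightarrow> norm (f s) \<le> b"
    and D: "(f has_derivative D) (at p)" "\<And>c v. D (c *s v) = c * D v"
  shows "norm v \<le> r \<Longrightarrow> norm (f (p + v) - f p - D v) \<le> 2 * b / r\<^sup>2 * (norm v)\<^sup>2" "norm (D v) \<le> b / r * norm v"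
proof -
  have b: "b \<ge> 0" using bd[of p] r norm_ge_zero[of "f p"] by (simp del: norm_ge_zero)
  have D0: "D 0 = 0" using D(2)[of 0 0] by simp
  have *: "(norm v \<le> r \<longrightarrow> norm (f (p + v) - f p - D v) \<le> 2 * b / r\<^sup>2 * (norm v)\<^sup>2) \<and> norm (D v) \<le> b / r * norm v"
  proof (cases "v = 0")
    case True then show ?thesis using b r D0 by simp
  next
    case False
    define u where "u = (1 / complex_of_real (norm v)) *s v"
    have nu: "norm u = 1" using False by (simp add: u_def norm_smult_vec norm_divide)
    have v: "v = complex_of_real (norm v) *s u" using False by (simp add: u_def vec_eq_iff)
    define g where "g = (\<lambda>w. f (p + w *s u))"
    have in_ball: "p + w *s u \<in> ball p (4 * r)" if "w \<in> ball 0 (4 * r)" for w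
      using that nu by (simp add: dist_norm norm_smult_vec)
    have g: "g holomorphic_on ball 0 (4 * r)"
      unfolding g_def holomorphic_on_def
      by (intro ballI field_differentiable_at_within[OF holomorphic_at_line_fd] hol in_ball)
    have gd: "(g has_field_derivative D u) (at 0)"
      unfolding g_def by (rule holomorphic_at_line) (use D in auto)
    have gb: "norm (g w) \<le> b" if "w \<in> ball 0 (4 * r)" for w
      unfolding g_def using bd in_ball that by blast
    have Dv: "D v = D u * complex_of_real (norm v)" 
      using arg_cong[OF v, of D] unfolding D(2) by (simp only: mult.commute)
    have "norm (D v) \<le> b / r * norm v"
      using mult_right_mono[OF second_order_bound_disc(2)[OF r g gb gd, of 0] norm_ge_zero[of v]] r
      unfolding Dv norm_mult by simp
    moreover have "norm (f (p + v) - f p - D v) \<le> 2 * b / r\<^sup>2 * (norm v)\<^sup>2" if "norm v \<le> r"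
      using second_order_bound_disc(1)[OF r g gb gd, of "complex_of_real (norm v)"] that
      unfolding Dv by (simp add: g_def v[symmetric])
    ultimately show ?thesis by blast
  qed
  then show "norm v \<le> r \<Longrightarrow> norm (f (p + v) - f p - D v) \<le> 2 * b / r\<^sup>2 * (norm v)\<^sup>2" "norm (D v) \<le> b / r * norm v" by auto
qed

lemma norm_integral_le:
  fixes f :: "'a \<Rightarrow> complex"
  assumes "integrable M f" "integrable M g" "\<And>x. norm (f x) \<le> g x"
  shows "norm (integral\<^sup>L M f) \<le> integral\<^sup>L M g"
proof -
  have "norm (integral\<^sup>L M f) \<le> integral\<^sup>L M (\<lambda>x. norm (f x))" by (rule integral_norm_bound)
  also have "\<dots> \<le> integral\<^sup>L M g" by (rule integral_mono) (use assms in auto)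
  finally show ?thesis .
qed

text \<open>The candidate derivative is the integral of the pointwise derivatives. The remainder
  bound is linear in \<open>b x\<close>, so integrating it bounds the remainder of the integral by
  \<open>2 * B / q\<^sup>2 * (norm v)\<^sup>2\<close>; bounds on the derivatives come from Cauchy's
  estimates instead of hypotheses.\<close>

lemma holomorphic_at_integral:
  fixes \<phi> :: "'a \<Rightarrow> complex ^ 'n::finite \<Rightarrow> complex"
  assumes r: "r > 0" and hol: "\<And>x s. s \<in> ball p r \<Longrightarrow> holomorphic_at (\<phi> x) s"
    and meas: "\<And>s. s \<in> ball p r \<Longrightarrow> (\<lambda>x. \<phi> x s) \<in> borel_measurable M"
    and bd: "\<And>x s. s \<in> ball p r \<Longrightarrow> norm (\<phi> x s) \<le> b x"
    and b: "integrable M b"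
  shows "holomorphic_at (\<lambda>s. integral\<^sup>L M (\<lambda>x. \<phi> x s)) p"
proof -
  define q where "q = r / 4"
  have q: "q > 0" "4 * q = r" using r by (auto simp: q_def)
  have "\<forall>x. \<exists>D. (\<phi> x has_derivative D) (at p) \<and> (\<forall>c v. D (c *s v) = c * D v)"
    using hol[of p] r by (auto simp: holomorphic_at_def)
  then obtain D where D: "\<And>x. (\<phi> x has_derivative D x) (at p)" "\<And>x c v. D x (c *s v) = c * D x v"
    by metis
  have lin: "linear (D x)" for x using D(1) has_derivative_linear by blast
  have sb: "norm v \<le> q \<Longrightarrow> norm (\<phi> x (p + v) - \<phi> x p - D x v) \<le> 2 * b x / q\<^sup>2 * (norm v)\<^sup>2"
    "norm (D x v) \<le> b x / q * norm v" for x v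
    using second_order_bound[OF q(1), of p "\<phi> x" "b x" "D x" v] hol bd D q by auto
  have int: "integrable M (\<lambda>x. \<phi> x s)" if "s \<in> ball p r" for s
    by (rule Bochner_Integration.integrable_bound[OF b meas[OF that]])
       (use bd[OF that] in \<open>auto intro!: AE_I2 order_trans[OF _ abs_ge_self]\<close>)
  \<comment> \<open>Measurability of \<open>D x v\<close> in \<open>x\<close> is inherited from
    difference quotients along a null sequence \<open>h\<close>, scaled so that the points at which
    they are taken stay in the ball.\<close>
  have measD: "(\<lambda>x. D x v) \<in> borel_measurable M" for v
  proof (cases "v = 0")
    case True then show ?thesis using lin by (simp add: linear_0)
  next
    case False
    define h where "h n = q / norm v / real (Suc n)" for n
    have h: "h n > 0" "h n * norm v \<le> q" for n using q False by (auto simp: h_def divide_simps)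
    have h0: "h \<longlonglongrightarrow> 0" unfolding h_def by real_asymp
    have inb: "p + of_real (h n) *s v \<in> ball p r" for n
      using h[of n] q by (simp add: dist_norm norm_smult_vec)
    show ?thesis
    proof (rule borel_measurable_LIMSEQ_metric)
      show "(\<lambda>x. (\<phi> x (p + of_real (h n) *s v) - \<phi> x p) / of_real (h n)) \<in> borel_measurable M" for n
        using meas[OF inb] meas[of p] r by (intro borel_measurable_divide borel_measurable_diff) auto
      fix x
      have fd: "((\<lambda>w. \<phi> x (p + w *s v)) has_field_derivative D x v) (at 0)"
        by (rule holomorphic_at_line) (use D in auto)
      have "filterlim (\<lambda>n. complex_of_real (h n)) (at 0) sequentially"
        using tendsto_of_real[OF h0, where 'a=complex] h(1)
        by (auto simp: filterlim_at intro!: eventuallyI) (metis less_irrefl)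
      from filterlim_compose[OF fd[unfolded has_field_derivative_iff] this]
      show "(\<lambda>n. (\<phi> x (p + of_real (h n) *s v) - \<phi> x p) / of_real (h n)) \<longlonglongrightarrow> D x v" by simp
    qed
  qed
  have intD: "integrable M (\<lambda>x. D x v)" for v
    by (rule Bochner_Integration.integrable_bound[of M "\<lambda>x. b x / q * norm v"])
       (use b measD sb(2)[THEN order_trans[OF _ abs_ge_self]] in auto)
  define E where "E v = integral\<^sup>L M (\<lambda>x. D x v)" for v
  define B where "B = integral\<^sup>L M b"
  have nE: "norm (E v) \<le> B / q * norm v" for v
  proof -
    have "norm (E v) \<le> integral\<^sup>L M (\<lambda>x. b x / q * norm v)"
      unfolding E_def by (rule norm_integral_le) (use intD b sb in auto)
    then show ?thesis by (simp add: B_def)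
  qed
  have Elin: "bounded_linear E"
  proof (rule bounded_linear_intro)
    show "E (x + y) = E x + E y" for x y unfolding E_def linear_add[OF lin] by (rule Bochner_Integration.integral_add[OF intD intD])
    show "E (c *\<^sub>R x) = c *\<^sub>R E x" for c x unfolding E_def linear_scale[OF lin] by (rule integral_scaleR_right)
    show "norm (E x) \<le> norm x * (B / q)" for x using nE[of x] by (simp add: mult.commute)
  qed
  define f where "f s = integral\<^sup>L M (\<lambda>x. \<phi> x s)" for s
  have est: "norm (f (p + v) - f p - E v) \<le> 2 * B / q\<^sup>2 * (norm v)\<^sup>2" if "norm v \<le> q" for v
  proof -
    have pv: "p + v \<in> ball p r" using that q by (simp add: dist_norm)
    have p: "p \<in> ball p r" using r by simp
    have int1: "integrable M (\<lambda>x. \<phi> x (p + v) - \<phi> x p)"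
      by (rule Bochner_Integration.integrable_diff[OF int[OF pv] int[OF p]])
    have "f (p + v) - f p - E v = integral\<^sup>L M (\<lambda>x. \<phi> x (p + v) - \<phi> x p - D x v)"
      unfolding f_def E_def Bochner_Integration.integral_diff[OF int1 intD]
        Bochner_Integration.integral_diff[OF int[OF pv] int[OF p]] ..
    also have "norm \<dots> \<le> integral\<^sup>L M (\<lambda>x. 2 * b x / q\<^sup>2 * (norm v)\<^sup>2)"
    proof (rule norm_integral_le)
      show "integrable M (\<lambda>x. 2 * b x / q\<^sup>2 * (norm v)\<^sup>2)" using b by simp
    qed (use sb(1)[OF that] in \<open>auto intro!: Bochner_Integration.integrable_diff int1 intD\<close>)
    finally show ?thesis by (simp add: B_def)
  qed
  have "(f has_derivative E) (at p)"
    unfolding has_derivative_at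
  proof (intro conjI Elin)
    have l0: "((\<lambda>h. 2 * B / q\<^sup>2 * norm h) \<longlongrightarrow> 0) (at (0 :: complex ^ 'n))" 
      by (rule tendsto_eq_intros refl tendsto_norm_zero)+ simp
    show "(\<lambda>h. norm (f (p + h) - f p - E h) / norm h) \<midarrow>0\<rightarrow> 0"
    proof (rule real_tendsto_sandwich[OF _ _ tendsto_const l0])
      show "\<forall>\<^sub>F h in at 0. norm (f (p + h) - f p - E h) / norm h \<le> 2 * B / q\<^sup>2 * norm h"
        unfolding eventually_at
      proof (intro exI[of _ q] conjI ballI impI q(1))
        fix h :: "complex ^ 'n" assume "h \<noteq> 0 \<and> dist h 0 < q"
        then show "norm (f (p + h) - f p - E h) / norm h \<le> 2 * B / q\<^sup>2 * norm h"
          using est[of h] by (simp add: divide_le_eq power2_eq_square mult.assoc)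
      qed
    qed (rule always_eventually, simp)
  qed
  moreover have "E (c *s v) = c * E v" for c v unfolding E_def by (simp add: D(2))
  ultimately show ?thesis unfolding holomorphic_at_def f_def by blast
qed

section \<open>Exponential sums over an arithmetic progression\<close>

text \<open>The \<open>i\<close>-th derivative in \<open>t\<close> of t^(1-s) e^(-tw).
  Differentiating the power only replaces \<open>s\<close> by \<open>s + 1\<close> and gives the
  factor \<open>1 - s\<close>, so the recursion stays within one family and permits induction on
  \<open>i\<close> for all \<open>s\<close> at once.\<close>

fun psi_deriv :: "nat \<Rightarrow> complex \<Rightarrow> complex \<Rightarrow> complex \<Rightarrow> complex" where
  "psi_deriv 0 s w t = t powr (1 - s) * exp (- (t * w))"
| "psi_deriv (Suc i) s w t = (1 - s) * psi_deriv i (s + 1) w t - w * psi_deriv i s w t"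

lemma psi_deriv_has_field_derivative:
  assumes "t \<notin> \<real>\<^sub>\<le>\<^sub>0"
  shows "(psi_deriv i s w has_field_derivative psi_deriv (Suc i) s w t) (at t)"
proof (induction i arbitrary: s)
  case 0
  have "t \<noteq> 0" using assms by auto
  then have *: "t powr (1 - s) / t = t powr (- s)" by (simp add: powr_diff powr_minus divide_inverse)
  show ?case using assms * unfolding psi_deriv.simps(1)[abs_def]
    by (auto intro!: derivative_eq_intros simp: powr_diff powr_minus field_simps)
next
  case (Suc i)
  show ?case unfolding psi_deriv.simps(2)[of i s w, abs_def]
    by (rule derivative_eq_intros Suc refl)+ simp
qed

lemma power_le_fact_exp: "0 \<le> (u::real) \<Longrightarrow> u ^ n \<le> fact n * exp u"
proof -
  assume u: "0 \<le> u"
  have "u ^ n /\<^sub>R fact n \<le> (\<Sum>k. u ^ k /\<^sub>R fact k)"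
    using sum_le_suminf[OF sums_summable[OF exp_converges[of u]], of "{n}"] u by simp
  then have "u ^ n / fact n \<le> exp u" using exp_converges[of u] by (simp add: sums_iff divide_inverse mult.commute)
  then show ?thesis by (simp add: divide_le_eq mult.commute)
qed

lemma norm_psi_deriv_0: "t > 0 \<Longrightarrow> norm (psi_deriv 0 s (of_real x) (of_real t)) = t powr (1 - Re s) * exp (- (t * x))"
  by (simp add: norm_mult norm_powr_real_powr)

text \<open>Each differentiation gains a factor 1/t, either from the power or by writing
  \<open>x\<close> as (t x)/t. The second case accounts for the polynomial in \<open>t * x\<close>,
  which the exponential can absorb. The constant is therefore independent of \<open>x\<close>, as is
  needed for \<open>x\<close> tending to 0.\<close>

lemma norm_psi_deriv_le:
  assumes R: "R \<ge> 0"
  shows "\<exists>C\<ge>0. \<forall>s x t. norm s \<le> R \<longrightarrow> t \<ge> 1 \<longrightarrow> x > 0 \<longrightarrow>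
    norm (psi_deriv i s (of_real x) (of_real t)) \<le> C * t powr (1 - Re s - real i) * (1 + t * x) ^ i * exp (- (t * x))"
  using R
proof (induction i arbitrary: R)
  case 0
  show ?case by (intro exI[of _ 1]) (auto simp: norm_mult norm_powr_real_powr)
next
  case (Suc i)
  obtain C1 C2 where C1: "C1 \<ge> 0" "\<And>s x t. norm s \<le> R + 1 \<Longrightarrow> t \<ge> 1 \<Longrightarrow> x > 0 \<Longrightarrow>
    norm (psi_deriv i s (of_real x) (of_real t)) \<le> C1 * t powr (1 - Re s - real i) * (1 + t * x) ^ i * exp (- (t * x))"
    and C2: "C2 \<ge> 0" "\<And>s x t. norm s \<le> R \<Longrightarrow> t \<ge> 1 \<Longrightarrow> x > 0 \<Longrightarrow>
    norm (psi_deriv i s (of_real x) (of_real t)) \<le> C2 * t powr (1 - Re s - real i) * (1 + t * x) ^ i * exp (- (t * x))"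
    using Suc.IH[of "R + 1"] Suc.IH[of R] Suc.prems by auto
  show ?case
  proof (intro exI[of _ "(1 + R) * C1 + C2"] conjI allI impI)
    show "0 \<le> (1 + R) * C1 + C2" using C1 C2 Suc.prems by simp
    fix s x t assume s: "norm (s::complex) \<le> R" and t: "t \<ge> (1::real)" and x: "x > (0::real)"
    define P where "P = t powr (1 - Re s - real (Suc i))"
    define E where "E = (1 + t * x) ^ i * exp (- (t * x))"
    have E: "E \<ge> 0" "P \<ge> 0" using t x by (simp_all add: E_def P_def)
    have tx: "t * x \<ge> 0" using t x by simp
    have P1: "t powr (1 - Re (s + 1) - real i) = P" by (simp add: P_def algebra_simps)
    have P2: "t powr (1 - Re s - real i) = t * P"
      using t by (simp add: P_def powr_diff powr_add powr_mult_base field_simps)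
    have s1: "norm (s + 1) \<le> R + 1" using norm_triangle_ineq[of s 1] s by simp
    have s2: "norm (1 - s) \<le> 1 + R" using norm_triangle_ineq4[of 1 s] s by simp
    have "norm (psi_deriv (Suc i) s (of_real x) (of_real t)) \<le>
      norm (1 - s) * norm (psi_deriv i (s + 1) (of_real x) (of_real t)) + x * norm (psi_deriv i s (of_real x) (of_real t))"
      using x by (auto simp: norm_mult intro!: order_trans[OF norm_triangle_ineq4])
    also have "\<dots> \<le> (1 + R) * (C1 * P * E) + x * (C2 * (t * P) * E)"
      using C1(2)[OF s1 t x] C2(2)[OF s t x] s2 x Suc.prems unfolding P1 P2 E_def
      by (intro add_mono mult_mono) (auto simp: mult.assoc)
    also have "\<dots> = ((1 + R) * C1 + C2 * (t * x)) * (P * E)" by (simp add: algebra_simps)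
    also have "\<dots> \<le> (((1 + R) * C1 + C2) * (1 + t * x)) * (P * E)"
      using E C1(1) C2(1) Suc.prems tx by (intro mult_right_mono) (auto simp: algebra_simps)
    finally show "norm (psi_deriv (Suc i) s (of_real x) (of_real t)) \<le>
      ((1 + R) * C1 + C2) * t powr (1 - Re s - real (Suc i)) * (1 + t * x) ^ Suc i * exp (- (t * x))"
      by (simp add: P_def E_def mult_ac)
  qed
qed

locale progression =
  fixes a Q :: nat
  assumes a_ge: "a \<ge> 1" and Q_ge: "Q \<ge> 1"
begin

definition node :: "nat \<Rightarrow> real" where "node n = real (a + Q * n)"

definition S :: "nat \<Rightarrow> complex \<Rightarrow> complex \<Rightarrow> complex" where
  "S i s w = (\<Sum>n. psi_deriv i s w (of_real (node n)))"

text \<open>The index \<open>s + 1\<close> makes the summands t^(-s) e^(-tx), while \<open>H\<close>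
  sums derivatives of t^(1-s) e^(-tx), so both belong to the same parameter
  \<open>s\<close>.\<close>

definition F :: "real \<Rightarrow> complex \<Rightarrow> complex" where "F x s = S 0 (s + 1) (of_real x)"

definition H :: "real \<Rightarrow> complex \<Rightarrow> complex" where "H x s = S 1 s (of_real x)"

lemma node_ge: "node n \<ge> real (Suc n)"
proof -
  have "1 * n \<le> Q * n" using Q_ge by (intro mult_right_mono) auto
  then have "Suc n \<le> a + Q * n" using a_ge by linarith
  then show ?thesis unfolding node_def by (simp only: of_nat_le_iff)
qed

lemma node_ge_1: "node n \<ge> 1" using node_ge[of n] by simp

lemma node_pos: "node n > 0" using node_ge_1[of n] by simp

lemma node_Suc: "node (Suc n) = node n + real Q" by (simp add: node_def)

lemma summable_node: "summable (\<lambda>n. node n powr (-2))"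
proof (rule summable_comparison_test'[of "\<lambda>n. 1 / real (Suc n) ^ 2" 0])
  show "summable (\<lambda>n. 1 / real (Suc n) ^ 2)"
    using inverse_power_summable[of 2] summable_Suc_iff[of "\<lambda>n. inverse (real n ^ 2)"] by (simp add: inverse_eq_divide)
  show "norm (node n powr (-2)) \<le> 1 / real (Suc n) ^ 2" for n
    using node_ge[of n] node_pos[of n]
    by (simp add: powr_minus powr_numeral divide_inverse power_mono)
qed

text \<open>Half of the exponential absorbs the \<open>\<kappa>\<close>-th power of \<open>t\<close>
  at the cost of the same power of 1/x; the other half leaves decay in \<open>x\<close>, because
  \<open>t \<ge> 1\<close>. The remaining exponent -2 is summable over the nodes. So
  \<open>\<kappa>\<close> measures how far \<open>s\<close> lies to the left and, with it, the order
  of blow-up at 0.\<close>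

lemma norm_term_le:
  assumes "Re s \<ge> 2 - real \<kappa>" "Re w > 0"
  shows "norm (psi_deriv 0 (s + 1) w (of_real (node n))) \<le>
     fact \<kappa> * 2 ^ \<kappa> / Re w ^ \<kappa> * exp (- (Re w / 2)) * node n powr (-2)"
proof -
  define x where "x = Re w"
  define t where "t = node n"
  have t: "t \<ge> 1" and x: "x > 0" using node_ge_1 assms by (auto simp: t_def x_def)
  have "norm (psi_deriv 0 (s + 1) w (of_real t)) = t powr (- Re s) * exp (- (t * x))"
    using t by (simp add: norm_mult norm_powr_real_powr x_def)
  also have "t powr (- Re s) \<le> t powr (real \<kappa> - 2)" using t assms by (intro powr_mono) auto
  also have "t powr (real \<kappa> - 2) = t ^ \<kappa> * t powr (-2)" using t by (simp add: powr_diff powr_realpow powr_minus divide_inverse)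
  also have "exp (- (t * x)) = exp (- (t * x / 2)) * exp (- (t * x / 2))" by (simp flip: exp_add)
  also have "\<dots> \<le> exp (- (t * x / 2)) * exp (- (x / 2))" using t x by simp
  also have "t ^ \<kappa> * t powr (-2) * (exp (- (t * x / 2)) * exp (- (x / 2))) =
      (t * x / 2) ^ \<kappa> * exp (- (t * x / 2)) * (2 ^ \<kappa> / x ^ \<kappa> * exp (- (x / 2)) * t powr (-2))"
    using x by (simp add: power_mult_distrib power_divide field_simps)
  also have "\<dots> \<le> fact \<kappa> * (2 ^ \<kappa> / x ^ \<kappa> * exp (- (x / 2)) * t powr (-2))"
  proof (rule mult_right_mono)
    have "(t * x / 2) ^ \<kappa> * exp (- (t * x / 2)) \<le> (fact \<kappa> * exp (t * x / 2)) * exp (- (t * x / 2))"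
      using power_le_fact_exp[of "t * x / 2" \<kappa>] t x by (intro mult_right_mono) auto
    then show "(t * x / 2) ^ \<kappa> * exp (- (t * x / 2)) \<le> fact \<kappa>" by (simp add: mult.assoc flip: exp_add)
  qed (use x in auto)
  finally show ?thesis using t x by (simp add: t_def x_def mult_ac mult_right_mono)
qed

lemma obtain_kappa: obtains \<kappa> :: nat where "Re s \<ge> 2 - real \<kappa>"
  using real_arch_simple[of "2 - Re s"] by (metis diff_le_eq add.commute)

lemma summable_term: "Re w > 0 \<Longrightarrow> summable (\<lambda>n. psi_deriv i s w (of_real (node n)))"
proof (induction i arbitrary: s)
  case 0
  obtain \<kappa> where "Re (s - 1) \<ge> 2 - real \<kappa>" by (rule obtain_kappa)
  from norm_term_le[OF this 0] show ?case
    by (intro summable_comparison_test'[OF summable_mult[OF summable_node]]) (simp only: diff_add_cancel)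
next
  case (Suc i)
  then show ?case by (auto intro!: summable_diff summable_mult)
qed

lemma S_Suc: "Re w > 0 \<Longrightarrow> S (Suc i) s w = (1 - s) * S i (s + 1) w - w * S i s w"
  unfolding S_def psi_deriv.simps
  by (subst suminf_diff[symmetric]) (auto intro!: summable_mult summable_term simp: suminf_mult summable_term)

lemma H_eq: "x > 0 \<Longrightarrow> H x s = (1 - s) * F x s - of_real x * F x (s - 1)"
  unfolding H_def F_def One_nat_def by (subst S_Suc) auto

definition Z2 :: real where "Z2 = (\<Sum>n. node n powr (-2))"

lemma Z2_nonneg: "Z2 \<ge> 0" unfolding Z2_def by (intro suminf_nonneg summable_node) auto

lemma norm_F_le:
  assumes "Re s \<ge> 2 - real \<kappa>" "x > 0"
  shows "norm (F x s) \<le> fact \<kappa> * 2 ^ \<kappa> * Z2 / x ^ \<kappa> * exp (- (x / 2))"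
proof -
  have x: "Re (of_real x) > 0" using assms by simp
  have "norm (F x s) \<le> (\<Sum>n. fact \<kappa> * 2 ^ \<kappa> / x ^ \<kappa> * exp (- (x / 2)) * node n powr (-2))"
    unfolding F_def S_def using norm_term_le[OF assms(1) x]
    by (intro norm_suminf_le summable_mult summable_node) auto
  also have "\<dots> = fact \<kappa> * 2 ^ \<kappa> / x ^ \<kappa> * exp (- (x / 2)) * Z2"
    unfolding Z2_def by (rule suminf_mult[OF summable_node])
  finally show ?thesis by (simp add: mult_ac)
qed

lemma F_holomorphic: "x > 0 \<Longrightarrow> F x holomorphic_on UNIV"
proof -
  assume x: "x > 0"
  have "F x holomorphic_on {s. Re s > 2 - real \<kappa>}" for \<kappa>
  proof (rule holomorphic_uniform_sequence[where f = "\<lambda>N s. \<Sum>n<N. psi_deriv 0 (s + 1) (of_real x) (of_real (node n))"])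
    show op: "open {s. 2 - real \<kappa> < Re s}" by (rule open_halfspace_Re_gt)
    show "(\<lambda>s. \<Sum>n<N. psi_deriv 0 (s + 1) (of_real x) (of_real (node n))) holomorphic_on {s. 2 - real \<kappa> < Re s}" for N
      using node_pos by (auto intro!: holomorphic_intros simp: less_imp_neq[symmetric])
    fix s assume "s \<in> {s. 2 - real \<kappa> < Re s}"
    then obtain d where d: "d > 0" "cball s d \<subseteq> {s. 2 - real \<kappa> < Re s}" using op open_contains_cball by blast
    have "uniform_limit (cball s d) (\<lambda>N s. \<Sum>n<N. psi_deriv 0 (s + 1) (of_real x) (of_real (node n))) (F x) sequentially"
      unfolding F_def[abs_def] S_def
    proof (rule Weierstrass_m_test)
      show "norm (psi_deriv 0 (z + 1) (of_real x) (of_real (node n))) \<le> 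
        fact \<kappa> * 2 ^ \<kappa> / x ^ \<kappa> * exp (- (x / 2)) * node n powr (-2)" if "z \<in> cball s d" for n z
        using norm_term_le[of \<kappa> z "of_real x" n] that d(2) x by force
    qed (intro summable_mult summable_node)
    with d show "\<exists>d>0. cball s d \<subseteq> {s. 2 - real \<kappa> < Re s} \<and>
       uniform_limit (cball s d) (\<lambda>N s. \<Sum>n<N. psi_deriv 0 (s + 1) (of_real x) (of_real (node n))) (F x) sequentially" by blast
  qed
  moreover have "\<exists>\<kappa>::nat. s \<in> {s. Re s > 2 - real \<kappa>}" for s
    using reals_Archimedean2[of "2 - Re s"] by (auto simp: algebra_simps)
  ultimately show ?thesis
    by (subst holomorphic_on_open, simp) (metis holomorphic_on_open open_halfspace_Re_gt)
qed

text \<open>Termwise differentiation in a complex \<open>w\<close>, on a half-plane that stays away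
  from the imaginary axis so that \<open>norm_term_le\<close> gives a bound uniform in
  \<open>w\<close>.\<close>

lemma S0_has_field_derivative:
  assumes "Re w > 0"
  shows "(S 0 s has_field_derivative - S 0 (s - 1) w) (at w)"
proof -
  define d where "d = Re w / 2"
  define A where "A = {z. Re z > d}"
  have d: "d > 0" "w \<in> A" using assms by (auto simp: d_def A_def)
  have op: "open A" unfolding A_def by (rule open_halfspace_Re_gt)
  have cv: "convex A" unfolding A_def by (rule convex_halfspace_Re_gt)
  obtain \<kappa> where k: "Re (s - 2) \<ge> 2 - real \<kappa>" by (rule obtain_kappa)
  have u: "uniformly_convergent_on A (\<lambda>N w. \<Sum>n<N. - psi_deriv 0 (s - 1) w (of_real (node n)))"
  proof (rule Weierstrass_m_test')
    show "norm (- psi_deriv 0 (s - 1) z (of_real (node n))) \<le>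
       fact \<kappa> * 2 ^ \<kappa> / d ^ \<kappa> * node n powr (-2)" if "z \<in> A" for n z
    proof -
      have z: "Re z > d" using that by (simp add: A_def)
      have "norm (psi_deriv 0 (s - 1) z (of_real (node n))) \<le>
        fact \<kappa> * 2 ^ \<kappa> / Re z ^ \<kappa> * exp (- (Re z / 2)) * node n powr (-2)"
        using norm_term_le[OF k, of z n] z d by (simp add: algebra_simps)
      also have "\<dots> \<le> fact \<kappa> * 2 ^ \<kappa> / d ^ \<kappa> * 1 * node n powr (-2)"
        using z d by (intro mult_right_mono mult_mono divide_left_mono power_mono) auto
      finally show ?thesis by simp
    qed
    show "summable (\<lambda>n. fact \<kappa> * 2 ^ \<kappa> / d ^ \<kappa> * node n powr (-2))"
      by (intro summable_mult summable_node)
  qed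
  have "((\<lambda>w. \<Sum>n. psi_deriv 0 s w (of_real (node n))) has_field_derivative (\<Sum>n. - psi_deriv 0 (s - 1) w (of_real (node n)))) (at w)"
  proof (rule has_field_derivative_series'(2)[OF cv _ u d(2)])
    show "((\<lambda>w. psi_deriv 0 s w (of_real (node n))) has_field_derivative - psi_deriv 0 (s - 1) z (of_real (node n))) (at z within A)" if "z \<in> A" for n z
    proof -
      have "complex_of_real (node n) powr (1 - s) * of_real (node n) = of_real (node n) powr (1 - (s - 1))"
        using node_pos[of n] by (simp add: powr_diff power2_eq_square field_simps)
      then show ?thesis by (auto intro!: derivative_eq_intros simp: mult_ac)
    qed
  qed (use d op summable_term[OF assms, of 0 s] in \<open>auto simp: interior_open\<close>)
  then show ?thesis
    unfolding S_def[abs_def] suminf_minus[OF summable_term[OF assms]] .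
qed

lemma F_has_vector_derivative:
  "x > 0 \<Longrightarrow> ((\<lambda>x. F x s) has_vector_derivative - F x (s - 1)) (at x)"
  using has_vector_derivative_real_field[OF S0_has_field_derivative[of "of_real x" "s + 1"]]
  unfolding F_def by simp

section \<open>Boundedness of \<open>H\<close> at 0, locally uniformly in \<open>s\<close>\<close>

definition bounded_near_0 :: "(real \<Rightarrow> complex \<Rightarrow> complex) \<Rightarrow> real \<Rightarrow> bool" where
  "bounded_near_0 f \<sigma> \<longleftrightarrow> (\<forall>R\<ge>0. \<exists>C. \<forall>s x. norm s \<le> R \<longrightarrow> Re s \<ge> \<sigma> \<longrightarrow> 0 < x \<longrightarrow> x \<le> 1 \<longrightarrow> norm (f x s) \<le> C)"

lemma bounded_near_0E:
  assumes "bounded_near_0 f \<sigma>" "R \<ge> 0"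
  obtains C where "C \<ge> 0" "\<And>s x. norm s \<le> R \<Longrightarrow> Re s \<ge> \<sigma> \<Longrightarrow> 0 < x \<Longrightarrow> x \<le> 1 \<Longrightarrow> norm (f x s) \<le> C"
proof -
  from assms obtain C where C: "\<And>s x. norm s \<le> R \<Longrightarrow> Re s \<ge> \<sigma> \<Longrightarrow> 0 < x \<Longrightarrow> x \<le> 1 \<Longrightarrow> norm (f x s) \<le> C"
    unfolding bounded_near_0_def by blast
  have "norm (f x s) \<le> max C 0" if "norm s \<le> R" "Re s \<ge> \<sigma>" "0 < x" "x \<le> 1" for s x
    using C[OF that] by simp
  then show ?thesis using that[of "max C 0"] by simp
qed

text \<open>Shaped after the recursion \<open>S_Suc\<close>: the term at \<open>s + 1\<close> needs
  control only one unit further right, and the term at \<open>s\<close> comes with a factor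
  \<open>x \<le> 1\<close>.\<close>

lemma bounded_near_0_step:
  assumes f: "bounded_near_0 f (\<sigma> + 1)" and g: "bounded_near_0 g \<sigma>"
  shows "bounded_near_0 (\<lambda>x s. (1 - s) * f x (s + 1) - of_real x * g x s) \<sigma>"
  unfolding bounded_near_0_def
proof (intro allI impI)
  fix R :: real assume R: "R \<ge> 0"
  obtain C where C: "C \<ge> 0" "\<And>s x. norm s \<le> R + 1 \<Longrightarrow> Re s \<ge> \<sigma> + 1 \<Longrightarrow> 0 < x \<Longrightarrow> x \<le> 1 \<Longrightarrow> norm (f x s) \<le> C"
    by (rule bounded_near_0E[OF f, of "R + 1"]) (use R in auto)
  obtain D where D: "D \<ge> 0" "\<And>s x. norm s \<le> R \<Longrightarrow> Re s \<ge> \<sigma> \<Longrightarrow> 0 < x \<Longrightarrow> x \<le> 1 \<Longrightarrow> norm (g x s) \<le> D"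
    by (rule bounded_near_0E[OF g R]) auto
  show "\<exists>C. \<forall>s x. norm s \<le> R \<longrightarrow> Re s \<ge> \<sigma> \<longrightarrow> 0 < x \<longrightarrow> x \<le> 1 \<longrightarrow>
     norm ((1 - s) * f x (s + 1) - of_real x * g x s) \<le> C"
  proof (intro exI[of _ "(1 + R) * C + 1 * D"] allI impI)
    fix s :: complex and x :: real
    assume s: "norm s \<le> R" "Re s \<ge> \<sigma>" and x: "0 < x" "x \<le> 1"
    have s1: "norm (s + 1) \<le> R + 1" using norm_triangle_ineq[of s 1] s by simp
    have s2: "norm (1 - s) \<le> 1 + R" using norm_triangle_ineq4[of 1 s] s by simp
    have "norm ((1 - s) * f x (s + 1) - of_real x * g x s) \<le> norm (1 - s) * norm (f x (s + 1)) + x * norm (g x s)"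
      using x by (auto simp: norm_mult intro!: order_trans[OF norm_triangle_ineq4])
    also have "\<dots> \<le> (1 + R) * C + 1 * D"
      using C(1) C(2)[OF s1 _ x] D(1) D(2)[OF s x] s2 s x R by (intro add_mono mult_mono) auto
    finally show "norm ((1 - s) * f x (s + 1) - of_real x * g x s) \<le> (1 + R) * C + 1 * D" .
  qed
qed

lemma bounded_near_0_cong:
  "(\<And>x s. 0 < x \<Longrightarrow> f x s = g x s) \<Longrightarrow> bounded_near_0 f \<sigma> \<longleftrightarrow> bounded_near_0 g \<sigma>"
  unfolding bounded_near_0_def by (simp cong: imp_cong)

lemma bounded_near_0_S:
  assumes "bounded_near_0 H \<sigma>"
  shows "bounded_near_0 (\<lambda>x s. S (Suc i) s (of_real x)) \<sigma>"
proof (induction i)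
  case 0 then show ?case using assms by (simp add: H_def[abs_def])
next
  case (Suc i)
  have "bounded_near_0 (\<lambda>x s. S (Suc i) s (of_real x)) (\<sigma> + 1)" using Suc unfolding bounded_near_0_def
    by (meson add_increasing2 zero_le_one order_trans le_add_same_cancel1)
  from bounded_near_0_step[OF this Suc] show ?case
    by (subst bounded_near_0_cong) (auto simp: S_Suc[of _ "Suc i"])
qed

text \<open>Following the summand with factor \<open>- w\<close> in \<open>S_Suc\<close> leads back
  to \<open>H x s\<close> itself; everything split off on the way is a sum at \<open>s + 1\<close>,
  where boundedness is already known. Hence all the higher sums contain only one unknown
  quantity.\<close>

lemma bounded_near_0_S_diff:
  assumes "bounded_near_0 H (\<sigma> + 1)"
  shows "bounded_near_0 (\<lambda>x s. S (Suc i) s (of_real x) - (- of_real x) ^ i * H x s) \<sigma>"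
proof (induction i)
  case 0 show ?case by (auto simp: H_def bounded_near_0_def)
next
  case (Suc i)
  from bounded_near_0_step[OF bounded_near_0_S[OF assms, of i] this] show ?case
    by (subst bounded_near_0_cong) (auto simp: S_Suc[of _ "Suc i"] algebra_simps)
qed

text \<open>The sum of \<open>\<psi>'\<close> over the progression is compared with the telescoping sum of the
  increments of \<open>\<psi>(t) = t\<^sup>1\<^sup>-\<^sup>s e\<^sup>-\<^sup>t\<^sup>x\<close>; in the Taylor expansion of the increments the higher
  derivatives are multiples \<open>(-x)\<^sup>i \<psi>'\<close> up to terms with \<open>s + 1\<close> in place of \<open>s\<close>.\<close>

lemma taylor_remainder:
  assumes "R \<ge> 0"
  shows "\<exists>C\<ge>0. \<forall>s x n. norm s \<le> R \<longrightarrow> Re s \<ge> 2 - real m \<longrightarrow> 0 < x \<longrightarrow>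
     norm (psi_deriv 0 s (of_real x) (of_real (node (Suc n))) -
           (\<Sum>i\<le>m. psi_deriv i s (of_real x) (of_real (node n)) * of_nat Q ^ i / fact i)) \<le> C * node n powr (-2)"
proof -
  obtain C where C: "C \<ge> 0" "\<And>s x t. norm s \<le> R \<Longrightarrow> t \<ge> 1 \<Longrightarrow> x > 0 \<Longrightarrow>
    norm (psi_deriv (Suc m) s (of_real x) (of_real t)) \<le> C * t powr (1 - Re s - real (Suc m)) * (1 + t * x) ^ Suc m * exp (- (t * x))"
    using norm_psi_deriv_le[OF assms, of "Suc m"] by blast
  \<comment> \<open>The bound \<open>power_le_fact_exp\<close> is applied at \<open>1 + u\<close>
    against \<open>exp (- u)\<close>, which leaves the factor \<open>exp 1\<close>.\<close>
  define D where "D = fact (Suc m) * exp (1::real)"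
  have D: "(1 + u) ^ Suc m * exp (- u) \<le> D" if "u \<ge> 0" for u :: real
  proof -
    have "(1 + u) ^ Suc m * exp (- u) \<le> fact (Suc m) * exp (1 + u) * exp (- u)"
      using power_le_fact_exp[of "1 + u" "Suc m"] that by (intro mult_right_mono) auto
    then show ?thesis by (simp add: D_def mult.assoc flip: exp_add)
  qed
  have D0: "D \<ge> 0" by (simp add: D_def)
  show ?thesis
  proof (intro exI[of _ "C * D * real Q ^ Suc m / fact m"] conjI allI impI)
    show "C * D * real Q ^ Suc m / fact m \<ge> 0" using C(1) D0 by simp
    fix s :: complex and x :: real and n :: nat
    assume s: "norm s \<le> R" "Re s \<ge> 2 - real m" and x: "0 < x"
    define A where "A = complex_of_real ` {node n..}"
    have "convex A" unfolding A_def
      by (intro convex_linear_image bounded_linear.linear[OF bounded_linear_of_real] convex_real_interval)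
    moreover have "(psi_deriv i s (of_real x) has_field_derivative psi_deriv (Suc i) s (of_real x) z) (at z within A)" if "z \<in> A" for i z
    proof (rule has_field_derivative_at_within[OF psi_deriv_has_field_derivative])
      from that node_pos[of n] show "z \<notin> \<real>\<^sub>\<le>\<^sub>0" by (auto simp: A_def)
    qed
    moreover have "norm (psi_deriv (Suc m) s (of_real x) z) \<le> C * D * node n powr (-2)" if "z \<in> A" for z
    proof -
      from that obtain t where t: "z = of_real t" "t \<ge> node n" by (auto simp: A_def)
      have t1: "t \<ge> 1" using t node_ge_1[of n] by simp
      have "norm (psi_deriv (Suc m) s (of_real x) z) \<le> C * t powr (1 - Re s - real (Suc m)) * ((1 + t * x) ^ Suc m * exp (- (t * x)))"
        using C(2)[OF s(1) t1 x] unfolding t(1) by (simp only: mult.assoc)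
      also have "\<dots> \<le> C * node n powr (-2) * D"
      proof (intro mult_mono mult_left_mono D)
        \<comment> \<open>The Taylor order enters here: the exponent is
          \<open>- Re s - real m\<close>, and \<open>Re s \<ge> 2 - real m\<close> brings it down to
          the summable -2.\<close>
        have "t powr (1 - Re s - real (Suc m)) \<le> t powr (-2)" using t1 s(2) by (intro powr_mono) auto
        also have "\<dots> \<le> node n powr (-2)" using t(2) node_pos[of n] by (intro powr_mono2') auto
        finally show "t powr (1 - Re s - real (Suc m)) \<le> node n powr (-2)" .
      qed (use C t1 x in auto)
      finally show ?thesis by (simp only: mult_ac)
    qed
    moreover have "complex_of_real (node n) \<in> A" "complex_of_real (node (Suc n)) \<in> A"
      unfolding A_def by (intro imageI; simp add: node_Suc)+
    ultimately have "norm (psi_deriv 0 s (of_real x) (of_real (node (Suc n))) -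
        (\<Sum>i\<le>m. psi_deriv i s (of_real x) (of_real (node n)) * (of_real (node (Suc n)) - of_real (node n)) ^ i / fact i))
      \<le> C * D * node n powr (-2) * norm (complex_of_real (node (Suc n)) - of_real (node n)) ^ Suc m / fact m"
      by (intro complex_Taylor[of A m "\<lambda>i. psi_deriv i s (of_real x)"])
    moreover have "complex_of_real (node (Suc n)) - of_real (node n) = of_nat Q" by (simp add: node_Suc)
    ultimately show "norm (psi_deriv 0 s (of_real x) (of_real (node (Suc n))) -
           (\<Sum>i\<le>m. psi_deriv i s (of_real x) (of_real (node n)) * of_nat Q ^ i / fact i)) \<le>
           C * D * real Q ^ Suc m / fact m * node n powr (-2)"
      by (simp only: norm_of_nat) (simp only: mult_ac times_divide_eq_left times_divide_eq_right)
  qed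
qed

text \<open>Read off from \<open>H_eq\<close>; it is useless at 0 but settles all \<open>x\<close>
  bounded away from 0 and provides the exponential decay. The choice
  \<open>R + 3 \<le> real \<kappa>\<close> suffices because \<open>s - 1\<close> has real part at
  least \<open>- (R + 1)\<close>.\<close>

lemma H_bound_far:
  assumes "R \<ge> 0"
  shows "\<exists>C\<ge>0. \<exists>\<kappa>. \<forall>s x. norm s \<le> R \<longrightarrow> x > 0 \<longrightarrow> norm (H x s) \<le> C * ((1 + x) / x ^ \<kappa>) * exp (- (x / 2))"
proof -
  obtain \<kappa> :: nat where k: "R + 3 \<le> real \<kappa>" using real_arch_simple by blast
  define C where "C = fact \<kappa> * 2 ^ \<kappa> * Z2"
  have C: "C \<ge> 0" using Z2_nonneg by (simp add: C_def)
  have F: "norm (F x s) \<le> C / x ^ \<kappa> * exp (- (x / 2))" if "norm s \<le> R + 1" "x > 0" for x s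
    using norm_F_le[of \<kappa> s x] that k abs_Re_le_cmod[of s] unfolding C_def by auto
  show ?thesis
  proof (intro exI[of _ "(1 + R) * C"] exI[of _ \<kappa>] conjI allI impI)
    show "(1 + R) * C \<ge> 0" using C assms by simp
    fix s x assume s: "norm (s::complex) \<le> R" and x: "x > (0::real)"
    define P where "P = C / x ^ \<kappa> * exp (- (x / 2))"
    have P: "P \<ge> 0" using C x by (simp add: P_def)
    have s1: "norm (s - 1) \<le> R + 1" using norm_triangle_ineq4[of s 1] s by simp
    have s2: "norm (1 - s) \<le> 1 + R" using norm_triangle_ineq4[of 1 s] s by simp
    have "norm (H x s) \<le> norm (1 - s) * norm (F x s) + x * norm (F x (s - 1))"
      unfolding H_eq[OF x] using x by (auto simp: norm_mult intro!: order_trans[OF norm_triangle_ineq4])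
    also have "\<dots> \<le> (1 + R) * P + x * P"
      using F[OF _ x, of s] F[OF s1 x] s s2 x P assms unfolding P_def[symmetric] by (intro add_mono mult_mono) auto
    also have "\<dots> \<le> (1 + R) * (1 + x) * P"
      using P x assms by (auto simp: algebra_simps)
    finally show "norm (H x s) \<le> (1 + R) * C * ((1 + x) / x ^ \<kappa>) * exp (- (x / 2))"
      by (simp add: P_def mult_ac)
  qed
qed

text \<open>The increments sum to minus the value at the first node, since the terms tend to 0.
  Comparing this with the summed Taylor polynomials and isolating the multiples of
  \<open>H x s\<close> gives the identity. The coefficient of \<open>H x s\<close> is a truncation
  of the power series of (1 - e^(-Qx)) / x.\<close>

lemma H_telescoped:
  assumes x: "x > 0"
  shows "H x s * (\<Sum>i<m. of_nat Q ^ Suc i / fact (Suc i) * (- of_real x) ^ i) =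
     - psi_deriv 0 s (of_real x) (of_real a)
     - (\<Sum>i<m. of_nat Q ^ Suc i / fact (Suc i) * (S (Suc i) s (of_real x) - (- of_real x) ^ i * H x s))
     - (\<Sum>n. psi_deriv 0 s (of_real x) (of_real (node (Suc n))) -
             (\<Sum>i\<le>m. psi_deriv i s (of_real x) (of_real (node n)) * of_nat Q ^ i / fact i))"
proof -
  define g where "g i n = psi_deriv i s (of_real x) (of_real (node n))" for i n
  have sg: "summable (g i)" for i unfolding g_def using summable_term[of "of_real x" i s] x by simp
  have sm: "(\<lambda>n. \<Sum>i<m. g (Suc i) n * (of_nat Q ^ Suc i / fact (Suc i))) sums
     (\<Sum>i<m. S (Suc i) s (of_real x) * (of_nat Q ^ Suc i / fact (Suc i)))"
    unfolding S_def g_def[symmetric] by (intro sums_sum sums_mult2 summable_sums sg)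
  have tel: "(\<lambda>n. g 0 (Suc n) - g 0 n) sums (0 - g 0 0)"
    by (rule telescope_sums) (rule summable_LIMSEQ_zero[OF sg])
  have "(\<Sum>i\<le>m. g i n * of_nat Q ^ i / fact i) = g 0 n + (\<Sum>i<m. g (Suc i) n * (of_nat Q ^ Suc i / fact (Suc i)))" for n
    by (simp add: sum.lessThan_Suc_shift lessThan_Suc_atMost[symmetric] del: sum.lessThan_Suc fact_Suc power_Suc)
  then have "(\<lambda>n. g 0 (Suc n) - (\<Sum>i\<le>m. g i n * of_nat Q ^ i / fact i)) =
    (\<lambda>n. (g 0 (Suc n) - g 0 n) - (\<Sum>i<m. g (Suc i) n * (of_nat Q ^ Suc i / fact (Suc i))))"
    by (simp only: diff_diff_eq)
  with sums_diff[OF tel sm] have R: "(\<Sum>n. g 0 (Suc n) - (\<Sum>i\<le>m. g i n * of_nat Q ^ i / fact i)) =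
    - g 0 0 - (\<Sum>i<m. S (Suc i) s (of_real x) * (of_nat Q ^ Suc i / fact (Suc i)))"
    by (simp add: sums_iff)
  have g00: "g 0 0 = psi_deriv 0 s (of_real x) (of_real a)" by (simp add: g_def node_def)
  show ?thesis unfolding g_def[symmetric] R g00
    by (simp add: algebra_simps sum_distrib_left sum_subtractf del: psi_deriv.simps fact_Suc power_Suc)
qed

text \<open>On the right of \<open>H_telescoped\<close> everything is bounded: the differences by
  the hypothesis one unit further right, the Taylor remainders by the convergent sum
  \<open>Z2\<close>. Near 0 one may divide by the coefficient of \<open>H x s\<close>, which tends
  to \<open>Q\<close>.\<close>

lemma bounded_near_0_H_step:
  assumes "bounded_near_0 H (\<sigma> + 1)" "\<sigma> \<ge> 2 - real N"
  shows "bounded_near_0 H \<sigma>"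
  unfolding bounded_near_0_def
proof (intro allI impI)
  fix R :: real assume R: "R \<ge> 0"
  \<comment> \<open>\<open>Suc N\<close> instead of \<open>N\<close> ensures that the sum defining
    \<open>c\<close> is not empty, so that \<open>c 0\<close> is \<open>Q\<close>.\<close>
  define m where "m = Suc N"
  have "\<exists>C. \<forall>i. C i \<ge> 0 \<and> (\<forall>s x. norm s \<le> R \<longrightarrow> Re s \<ge> \<sigma> \<longrightarrow> 0 < x \<longrightarrow> x \<le> 1 \<longrightarrow>
      norm (S (Suc i) s (of_real x) - (- of_real x) ^ i * H x s) \<le> C i)"
    by (intro choice allI) (metis bounded_near_0E[OF bounded_near_0_S_diff[OF assms(1)] R])
  then obtain C where C: "\<And>i. C i \<ge> 0" "\<And>i s x. norm s \<le> R \<Longrightarrow> Re s \<ge> \<sigma> \<Longrightarrow> 0 < x \<Longrightarrow> x \<le> 1 \<Longrightarrow>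
      norm (S (Suc i) s (of_real x) - (- of_real x) ^ i * H x s) \<le> C i" by blast
  obtain D where D: "D \<ge> 0" "\<And>s x n. norm s \<le> R \<Longrightarrow> Re s \<ge> 2 - real m \<Longrightarrow> 0 < x \<Longrightarrow>
     norm (psi_deriv 0 s (of_real x) (of_real (node (Suc n))) -
           (\<Sum>i\<le>m. psi_deriv i s (of_real x) (of_real (node n)) * of_nat Q ^ i / fact i)) \<le> D * node n powr (-2)"
    using taylor_remainder[OF R, of m] by blast
  define c where "c x = (\<Sum>i<m. of_nat Q ^ Suc i / fact (Suc i) * (- complex_of_real x) ^ i)" for x
  have "c 0 = of_nat Q" unfolding c_def m_def
    by (simp add: sum.lessThan_Suc_shift del: sum.lessThan_Suc)
  moreover have "isCont c 0" unfolding c_def by (intro continuous_intros)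
  ultimately have "(c \<longlongrightarrow> of_nat Q) (at 0)" by (simp add: isCont_def)
  \<comment> \<open>Since \<open>c\<close> does not involve \<open>s\<close>, the threshold
    \<open>d\<close> is uniform in \<open>s\<close>.\<close>
  from tendstoD[OF this, of "1/2"] obtain d where d: "d > 0" "\<And>x. x \<noteq> 0 \<Longrightarrow> dist x 0 < d \<Longrightarrow> dist (c x) (of_nat Q) < 1/2"
    by (auto simp: eventually_at)
  have c: "norm (c x) \<ge> 1/2" if "0 < x" "x < d" for x
  proof -
    have "norm (complex_of_nat Q) \<le> norm (c x) + dist (c x) (of_nat Q)"
      by (metis dist_norm norm_minus_commute norm_triangle_sub add.commute)
    moreover have "norm (complex_of_nat Q) \<ge> 1" using Q_ge by simp
    ultimately show ?thesis using d(2)[of x] that by simp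
  qed
  obtain K \<kappa> where K: "K \<ge> 0" "\<And>s x. norm s \<le> R \<Longrightarrow> x > 0 \<Longrightarrow> norm (H x s) \<le> K * ((1 + x) / x ^ \<kappa>) * exp (- (x / 2))"
    using H_bound_far[OF R] by blast
  define B where "B = real a powr (1 + R) + (\<Sum>i<m. real Q ^ Suc i / fact (Suc i) * C i) + D * Z2"
  have B: "B \<ge> 0" unfolding B_def using C(1) D(1) Z2_nonneg by (intro add_nonneg_nonneg sum_nonneg mult_nonneg_nonneg) auto
  have near: "norm (H x s) \<le> 2 * B" if s: "norm s \<le> R" "Re s \<ge> \<sigma>" and x: "0 < x" "x \<le> 1" "x < d" for s x
  proof -
    have s': "Re s \<ge> 2 - real m" using s assms by (simp add: m_def)
    have "norm (psi_deriv 0 s (of_real x) (of_real a)) = real a powr (1 - Re s) * exp (- (a * x))"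
      using norm_psi_deriv_0[of "real a" s x] a_ge by simp
    also have "\<dots> \<le> real a powr (1 + R) * 1"
      using a_ge s(1) abs_Re_le_cmod[of s] x by (intro mult_mono powr_mono) auto
    finally have b1: "norm (psi_deriv 0 s (of_real x) (of_real a)) \<le> real a powr (1 + R)" by simp
    have b2: "norm (\<Sum>i<m. of_nat Q ^ Suc i / fact (Suc i) * (S (Suc i) s (of_real x) - (- of_real x) ^ i * H x s))
      \<le> (\<Sum>i<m. real Q ^ Suc i / fact (Suc i) * C i)"
    proof (rule sum_norm_le)
      fix i
      show "norm (of_nat Q ^ Suc i / fact (Suc i) * (S (Suc i) s (of_real x) - (- of_real x) ^ i * H x s)) \<le> real Q ^ Suc i / fact (Suc i) * C i"
        unfolding norm_mult norm_divide norm_power norm_of_nat norm_fact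
        by (rule mult_left_mono[OF C(2)[OF s x(1,2)]]) simp
    qed
    have b3: "norm (\<Sum>n. psi_deriv 0 s (of_real x) (of_real (node (Suc n))) -
             (\<Sum>i\<le>m. psi_deriv i s (of_real x) (of_real (node n)) * of_nat Q ^ i / fact i)) \<le> D * Z2"
      unfolding Z2_def suminf_mult[OF summable_node, symmetric]
      by (rule norm_suminf_le[OF D(2)[OF s(1) s' x(1)] summable_mult[OF summable_node]])
    have "norm (H x s) * (1/2) \<le> norm (H x s) * norm (c x)"
      by (rule mult_left_mono[OF c[OF x(1,3)] norm_ge_zero])
    also have "\<dots> = norm (H x s * c x)" by (simp add: norm_mult)
    also have "\<dots> \<le> B" unfolding c_def H_telescoped[OF x(1)] B_def
      by (intro order_trans[OF norm_triangle_ineq4] add_mono b2 b3 order_trans[OF eq_refl[OF norm_minus_cancel] b1])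
    finally show ?thesis by simp
  qed
  show "\<exists>C. \<forall>s x. norm s \<le> R \<longrightarrow> Re s \<ge> \<sigma> \<longrightarrow> 0 < x \<longrightarrow> x \<le> 1 \<longrightarrow> norm (H x s) \<le> C"
  proof (intro exI[of _ "max (2 * B) (K * (2 / d ^ \<kappa>))"] allI impI)
    fix s x assume s: "norm s \<le> R" "Re s \<ge> \<sigma>" and x: "(0::real) < x" "x \<le> 1"
    show "norm (H x s) \<le> max (2 * B) (K * (2 / d ^ \<kappa>))"
    proof (cases "x < d")
      case True then show ?thesis using near[OF s x] by simp
    next
      case False
      have "norm (H x s) \<le> K * ((1 + x) / x ^ \<kappa>) * exp (- (x / 2))" by (rule K(2)[OF s(1) x(1)])
      also have "\<dots> \<le> K * ((1 + x) / x ^ \<kappa>) * 1" using K(1) x by (intro mult_left_mono) auto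
      also have "\<dots> \<le> K * (2 / d ^ \<kappa>)" using K(1) x d(1) False
        by (auto intro!: mult_left_mono frac_le power_mono)
      finally show ?thesis by simp
    qed
  qed
qed

text \<open>Induction to the left. It starts at real part 3, where both \<open>F x s\<close> and
  \<open>F x (s - 1)\<close> are dominated by the convergent sum \<open>Z2\<close> for every
  \<open>x > 0\<close>.\<close>

lemma bounded_near_0_H: "bounded_near_0 H (3 - real N)"
proof (induction N)
  case 0
  show ?case unfolding bounded_near_0_def
  proof (intro allI impI)
    fix R :: real assume R: "R \<ge> 0"
    show "\<exists>C. \<forall>s x. norm s \<le> R \<longrightarrow> 3 - real 0 \<le> Re s \<longrightarrow> 0 < x \<longrightarrow> x \<le> 1 \<longrightarrow> norm (H x s) \<le> C"
    proof (intro exI[of _ "(1 + R) * Z2 + 1 * Z2"] allI impI)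
      fix s x assume s: "norm s \<le> R" "3 - real 0 \<le> Re s" and x: "(0::real) < x" "x \<le> 1"
      have F: "norm (F x s) \<le> Z2" if "Re s \<ge> 2" for s
        using norm_F_le[of 0 s x] that x Z2_nonneg by (auto intro: order_trans[OF _ mult_left_le])
      have s2: "norm (1 - s) \<le> 1 + R" using norm_triangle_ineq4[of 1 s] s by simp
      have "norm (H x s) \<le> norm (1 - s) * norm (F x s) + x * norm (F x (s - 1))"
        unfolding H_eq[OF x(1)] using x by (auto simp: norm_mult intro!: order_trans[OF norm_triangle_ineq4])
      also have "\<dots> \<le> (1 + R) * Z2 + 1 * Z2"
        using F[of s] F[of "s - 1"] s s2 x R Z2_nonneg by (intro add_mono mult_mono) auto
      finally show "norm (H x s) \<le> (1 + R) * Z2 + 1 * Z2" .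
    qed
  qed
next
  case (Suc N)
  then have "bounded_near_0 H (3 - real (Suc N) + 1)" by simp
  then show ?case by (rule bounded_near_0_H_step[of _ N]) simp
qed

lemma H_bound:
  assumes R: "R \<ge> 0"
  shows "\<exists>C\<ge>0. \<forall>s x. norm s \<le> R \<longrightarrow> x > 0 \<longrightarrow> norm (H x s) \<le> C * exp (- (x / 4))"
proof -
  obtain N :: nat where N: "R + 3 \<le> real N" using real_arch_simple by blast
  obtain C where C: "C \<ge> 0" "\<And>s x. norm s \<le> R \<Longrightarrow> Re s \<ge> 3 - real N \<Longrightarrow> 0 < x \<Longrightarrow> x \<le> 1 \<Longrightarrow> norm (H x s) \<le> C"
    using bounded_near_0E[OF bounded_near_0_H R] by blast
  obtain K \<kappa> where K: "K \<ge> 0" "\<And>s x. norm s \<le> R \<Longrightarrow> x > 0 \<Longrightarrow> norm (H x s) \<le> K * ((1 + x) / x ^ \<kappa>) * exp (- (x / 2))"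
    using H_bound_far[OF R] by blast
  \<comment> \<open>On \<open>x \<le> 1\<close> the factor \<open>exp (1/4)\<close> outweighs the
    decay factor. On \<open>x > 1\<close> half of the rate 1/2 is spent on absorbing
    \<open>1 + x\<close>, which is at most \<open>8 * exp (x / 4)\<close>; hence the 8 and the final
    rate 1/4.\<close>
  define M where "M = C * exp (1/4) + 8 * K"
  have M: "M \<ge> 0" using C K by (simp add: M_def)
  have "norm (H x s) \<le> M * exp (- (x / 4))" if s: "norm s \<le> R" and x: "x > 0" for s x
  proof (cases "x \<le> 1")
    case True
    have "norm (H x s) \<le> C * 1" using C(2)[OF s _ x True] N s abs_Re_le_cmod[of s] by simp
    also have "\<dots> \<le> C * (exp (1/4) * exp (- (x / 4)))" using True C(1) by (intro mult_left_mono) (auto simp flip: exp_add)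
    also have "\<dots> \<le> M * exp (- (x / 4))" using K(1) by (simp add: M_def algebra_simps)
    finally show ?thesis .
  next
    case False
    have "(1 + x) / x ^ \<kappa> \<le> 2 * x / 1" using False by (intro frac_le one_le_power) auto
    also have "\<dots> \<le> 8 * exp (x / 4)" using exp_ge_add_one_self[of "x / 4"] by linarith
    finally have *: "(1 + x) / x ^ \<kappa> \<le> 8 * exp (x / 4)" .
    have "norm (H x s) \<le> K * ((1 + x) / x ^ \<kappa>) * exp (- (x / 2))" by (rule K(2)[OF s x])
    also have "\<dots> \<le> K * (8 * exp (x / 4)) * exp (- (x / 2))" using K(1) * by (intro mult_left_mono mult_right_mono) auto
    also have "\<dots> = 8 * K * exp (- (x / 4))" by (simp flip: exp_add)
    also have "\<dots> \<le> M * exp (- (x / 4))" using C(1) by (simp add: M_def)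
    finally show ?thesis .
  qed
  with M show ?thesis by blast
qed

end

section \<open>Mellin transforms\<close>

lemma integral_derivative_zero:
  fixes u f :: "real \<Rightarrow> complex"
  assumes "\<And>x. x > 0 \<Longrightarrow> (u has_vector_derivative f x) (at x)" "\<And>x. x > 0 \<Longrightarrow> isCont f x"
    "set_integrable lborel {0<..} f" "(u \<longlongrightarrow> 0) (at_right 0)" "(u \<longlongrightarrow> 0) at_top"
  shows "(LINT x:{0<..}|lborel. f x) = 0"
proof -
  have "(LBINT x=ereal 0..\<infinity>. f x) = 0 - 0"
    by (rule interval_integral_FTC_integrable[where F = u])
       (use assms in \<open>auto simp: ereal_tendsto_simps simp del: zero_ereal_def[symmetric]\<close>)
  then show ?thesis by (simp add: interval_lebesgue_integral_def)
qed

lemma set_integrable_Gamma_real: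
  fixes e c :: real
  assumes "e > 0" "c > 0"
  shows "set_integrable lborel {0<..} (\<lambda>x. x powr (e - 1) * exp (- (c * x)))"
proof -
  have "(\<lambda>t. complex_of_real t powr (of_real e - 1) / of_real (exp (c * t))) absolutely_integrable_on {0<..}"
    by (rule absolutely_integrable_Gamma_integral) (use assms in auto)
  then have "set_integrable lebesgue {0<..} (\<lambda>t. norm (complex_of_real t powr (of_real e - 1) / of_real (exp (c * t))))"
    by (rule set_integrable_norm)
  also have "?this \<longleftrightarrow> set_integrable lebesgue {0<..} (\<lambda>x. x powr (e - 1) * exp (- (c * x)))"
    by (rule set_integrable_cong) (auto simp: norm_divide norm_powr_real_powr exp_minus field_simps)
  finally show ?thesis
    unfolding set_integrable_def by (subst (asm) integrable_completion) auto
qed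

lemma tendsto_powr_exp_0:
  fixes e :: real
  assumes "e > 0"
  shows "((\<lambda>x. x powr e * exp (- (x / 4))) \<longlongrightarrow> 0) (at_right 0)"
    and "((\<lambda>x. x powr e * exp (- (x / 4))) \<longlongrightarrow> 0) at_top"
  using assms by real_asymp+

lemma set_integral_finite_sum:
  fixes f :: "'i \<Rightarrow> 'a \<Rightarrow> 'b::{banach, second_countable_topology}"
  assumes "\<And>i. i \<in> I \<Longrightarrow> set_integrable M A (f i)"
  shows "set_integrable M A (\<lambda>x. \<Sum>i\<in>I. f i x)"
    and "(LINT x:A|M. (\<Sum>i\<in>I. f i x)) = (\<Sum>i\<in>I. LINT x:A|M. f i x)"
  using assms unfolding set_integrable_def set_lebesgue_integral_def scaleR_sum_right
  by (auto intro!: Bochner_Integration.integrable_sum Bochner_Integration.integral_sum)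

lemma set_integral_Gamma:
  assumes "Re z > 0" "T > 0"
  shows "set_integrable lborel {0<..} (\<lambda>x. complex_of_real x powr (z - 1) * of_real (exp (- (T * x))))"
    and "(LINT x:{0<..}|lborel. complex_of_real x powr (z - 1) * of_real (exp (- (T * x)))) = Gamma z / of_real T powr z"
proof -
  have meas: "set_borel_measurable lborel {0<..} (\<lambda>x. complex_of_real x powr (z - 1) * of_real (exp (- (T * x))))" for T
    unfolding set_borel_measurable_def measurable_lborel2
    by (intro borel_measurable_continuous_on_indicator continuous_intros) auto
  have int: "set_integrable lborel {0<..} (\<lambda>x. complex_of_real x powr (z - 1) * of_real (exp (- (T * x))))" if "T > 0" for T
    by (rule set_integrable_bound[OF set_integrable_Gamma_real[OF assms(1) that] meas])
       (auto simp: norm_mult norm_powr_real_powr)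
  show "set_integrable lborel {0<..} (\<lambda>x. complex_of_real x powr (z - 1) * of_real (exp (- (T * x))))" by (rule int[OF assms(2)])
  have "Gamma z = integral {0<..} (\<lambda>t. of_real t powr (z - 1) / of_real (exp t))"
    using Gamma_integral_complex'[OF assms(1)] by (simp add: integral_unique)
  also have "\<dots> = integral {0<..} (\<lambda>x. complex_of_real x powr (z - 1) * of_real (exp (- (1 * x))))"
    by (intro Henstock_Kurzweil_Integration.integral_cong) (auto simp: exp_minus field_simps)
  also have "\<dots> = (LINT x:{0<..}|lborel. complex_of_real x powr (z - 1) * of_real (exp (- (1 * x))))"
    by (rule set_borel_integral_eq_integral(2)[symmetric, OF int]) simp
  also have "\<dots> = \<bar>T\<bar> *\<^sub>R (LINT x|lborel. indicator {0<..} (0 + T * x) *\<^sub>R (complex_of_real (0 + T * x) powr (z - 1) * of_real (exp (- (1 * (0 + T * x))))))"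
    unfolding set_lebesgue_integral_def by (rule lborel_integral_real_affine) (use assms in auto)
  also have "(LINT x|lborel. indicator {0<..} (0 + T * x) *\<^sub>R (complex_of_real (0 + T * x) powr (z - 1) * of_real (exp (- (1 * (0 + T * x)))))) =
      (LINT x|lborel. of_real T powr (z - 1) * (indicator {0<..} x *\<^sub>R (complex_of_real x powr (z - 1) * of_real (exp (- (T * x))))))"
    using assms by (intro Bochner_Integration.integral_cong refl)
      (auto simp: indicator_def zero_less_mult_iff powr_times_real)
  also have "\<dots> = of_real T powr (z - 1) * (LINT x:{0<..}|lborel. complex_of_real x powr (z - 1) * of_real (exp (- (T * x))))"
    unfolding set_lebesgue_integral_def by (rule integral_mult_right_zero)
  finally show "(LINT x:{0<..}|lborel. complex_of_real x powr (z - 1) * of_real (exp (- (T * x)))) = Gamma z / of_real T powr z"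
    using assms by (simp add: powr_diff scaleR_conv_of_real)
qed

section \<open>Translations, linear forms and regions of convergence\<close>

definition shift :: "'k::finite \<Rightarrow> complex ^ 'k option" where
  "shift i = axis None 1 - axis (Some i) 1"

lemma shift_nth [simp]: "shift i $ None = 1" "shift i $ Some j = (if i = j then -1 else 0)"
  by (auto simp: shift_def axis_def)

text \<open>The exponent of \<open>x\<close> in x^(s_(k+1)) times the singular parts x^(s_j - 1) of
  the factors with \<open>j \<in> J\<close>, hence the eigenvalue of x d/dx on this power.\<close>

definition \<Lambda> :: "'k::finite set \<Rightarrow> complex ^ 'k option \<Rightarrow> complex" where
  "\<Lambda> J s = s $ None + (\<Sum>j\<in>J. s $ Some j - 1)"

text \<open>For \<open>N = 0\<close> the integral defining \<open>M A\<close> converges here;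
  \<open>N\<close> counts the units gained in \<open>s $ None\<close>. Coordinates in
  \<open>A\<close> are free because \<open>H\<close> is bounded at 0 for every \<open>s\<close>,
  whereas an \<open>F\<close> may blow up to order \<open>\<kappa>\<close>. Charging
  \<open>\<kappa>\<close> for all \<open>CARD('k)\<close> factors, not only for those outside
  \<open>A\<close>, keeps the bound on \<open>s $ None\<close> independent of
  \<open>A\<close>.\<close>

definition region :: "nat \<Rightarrow> nat \<Rightarrow> 'k::finite set \<Rightarrow> (complex ^ 'k option) set" where
  "region \<kappa> N A = {s. (\<forall>j. j \<notin> A \<longrightarrow> Re (s $ Some j) > 2 - real \<kappa>) \<and> Re (s $ None) > real (\<kappa> * CARD('k)) - real N}"

lemma open_region: "open (region \<kappa> N (A :: 'k::finite set))"
proof -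
  have "region \<kappa> N A = (\<Inter>j\<in>-A. {s. Re (s $ Some j) > 2 - real \<kappa>}) \<inter> {s. Re (s $ None) > real (\<kappa> * CARD('k)) - real N}"
    by (auto simp: region_def)
  then show ?thesis
    by (simp only:) (intro open_Int open_INT finite open_Collect_less continuous_intros ballI)
qed

text \<open>The coordinate that is lowered is not constrained, so a whole unit of
  \<open>s $ None\<close> is gained; this drives the continuation.\<close>

lemma region_shift: "s \<in> region \<kappa> (Suc N) A \<Longrightarrow> i \<in> A \<Longrightarrow> s + shift i \<in> region \<kappa> N A"
  by (auto simp: region_def)

lemma region_insert: "s \<in> region \<kappa> N A \<Longrightarrow> s \<in> region \<kappa> N (insert j A)"
  by (auto simp: region_def)

lemma region_Suc: "s \<in> region \<kappa> N A \<Longrightarrow> s \<in> region \<kappa> (Suc N) A"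
  by (auto simp: region_def)

text \<open>Isolates what the continuation uses of the exponential sums. Both bounds have the same
  decay rate, so that mixed products of \<open>F\<close> and \<open>H\<close> can be estimated
  uniformly.\<close>

locale regularised =
  fixes F H :: "'k::finite \<Rightarrow> real \<Rightarrow> complex \<Rightarrow> complex"
  assumes F_holomorphic: "\<And>j x. x > 0 \<Longrightarrow> F j x holomorphic_on UNIV"
    and F_has_vector_derivative: "\<And>j x s. x > 0 \<Longrightarrow> ((\<lambda>x. F j x s) has_vector_derivative - F j x (s - 1)) (at x)"
    and H_eq: "\<And>j x s. x > 0 \<Longrightarrow> H j x s = (1 - s) * F j x s - of_real x * F j x (s - 1)"
    and F_bound: "\<And>j \<kappa>. \<exists>C\<ge>0. \<forall>s x. Re s \<ge> 2 - real \<kappa> \<longrightarrow> x > 0 \<longrightarrow> norm (F j x s) \<le> C / x ^ \<kappa> * exp (- (x / 4))"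
    and H_bound: "\<And>j R. R \<ge> 0 \<Longrightarrow> \<exists>C\<ge>0. \<forall>s x. norm s \<le> R \<longrightarrow> x > 0 \<longrightarrow> norm (H j x s) \<le> C * exp (- (x / 4))"
begin

definition K :: "'k set \<Rightarrow> 'k \<Rightarrow> real \<Rightarrow> complex \<Rightarrow> complex" where
  "K A j = (if j \<in> A then H j else F j)"

definition \<Phi> :: "'k set \<Rightarrow> real \<Rightarrow> complex ^ 'k option \<Rightarrow> complex" where
  "\<Phi> A x s = (\<Prod>j\<in>UNIV. K A j x (s $ Some j))"

definition \<phi> :: "'k set \<Rightarrow> complex ^ 'k option \<Rightarrow> real \<Rightarrow> complex" where
  "\<phi> A s x = of_real x powr (s $ None - 1) * \<Phi> A x s"

definition M :: "'k set \<Rightarrow> complex ^ 'k option \<Rightarrow> complex" where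
  "M A s = rGamma (s $ None) * (LINT x:{0<..}|lborel. \<phi> A s x)"

text \<open>\<open>H\<close> obeys the same law as \<open>F\<close> because d/dx composed with x
  d/dx + 1 - s equals x d/dx + 1 - (s - 1) composed with d/dx. A factor that has been replaced is
  from then on merely translated.\<close>

lemma K_has_vector_derivative:
  assumes "x > 0" shows "((\<lambda>x. K A j x s) has_vector_derivative - K A j x (s - 1)) (at x)"
proof (cases "j \<in> A")
  case False then show ?thesis using F_has_vector_derivative[OF assms] by (simp add: K_def)
next
  case True
  have id: "(complex_of_real has_vector_derivative 1) (at x)"
    using has_vector_derivative_of_real[OF DERIV_ident[of "at x"]] by simp
  have "((\<lambda>x. (1 - s) * F j x s - of_real x * F j x (s - 1)) has_vector_derivative
      ((1 - s) * - F j x (s - 1) + 0 * F j x s - (of_real x * - F j x (s - 1 - 1) + 1 * F j x (s - 1)))) (at x)"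
    by (intro has_vector_derivative_diff has_vector_derivative_mult has_vector_derivative_const F_has_vector_derivative assms id)
  then have "((\<lambda>x. H j x s) has_vector_derivative
      ((1 - s) * - F j x (s - 1) + 0 * F j x s - (of_real x * - F j x (s - 1 - 1) + 1 * F j x (s - 1)))) (at x)"
    by (rule has_vector_derivative_transform_within_open[of _ _ _ "{0<..}"]) (simp_all add: assms H_eq)
  also have "((1 - s) * - F j x (s - 1) + 0 * F j x s - (of_real x * - F j x (s - 1 - 1) + 1 * F j x (s - 1))) = - H j x (s - 1)"
    using assms by (simp add: H_eq algebra_simps)
  finally show ?thesis using True by (simp add: K_def)
qed

lemma K_field_differentiable: "x > 0 \<Longrightarrow> K A j x field_differentiable (at s)"
proof -
  assume x: "x > 0"
  have F: "F j x field_differentiable (at s)" for s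
    using F_holomorphic[OF x] by (simp add: holomorphic_on_def)
  have "(\<lambda>s. s - 1) field_differentiable (at s)" by (intro derivative_intros)
  from field_differentiable_compose[OF this F]
  have F1: "(\<lambda>s. F j x (s - 1)) field_differentiable (at s)" by (simp add: o_def)
  have "H j x = (\<lambda>s. (1 - s) * F j x s - of_real x * F j x (s - 1))" 
    by (rule ext) (rule H_eq[OF x])
  then have "H j x field_differentiable (at s)"
    by (simp only:) (intro derivative_intros F F1)
  with F show ?thesis by (simp add: K_def)
qed

lemma K_bound:
  assumes "R \<ge> 0"
  shows "\<exists>C\<ge>0. \<forall>s x. norm s \<le> R \<longrightarrow> (j \<notin> A \<longrightarrow> Re s \<ge> 2 - real \<kappa>) \<longrightarrow> x > 0 \<longrightarrow>
     norm (K A j x s) \<le> C * max 1 (1 / x) ^ \<kappa> * exp (- (x / 4))"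
proof (cases "j \<in> A")
  case True
  obtain C where C: "C \<ge> 0" "\<And>s x. norm s \<le> R \<Longrightarrow> x > 0 \<Longrightarrow> norm (H j x s) \<le> C * exp (- (x / 4))"
    using H_bound[OF assms, of j] by blast
  have "C * exp (- (x / 4)) \<le> C * max 1 (1 / x) ^ \<kappa> * exp (- (x / 4))" for x
  proof (rule mult_right_mono)
    show "C \<le> C * max 1 (1 / x) ^ \<kappa>" 
      using mult_left_mono[OF one_le_power[OF max.cobounded1[of 1 "1 / x"], of \<kappa>] C(1)] by (simp only: mult_1_right)
  qed simp
  then have "norm (K A j x s) \<le> C * max 1 (1 / x) ^ \<kappa> * exp (- (x / 4))" if "norm s \<le> R" "x > 0" for s x
    using order_trans[OF C(2)[OF that]] True by (simp add: K_def)
  then show ?thesis by (intro exI[of _ C] conjI allI impI C(1))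
next
  case False
  obtain C where C: "C \<ge> 0" "\<And>s x. Re s \<ge> 2 - real \<kappa> \<Longrightarrow> x > 0 \<Longrightarrow> norm (F j x s) \<le> C / x ^ \<kappa> * exp (- (x / 4))"
    using F_bound[of \<kappa> j] by blast
  have "norm (K A j x s) \<le> C * max 1 (1 / x) ^ \<kappa> * exp (- (x / 4))" if "Re s \<ge> 2 - real \<kappa>" "x > 0" for s x
  proof -
    have "(1 / x) ^ \<kappa> \<le> max 1 (1 / x) ^ \<kappa>" using that by (intro power_mono) auto
    then have "C * (1 / x) ^ \<kappa> * exp (- (x / 4)) \<le> C * max 1 (1 / x) ^ \<kappa> * exp (- (x / 4))"
      using C(1) by (intro mult_right_mono mult_left_mono) auto
    moreover have "norm (K A j x s) \<le> C * (1 / x) ^ \<kappa> * exp (- (x / 4))"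
      using C(2)[OF that] False by (simp add: K_def power_one_over)
    ultimately show ?thesis by (rule order_trans[rotated])
  qed
  then show ?thesis using False by (intro exI[of _ C] conjI allI impI C(1)) simp_all
qed

lemma \<Phi>_bound:
  assumes "R \<ge> 0"
  shows "\<exists>C\<ge>0. \<forall>s x. norm s \<le> R \<longrightarrow> s \<in> region \<kappa> N A \<longrightarrow> x > 0 \<longrightarrow>
     norm (\<Phi> A x s) \<le> C * (1 + x powr (- real (\<kappa> * CARD('k)))) * exp (- (x / 4))"
proof -
  have "\<exists>C. \<forall>j. C j \<ge> 0 \<and> (\<forall>s x. norm s \<le> R \<longrightarrow> (j \<notin> A \<longrightarrow> Re s \<ge> 2 - real \<kappa>) \<longrightarrow> x > 0 \<longrightarrow>
     norm (K A j x s) \<le> C j * max 1 (1 / x) ^ \<kappa> * exp (- (x / 4)))"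
    by (intro choice allI K_bound assms)
  then obtain C where C': "\<forall>j. C j \<ge> 0 \<and> (\<forall>s x. norm s \<le> R \<longrightarrow> (j \<notin> A \<longrightarrow> Re s \<ge> 2 - real \<kappa>) \<longrightarrow> x > 0 \<longrightarrow>
     norm (K A j x s) \<le> C j * max 1 (1 / x) ^ \<kappa> * exp (- (x / 4)))" ..
  have C: "C j \<ge> 0" for j using C' by simp
  have CK: "norm (K A j x s) \<le> C j * max 1 (1 / x) ^ \<kappa> * exp (- (x / 4))"
    if "norm s \<le> R" "j \<notin> A \<Longrightarrow> Re s \<ge> 2 - real \<kappa>" "x > 0" for j s x
    using C'[rule_format, of j] that by simp
  show ?thesis
  proof (intro exI[of _ "\<Prod>j\<in>UNIV. C j"] conjI allI impI prod_nonneg C)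
    fix s :: "complex ^ 'k option" and x :: real
    assume s: "norm s \<le> R" "s \<in> region \<kappa> N A" and x: "x > 0"
    define B where "B = max 1 (1 / x)"
    have B: "B \<ge> 1" by (simp add: B_def)
    have "norm (\<Phi> A x s) = (\<Prod>j\<in>UNIV. norm (K A j x (s $ Some j)))" by (simp add: \<Phi>_def prod_norm)
    also have "\<dots> \<le> (\<Prod>j\<in>UNIV. C j * B ^ \<kappa> * exp (- (x / 4)))"
    proof (intro prod_mono conjI norm_ge_zero)
      fix j :: 'k
      have "norm (s $ Some j) \<le> R" using s(1) Finite_Cartesian_Product.norm_nth_le[of s "Some j"] by linarith
      then show "norm (K A j x (s $ Some j)) \<le> C j * B ^ \<kappa> * exp (- (x / 4))"
        unfolding B_def using s(2) x by (intro CK) (auto simp: region_def less_imp_le)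
    qed
    also have "\<dots> = (\<Prod>j\<in>UNIV. C j) * B ^ (\<kappa> * CARD('k)) * exp (- (x / 4)) ^ CARD('k)"
      by (simp add: prod.distrib power_mult)
    \<comment> \<open>Of the \<open>CARD('k)\<close> equal exponential factors only one is kept;
      there is at least one since a type is not empty.\<close>
    also have "\<dots> \<le> (\<Prod>j\<in>UNIV. C j) * (1 + x powr (- real (\<kappa> * CARD('k)))) * exp (- (x / 4)) ^ 1"
    proof (intro mult_mono mult_left_mono prod_nonneg C power_decreasing)
      show "B ^ (\<kappa> * CARD('k)) \<le> 1 + x powr (- real (\<kappa> * CARD('k)))"
      proof (cases "1 / x \<le> 1")
        case True then show ?thesis by (simp add: B_def)
      next
        case False
        then have "B = 1 / x" by (simp add: B_def)
        then have "B ^ (\<kappa> * CARD('k)) = x powr (- real (\<kappa> * CARD('k)))"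
          using x by (simp add: powr_minus powr_realpow power_one_over divide_inverse power_inverse del: of_nat_mult)
        then show ?thesis by simp
      qed
      show "1 \<le> CARD('k)" by (simp add: Suc_le_eq)
    qed (use x B in \<open>auto intro!: mult_nonneg_nonneg prod_nonneg C\<close>)
    finally show "norm (\<Phi> A x s) \<le> (\<Prod>j\<in>UNIV. C j) * (1 + x powr (- real (\<kappa> * CARD('k)))) * exp (- (x / 4))" by simp
  qed
qed

lemma \<Phi>_has_vector_derivative:
  assumes "x > 0"
  shows "((\<lambda>x. \<Phi> A x s) has_vector_derivative (\<Sum>i\<in>UNIV. - K A i x (s $ Some i - 1) * (\<Prod>j\<in>UNIV - {i}. K A j x (s $ Some j)))) (at x)"
proof -
  have "((\<lambda>x. \<Phi> A x s) has_derivative (\<lambda>y. \<Sum>i\<in>UNIV. (y *\<^sub>R - K A i x (s $ Some i - 1)) * (\<Prod>j\<in>UNIV - {i}. K A j x (s $ Some j)))) (at x)"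
    unfolding \<Phi>_def by (intro has_derivative_prod K_has_vector_derivative[unfolded has_vector_derivative_def] assms)
  then show ?thesis unfolding has_vector_derivative_def by (simp add: scaleR_sum_right)
qed

lemma \<Phi>_continuous: "x > 0 \<Longrightarrow> isCont (\<lambda>x. \<Phi> A x s) x"
  using \<Phi>_has_vector_derivative has_vector_derivative_continuous by blast

lemma \<phi>_continuous: "x > 0 \<Longrightarrow> isCont (\<phi> A s) x"
  unfolding \<phi>_def[abs_def] by (intro continuous_intros \<Phi>_continuous) auto

lemma \<phi>_measurable: "(\<lambda>x. indicator {0<..} x *\<^sub>R \<phi> A s x) \<in> borel_measurable borel"
  by (intro borel_measurable_continuous_on_indicator continuous_at_imp_continuous_on ballI \<phi>_continuous) auto

lemma \<phi>_dominated:
  assumes p: "p \<in> region \<kappa> 0 A"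
  shows "\<exists>r>0. \<exists>b. ball p r \<subseteq> region \<kappa> 0 A \<and> integrable lborel b \<and> (\<forall>s\<in>ball p r. \<forall>x. norm (indicator {0<..} x *\<^sub>R \<phi> A s x) \<le> b x)"
proof -
  define L where "L = real (\<kappa> * CARD('k))"
  define r1 where "r1 = (Re (p $ None) - L) / 2"
  have r1: "r1 > 0" using p by (simp add: r1_def L_def region_def)
  obtain r2 where r2: "r2 > 0" "ball p r2 \<subseteq> region \<kappa> 0 A"
    using open_region p open_contains_ball by blast
  define r where "r = min r1 r2"
  have r: "r > 0" "ball p r \<subseteq> region \<kappa> 0 A" using r1 r2 by (auto simp: r_def)
  have "norm p + r \<ge> 0" using r by simp
  from \<Phi>_bound[OF this, of \<kappa> 0 A] obtain C where C0: "C \<ge> 0"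
    and C': "\<forall>s x. norm s \<le> norm p + r \<longrightarrow> s \<in> region \<kappa> 0 A \<longrightarrow> x > 0 \<longrightarrow>
     norm (\<Phi> A x s) \<le> C * (1 + x powr (- real (\<kappa> * CARD('k)))) * exp (- (x / 4))" by (elim exE conjE)
  have C: "norm (\<Phi> A x s) \<le> C * (1 + x powr (- L)) * exp (- (x / 4))"
    if "norm s \<le> norm p + r" "s \<in> region \<kappa> 0 A" "x > 0" for s x
    using C'[rule_format, OF that] unfolding L_def .
  \<comment> \<open>\<open>r1\<close> is half the distance of \<open>Re (p $ None)\<close> from the
    critical value \<open>L\<close>, so \<open>c > L\<close>. The sum of the powers belonging to
    \<open>c\<close> and \<open>d\<close> covers \<open>x \<le> 1\<close> and \<open>x > 1\<close>
    together; multiplying by \<open>1 + x powr (- L)\<close> yields the four Gamma integrands of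
    \<open>b0\<close>.\<close>
  define c d where "c = Re (p $ None) - r1" and "d = Re (p $ None) + r1"
  have cd: "c > L" "d > L" "L \<ge> 0" using r1 by (auto simp: c_def d_def r1_def L_def field_simps)
  define b0 where "b0 x = C * (x powr (c - 1) * exp (- (1/4 * x)) + x powr (d - 1) * exp (- (1/4 * x))
     + x powr (c - L - 1) * exp (- (1/4 * x)) + x powr (d - L - 1) * exp (- (1/4 * x)))" for x
  have "set_integrable lborel {0<..} b0"
    unfolding b0_def by (intro set_integrable_mult_right set_integral_add set_integrable_Gamma_real) (use cd in auto)
  then have int: "integrable lborel (\<lambda>x. indicator {0<..} x *\<^sub>R b0 x)" by (simp add: set_integrable_def)
  have bd: "norm (\<phi> A s x) \<le> b0 x" if s: "s \<in> ball p r" and x: "x > 0" for s x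
  proof -
    have d: "norm (s - p) < r" using s by (simp add: dist_norm norm_minus_commute)
    have ns: "norm s \<le> norm p + r" using d norm_triangle_sub[of s p] by simp
    have "\<bar>Re (s $ None) - Re (p $ None)\<bar> \<le> norm ((s - p) $ None)" using abs_Re_le_cmod[of "(s - p) $ None"] by simp
    also have "\<dots> < r1" using Finite_Cartesian_Product.norm_nth_le[of "s - p" None] d r_def by linarith
    finally have Re: "c \<le> Re (s $ None)" "Re (s $ None) \<le> d" by (auto simp: c_def d_def)
    have "x powr (Re (s $ None) - 1) \<le> x powr (c - 1) + x powr (d - 1)"
    proof (cases "x \<le> 1")
      case True
      then have "x powr (Re (s $ None) - 1) \<le> x powr (c - 1)" using powr_mono'[of "c - 1" "Re (s $ None) - 1" x] Re x by simp
      also have "\<dots> \<le> x powr (c - 1) + x powr (d - 1)" by simp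
      finally show ?thesis .
    next
      case False
      then have "x powr (Re (s $ None) - 1) \<le> x powr (d - 1)" using powr_mono[of "Re (s $ None) - 1" "d - 1" x] Re x by simp
      also have "\<dots> \<le> x powr (c - 1) + x powr (d - 1)" by simp
      finally show ?thesis .
    qed
    moreover have "norm (\<phi> A s x) = x powr (Re (s $ None) - 1) * norm (\<Phi> A x s)"
      using x by (simp add: \<phi>_def norm_mult norm_powr_real_powr)
    ultimately have "norm (\<phi> A s x) \<le> (x powr (c - 1) + x powr (d - 1)) * (C * (1 + x powr (- L)) * exp (- (x / 4)))"
      
      by (simp only:) (intro mult_mono C[OF ns subsetD[OF r(2) s] x] norm_ge_zero add_nonneg_nonneg powr_ge_zero)
    also have "\<dots> = b0 x"
    proof -
      have "x powr (e - L - 1) = x powr (e - 1) * x powr (- L)" for e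
        unfolding powr_add[symmetric] by (rule arg_cong[of _ _ "\<lambda>e. x powr e"]) simp
      then show ?thesis unfolding b0_def by (simp only:) (simp add: distrib_left distrib_right mult_ac)
    qed
    finally show ?thesis .
  qed
  show ?thesis
  proof (intro exI[of _ r] exI[of _ "\<lambda>x. indicator {0<..} x *\<^sub>R b0 x"] conjI r int ballI allI)
    fix s x assume "s \<in> ball p r"
    then show "norm (indicator {0<..} x *\<^sub>R \<phi> A s x) \<le> indicator {0<..} x *\<^sub>R b0 x"
      using bd[of s x] by (cases "x > 0") simp_all
  qed
qed

lemma \<phi>_integrable:
  assumes "s \<in> region \<kappa> 0 A" shows "set_integrable lborel {0<..} (\<phi> A s)"
proof -
  obtain r b where rb: "r > 0" "integrable lborel b" "\<And>t x. t \<in> ball s r \<Longrightarrow> norm (indicator {0<..} x *\<^sub>R \<phi> A t x) \<le> b x"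
    using \<phi>_dominated[OF assms] by blast
  show ?thesis unfolding set_integrable_def
    by (rule Bochner_Integration.integrable_bound[OF rb(2)])
       (use rb(1) rb(3)[of s] \<phi>_measurable in \<open>auto intro!: AE_I2 order_trans[OF _ abs_ge_self]\<close>)
qed

lemma \<phi>_holomorphic_at: "x > 0 \<Longrightarrow> holomorphic_at (\<lambda>s. \<phi> A s x) z"
  unfolding \<phi>_def \<Phi>_def powr_diff
  by (intro holomorphic_at_mult holomorphic_at_prod holomorphic_at_compose[OF holomorphic_at_coord] K_field_differentiable
       holomorphic_at_compose[OF holomorphic_at_coord, where g = "\<lambda>s. of_real x powr s / of_real x powr 1"] derivative_intros) auto

lemma M_holomorphic_at:
  assumes "p \<in> region \<kappa> 0 A" shows "holomorphic_at (M A) p"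
proof -
  obtain r b where rb: "r > 0" "integrable lborel b" "\<And>t x. t \<in> ball p r \<Longrightarrow> norm (indicator {0<..} x *\<^sub>R \<phi> A t x) \<le> b x"
    using \<phi>_dominated[OF assms] by blast
  have "holomorphic_at (\<lambda>s. LINT x|lborel. indicator {0<..} x *\<^sub>R \<phi> A s x) p"
  proof (rule holomorphic_at_integral[OF rb(1) _ _ rb(3) rb(2)])
    fix x s
    show "holomorphic_at (\<lambda>s. indicator {0<..} x *\<^sub>R \<phi> A s x) s"
      using \<phi>_holomorphic_at[of x A s] by (cases "x > 0") auto
  qed (use \<phi>_measurable in auto)
  moreover have "holomorphic_at (\<lambda>s. rGamma (s $ None)) p"
    by (intro holomorphic_at_compose[OF holomorphic_at_coord] field_differentiable_rGamma)
  ultimately show ?thesis unfolding M_def[abs_def] set_lebesgue_integral_def by (rule holomorphic_at_mult[rotated])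
qed

text \<open>Product rule. For a factor outside \<open>A\<close>, \<open>H_eq\<close> is solved for
  -x F(x, s-1) = (s-1) F(x, s) + H(x, s), which contributes to the linear form and produces the
  larger set. For a factor in \<open>A\<close>, the derivative is the same integrand at
  \<open>s + shift i\<close>.\<close>

lemma \<phi>_has_vector_derivative:
  assumes x: "x > 0"
  shows "((\<lambda>x. of_real x powr (s $ None) * \<Phi> A x s) has_vector_derivative
     (\<Lambda> (- A) s * \<phi> A s x + (\<Sum>j\<in>-A. \<phi> (insert j A) s x) - (\<Sum>i\<in>A. \<phi> A (s + shift i) x))) (at x)"
proof -
  define P where "P i = (\<Prod>j\<in>UNIV - {i}. K A j x (s $ Some j))" for i
  have pw: "((\<lambda>x. complex_of_real x powr (s $ None)) has_vector_derivative s $ None * of_real x powr (s $ None - 1)) (at x)"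
    by (rule has_vector_derivative_real_field) (use x in \<open>auto intro!: derivative_eq_intros simp: powr_diff\<close>)
  have x': "complex_of_real x powr (s $ None) = of_real x powr (s $ None - 1) * of_real x"
    using x by (simp add: powr_diff)
  have \<Phi>_split: "\<Phi> B x t = K B i x (t $ Some i) * (\<Prod>j\<in>UNIV - {i}. K B j x (t $ Some j))" for B t i
    unfolding \<Phi>_def by (rule prod.remove) auto
  have notin: "of_real x powr (s $ None) * (- K A i x (s $ Some i - 1) * P i) = 
     (s $ Some i - 1) * \<phi> A s x + \<phi> (insert i A) s x" if "i \<notin> A" for i
  proof -
    have "(\<Prod>j\<in>UNIV - {i}. K (insert i A) j x (s $ Some j)) = P i" unfolding P_def
      by (intro prod.cong) (auto simp: K_def)
    then have 1: "\<Phi> (insert i A) x s = H i x (s $ Some i) * P i" using \<Phi>_split[of "insert i A" s i] by (simp add: K_def)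
    have 2: "\<Phi> A x s = F i x (s $ Some i) * P i" using \<Phi>_split[of A s i] that by (simp add: K_def P_def)
    show ?thesis unfolding \<phi>_def 1 2 x' H_eq[OF x] using that by (simp add: K_def algebra_simps)
  qed
  have inA: "of_real x powr (s $ None) * (- K A i x (s $ Some i - 1) * P i) = - \<phi> A (s + shift i) x" for i
  proof -
    have "(\<Prod>j\<in>UNIV - {i}. K A j x ((s + shift i) $ Some j)) = P i" unfolding P_def
      by (intro prod.cong) auto
    then show ?thesis using \<Phi>_split[of A "s + shift i" i] by (simp add: \<phi>_def)
  qed
  have "of_real x powr (s $ None) * (\<Sum>i\<in>UNIV. - K A i x (s $ Some i - 1) * P i) =
     (\<Sum>i\<in>UNIV. of_real x powr (s $ None) * (- K A i x (s $ Some i - 1) * P i))" by (rule sum_distrib_left)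
  also have "\<dots> = (\<Sum>i\<in>A. of_real x powr (s $ None) * (- K A i x (s $ Some i - 1) * P i)) + 
     (\<Sum>i\<in>-A. of_real x powr (s $ None) * (- K A i x (s $ Some i - 1) * P i))"
    by (subst sum.union_disjoint[symmetric]) auto
  also have "\<dots> = (\<Sum>i\<in>A. - \<phi> A (s + shift i) x) + (\<Sum>i\<in>-A. (s $ Some i - 1) * \<phi> A s x + \<phi> (insert i A) s x)"
    by (intro arg_cong2[of _ _ _ _ "(+)"] sum.cong refl inA notin) auto
  finally have eq: "of_real x powr (s $ None) * (\<Sum>i\<in>UNIV. - K A i x (s $ Some i - 1) * P i) = \<dots>" .
  from has_vector_derivative_mult[OF pw \<Phi>_has_vector_derivative[OF x, of A s]]
  have "((\<lambda>x. of_real x powr (s $ None) * \<Phi> A x s) has_vector_derivative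
     of_real x powr (s $ None) * (\<Sum>i\<in>UNIV. - K A i x (s $ Some i - 1) * P i) + s $ None * of_real x powr (s $ None - 1) * \<Phi> A x s) (at x)"
    by (simp add: P_def)
  also have "of_real x powr (s $ None) * (\<Sum>i\<in>UNIV. - K A i x (s $ Some i - 1) * P i) + s $ None * of_real x powr (s $ None - 1) * \<Phi> A x s =
    \<Lambda> (- A) s * \<phi> A s x + (\<Sum>j\<in>-A. \<phi> (insert j A) s x) - (\<Sum>i\<in>A. \<phi> A (s + shift i) x)"
    unfolding eq \<Lambda>_def sum.distrib sum_distrib_right[symmetric] sum_negf by (simp add: \<phi>_def[of A s] algebra_simps)
  finally show ?thesis .
qed

text \<open>The derivative integrates to 0, since x^(s_(k+1)) outweighs the blow-up of order
  \<open>L\<close> at 0 and the exponential decides at infinity. The factor \<open>s $ None\<close>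
  appears because the translated transforms are normalised by \<open>rGamma\<close> at
  \<open>s $ None + 1\<close>.\<close>

lemma M_relation:
  assumes s: "s \<in> region \<kappa> 0 A"
  shows "\<Lambda> (- A) s * M A s = s $ None * (\<Sum>i\<in>A. M A (s + shift i)) - (\<Sum>j\<in>-A. M (insert j A) s)"
proof -
  define L where "L = real (\<kappa> * CARD('k))"
  have L: "L \<ge> 0" "Re (s $ None) > L" using s by (auto simp: L_def region_def)
  have int1: "set_integrable lborel {0<..} (\<phi> A s)" by (rule \<phi>_integrable[OF s])
  have int2: "set_integrable lborel {0<..} (\<phi> (insert j A) s)" for j by (rule \<phi>_integrable[OF region_insert[OF s]])
  have int3: "set_integrable lborel {0<..} (\<phi> A (s + shift i))" if "i \<in> A" for i
    by (rule \<phi>_integrable[OF region_shift[OF region_Suc[OF s] that]])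
  define f where "f x = \<Lambda> (- A) s * \<phi> A s x + (\<Sum>j\<in>-A. \<phi> (insert j A) s x) - (\<Sum>i\<in>A. \<phi> A (s + shift i) x)" for x
  from \<Phi>_bound[OF norm_ge_zero[of s], of \<kappa> 0 A] obtain C where "C \<ge> 0"
    and C': "\<forall>s' x. norm s' \<le> norm s \<longrightarrow> s' \<in> region \<kappa> 0 A \<longrightarrow> x > 0 \<longrightarrow>
     norm (\<Phi> A x s') \<le> C * (1 + x powr (- real (\<kappa> * CARD('k)))) * exp (- (x / 4))" by (elim exE conjE)
  have C: "norm (\<Phi> A x s) \<le> C * (1 + x powr (- L)) * exp (- (x / 4))" if "x > 0" for x
    using C'[rule_format, OF order_refl s that] unfolding L_def .
  have bd: "norm (of_real x powr (s $ None) * \<Phi> A x s) \<le> C * ((x powr Re (s $ None) + x powr (Re (s $ None) - L)) * exp (- (x / 4)))"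
    if "x > 0" for x
  proof -
    have "norm (of_real x powr (s $ None) * \<Phi> A x s) = x powr Re (s $ None) * norm (\<Phi> A x s)"
      using that by (simp add: norm_mult norm_powr_real_powr)
    also have "\<dots> \<le> x powr Re (s $ None) * (C * (1 + x powr (- L)) * exp (- (x / 4)))"
      by (rule mult_left_mono[OF C[OF that]]) simp
    also have "\<dots> = C * ((x powr Re (s $ None) + x powr (Re (s $ None) - L)) * exp (- (x / 4)))"
    proof -
      have "x powr (Re (s $ None) - L) = x powr Re (s $ None) * x powr (- L)"
        unfolding powr_add[symmetric] by simp
      then show ?thesis by (simp only:) (simp add: distrib_left distrib_right mult_ac)
    qed
    finally show ?thesis .
  qed
  have 0: "(LINT x:{0<..}|lborel. f x) = 0"
  proof (rule integral_derivative_zero[where u = "\<lambda>x. of_real x powr (s $ None) * \<Phi> A x s"])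
    show "((\<lambda>x. of_real x powr (s $ None) * \<Phi> A x s) has_vector_derivative f x) (at x)" if "x > 0" for x
      unfolding f_def by (rule \<phi>_has_vector_derivative[OF that])
    show "isCont f x" if "x > 0" for x unfolding f_def[abs_def] using that by (intro continuous_intros \<phi>_continuous)
    show "set_integrable lborel {0<..} f" unfolding f_def[abs_def]
      by (intro set_integral_diff set_integral_add set_integrable_mult_right set_integral_finite_sum(1) int1 int2 int3) auto
    have pos: "Re (s $ None) > 0" "Re (s $ None) - L > 0" using L by auto
    show "((\<lambda>x. of_real x powr (s $ None) * \<Phi> A x s) \<longlongrightarrow> 0) (at_right 0)"
    proof (rule Lim_null_comparison)
      show "\<forall>\<^sub>F x in at_right 0. norm (of_real x powr (s $ None) * \<Phi> A x s) \<le>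
         C * ((x powr Re (s $ None) + x powr (Re (s $ None) - L)) * exp (- (x / 4)))"
        using bd by (auto simp: eventually_at_right_field intro!: exI[of _ 1])
      show "((\<lambda>x. C * ((x powr Re (s $ None) + x powr (Re (s $ None) - L)) * exp (- (x / 4)))) \<longlongrightarrow> 0) (at_right 0)"
        using tendsto_mult_right_zero[OF tendsto_add_zero[OF tendsto_powr_exp_0(1)[OF pos(1)] tendsto_powr_exp_0(1)[OF pos(2)]]]
        by (simp add: distrib_right)
    qed
    show "((\<lambda>x. of_real x powr (s $ None) * \<Phi> A x s) \<longlongrightarrow> 0) at_top"
    proof (rule Lim_null_comparison)
      show "\<forall>\<^sub>F x in at_top. norm (of_real x powr (s $ None) * \<Phi> A x s) \<le>
         C * ((x powr Re (s $ None) + x powr (Re (s $ None) - L)) * exp (- (x / 4)))"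
        by (rule eventually_mono[OF eventually_gt_at_top[of 0] bd])
      show "((\<lambda>x. C * ((x powr Re (s $ None) + x powr (Re (s $ None) - L)) * exp (- (x / 4)))) \<longlongrightarrow> 0) at_top"
        using tendsto_mult_right_zero[OF tendsto_add_zero[OF tendsto_powr_exp_0(2)[OF pos(1)] tendsto_powr_exp_0(2)[OF pos(2)]]]
        by (simp add: distrib_right)
    qed
  qed
  define I where "I B t = (LINT x:{0<..}|lborel. \<phi> B t x)" for B t
  have "(LINT x:{0<..}|lborel. f x) = \<Lambda> (- A) s * I A s + (\<Sum>j\<in>-A. I (insert j A) s) - (\<Sum>i\<in>A. I A (s + shift i))"
    unfolding f_def[abs_def] I_def
    by (subst set_integral_diff(2) set_integral_add(2) set_integral_finite_sum(2);
        (intro set_integral_add set_integrable_mult_right set_integral_finite_sum(1) int1 int2 int3; assumption)?)+ simp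
  with 0 have rel: "\<Lambda> (- A) s * I A s + (\<Sum>j\<in>-A. I (insert j A) s) - (\<Sum>i\<in>A. I A (s + shift i)) = 0" by simp
  have rg: "s $ None * rGamma (s $ None + 1) = rGamma (s $ None)" by (rule rGamma_plus1)
  have "\<Lambda> (- A) s * M A s - (s $ None * (\<Sum>i\<in>A. M A (s + shift i)) - (\<Sum>j\<in>-A. M (insert j A) s)) = 
    rGamma (s $ None) * (\<Lambda> (- A) s * I A s + (\<Sum>j\<in>-A. I (insert j A) s) - (\<Sum>i\<in>A. I A (s + shift i)))"
    by (simp add: M_def I_def[symmetric] rg[symmetric] sum_distrib_left algebra_simps)
  then show ?thesis using rel by simp
qed

end

section \<open>Meromorphic continuation\<close>

text \<open>Taking all \<open>l\<close> together makes the condition stable under the translations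
  of the recursion, which leave a form fixed or raise it by 1.\<close>

definition regular_point :: "complex ^ 'k::finite option \<Rightarrow> bool" where
  "regular_point s \<longleftrightarrow> (\<forall>J l. J \<noteq> {} \<longrightarrow> \<Lambda> J s + of_nat l \<noteq> 0)"

lemma regular_point_iff: "regular_point (s :: complex ^ 'k::finite option) \<longleftrightarrow> s \<notin> \<Union> MT_hyperplanes"
proof -
  have "s \<in> MT_hyperplane J l \<longleftrightarrow> \<Lambda> J s + of_nat l = 0" for J l
    unfolding MT_hyperplane_def \<Lambda>_def by (simp add: sum_subtractf algebra_simps)
  then show ?thesis unfolding regular_point_def MT_hyperplanes_def by blast
qed

lemma regular_point_shift: "regular_point s \<Longrightarrow> regular_point (s + shift i)"
proof -
  assume g: "regular_point s"
  have "\<Lambda> J (s + shift i) = \<Lambda> J s + (if i \<in> J then 0 else 1)" for J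
    by (auto simp: \<Lambda>_def sum.distrib sum_subtractf sum.delta)
  then have "\<Lambda> J (s + shift i) + of_nat l = \<Lambda> J s + of_nat (if i \<in> J then l else Suc l)" for J l by simp
  with g show ?thesis unfolding regular_point_def by metis
qed

lemma \<Lambda>_nonzero: "regular_point s \<Longrightarrow> J \<noteq> {} \<Longrightarrow> \<Lambda> J s \<noteq> 0"
  unfolding regular_point_def by (metis add_0_right of_nat_0)

lemma holomorphic_at_\<Lambda>: "holomorphic_at (\<Lambda> J) z"
  unfolding \<Lambda>_def[abs_def] by (intro holomorphic_at_add holomorphic_at_sum holomorphic_at_diff holomorphic_at_coord holomorphic_at_const)

text \<open>Local finiteness of the hyperplanes: on a ball the forms are bounded, so
  \<open>\<Lambda> J z + of_nat l\<close> can vanish only for small \<open>l\<close>. The finite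
  product of the remaining forms cuts out exactly the points that are not regular.\<close>

lemma local_denominator:
  fixes p :: "complex ^ 'k::finite option"
  shows "\<exists>h. (\<forall>z. holomorphic_at h z) \<and> (\<forall>z\<in>ball p 1. regular_point z \<longleftrightarrow> h z \<noteq> 0)"
proof -
  have bd: "norm (\<Lambda> J z) \<le> norm (\<Lambda> J p) + (1 + real CARD('k))" if "z \<in> ball p 1" for J z
  proof -
    have nz: "norm ((z - p) $ i) \<le> 1" for i
      using that Finite_Cartesian_Product.norm_nth_le[of "z - p" i] by (simp add: dist_norm norm_minus_commute)
    have "\<Lambda> J z - \<Lambda> J p = (z - p) $ None + (\<Sum>j\<in>J. (z - p) $ Some j)"
      by (simp add: \<Lambda>_def sum_subtractf)
    also have "norm \<dots> \<le> 1 + (\<Sum>j\<in>J. 1)"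
      by (intro order_trans[OF norm_triangle_ineq] add_mono sum_norm_le nz)
    also have "\<dots> \<le> 1 + real CARD('k)" by (simp add: card_mono)
    finally show ?thesis using norm_triangle_sub[of "\<Lambda> J z" "\<Lambda> J p"] by simp
  qed
  \<comment> \<open>The sum over all \<open>J\<close> gives one bound for all forms at
    \<open>p\<close>; the second summand bounds their variation on the ball, where each coordinate
    moves by at most 1.\<close>
  define B where "B = (\<Sum>J\<in>UNIV. norm (\<Lambda> J p)) + (1 + real CARD('k))"
  obtain L :: nat where L: "B < real L" using reals_Archimedean2 by blast
  define h where "h z = (\<Prod>J\<in>- {{}}. \<Prod>l<L. \<Lambda> J z + of_nat l)" for z :: "complex ^ 'k option"
  show ?thesis
  proof (intro exI[of _ h] conjI ballI allI)
    show "holomorphic_at h z" for z unfolding h_def[abs_def]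
      by (intro holomorphic_at_prod holomorphic_at_add holomorphic_at_\<Lambda> holomorphic_at_const)
    fix z assume z: "z \<in> ball p 1"
    have "\<Lambda> J z + of_nat l \<noteq> 0" if "l \<ge> L" for J l
    proof
      assume "\<Lambda> J z + of_nat l = 0"
      then have "norm (\<Lambda> J z) = real l" by (metis add_eq_0_iff2 norm_minus_cancel norm_of_nat)
      moreover have "norm (\<Lambda> J z) \<le> norm (\<Lambda> J p) + (1 + real CARD('k))" by (rule bd[OF z])
      moreover have "norm (\<Lambda> J p) \<le> (\<Sum>J\<in>UNIV. norm (\<Lambda> J p))" by (rule member_le_sum) auto
      ultimately show False using L that unfolding B_def by linarith
    qed
    then have "(\<forall>l. \<Lambda> J z + of_nat l \<noteq> 0) \<longleftrightarrow> (\<forall>l\<in>{..<L}. \<Lambda> J z + of_nat l \<noteq> 0)" for J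
      by (metis lessThan_iff not_le)
    then show "regular_point z \<longleftrightarrow> h z \<noteq> 0" unfolding regular_point_def h_def by (simp add: prod_zero_iff) blast
  qed
qed

lemma open_regular_point: "open {s :: complex ^ 'k::finite option. regular_point s}"
proof (subst open_subopen, intro ballI)
  fix p :: "complex ^ 'k option" assume "p \<in> {s. regular_point s}"
  obtain h where h: "\<And>z. holomorphic_at h z" "\<And>z. z \<in> ball p 1 \<Longrightarrow> regular_point z \<longleftrightarrow> h z \<noteq> 0"
    using local_denominator[of p] by metis
  have "continuous_on UNIV h" using h(1) holomorphic_at_isCont continuous_at_imp_continuous_on by blast
  then have "open (ball p 1 \<inter> h -` (- {0}))"
    by (intro open_Int open_ball open_vimage) auto
  moreover have "p \<in> ball p 1 \<inter> h -` (- {0})" using h(2)[of p] \<open>p \<in> {s. regular_point s}\<close> by auto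
  moreover have "ball p 1 \<inter> h -` (- {0}) \<subseteq> {s. regular_point s}" using h(2) by auto
  ultimately show "\<exists>T. open T \<and> p \<in> T \<and> T \<subseteq> {s. regular_point s}" by blast
qed

text \<open>A real displacement \<open>t\<close> of the coordinate \<open>None\<close> raises every
  form by \<open>t\<close>, and only countably many \<open>t\<close> hit a zero. This shows that
  local denominators do not vanish identically.\<close>

lemma exists_regular_point:
  fixes p :: "complex ^ 'k::finite option"
  assumes "r > 0" shows "\<exists>z\<in>ball p r. regular_point z"
proof -
  define T where "T = (\<Union>J. \<Union>l. {- Re (\<Lambda> J p) - real l})"
  have "countable T" unfolding T_def by (intro countable_UN uncountable_def) auto
  moreover have "uncountable {0<..<r}" using assms uncountable_open_interval by blast
  ultimately have "\<not> {0<..<r} \<subseteq> T" using countable_subset by blast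
  then obtain t where "t \<in> {0<..<r}" and t: "t \<notin> T" by blast
  then have t: "0 < t" "t < r" "t \<notin> T" by simp_all
  define z where "z = p + axis None (of_real t)"
  have \<Lambda>z: "\<Lambda> J z = \<Lambda> J p + of_real t" for J by (simp add: z_def \<Lambda>_def axis_def)
  have "regular_point z" unfolding regular_point_def
  proof (intro allI impI notI)
    fix J :: "'k set" and l :: nat assume "\<Lambda> J z + of_nat l = 0"
    then have "Re (\<Lambda> J p) + t + real l = 0" unfolding \<Lambda>z by (metis Re_complex_of_real complex.sel(1) of_real_of_nat_eq plus_complex.sel(1) zero_complex.sel(1))
    then have "t \<in> T" unfolding T_def by (auto intro!: exI[of _ J] exI[of _ l])
    with t(3) show False by simp
  qed
  moreover have "norm (axis None (complex_of_real t) :: complex ^ 'k option) = t"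
    using t by (simp add: norm_vec_def L2_set_def axis_def if_distrib[of norm] if_distrib[of "\<lambda>x. x\<^sup>2"] cong: if_cong)
  then have "z \<in> ball p r" using t by (simp add: z_def dist_norm)
  ultimately show ?thesis by blast
qed

text \<open>One quotient on all of \<open>W\<close>. Nothing is asked of \<open>f\<close> off the
  regular points, where the recursion may divide by 0 and return a default value. In this form the
  class is closed under sums, products, translations and division by the forms with
  \<open>J \<noteq> {}\<close>.\<close>

definition mero_quotient :: "(complex ^ 'k::finite option) set \<Rightarrow> (complex ^ 'k option \<Rightarrow> complex) \<Rightarrow> bool" where
  "mero_quotient W f \<longleftrightarrow> (\<exists>u v. (\<forall>z\<in>W. holomorphic_at u z \<and> holomorphic_at v z) \<and> (\<forall>s\<in>W. regular_point s \<longrightarrow> v s \<noteq> 0 \<and> f s = u s / v s))"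

lemma mero_quotientI:
  "(\<And>z. z \<in> W \<Longrightarrow> holomorphic_at u z) \<Longrightarrow> (\<And>z. z \<in> W \<Longrightarrow> holomorphic_at v z) \<Longrightarrow>
   (\<And>z. z \<in> W \<Longrightarrow> regular_point z \<Longrightarrow> v z \<noteq> 0) \<Longrightarrow> (\<And>z. z \<in> W \<Longrightarrow> regular_point z \<Longrightarrow> f z = u z / v z) \<Longrightarrow> mero_quotient W f"
  unfolding mero_quotient_def by blast

lemma mero_quotientE:
  assumes "mero_quotient W f"
  obtains u v where "\<And>z. z \<in> W \<Longrightarrow> holomorphic_at u z" "\<And>z. z \<in> W \<Longrightarrow> holomorphic_at v z"
    "\<And>z. z \<in> W \<Longrightarrow> regular_point z \<Longrightarrow> v z \<noteq> 0" "\<And>z. z \<in> W \<Longrightarrow> regular_point z \<Longrightarrow> f z = u z / v z"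
  using assms unfolding mero_quotient_def by blast

lemma mero_quotient_holomorphic: "(\<And>z. z \<in> W \<Longrightarrow> holomorphic_at f z) \<Longrightarrow> mero_quotient W f"
  by (rule mero_quotientI[of W f "\<lambda>_. 1"]) (auto intro: holomorphic_at_const)

lemma mero_quotient_add:
  assumes "mero_quotient W f" "mero_quotient W g" shows "mero_quotient W (\<lambda>s. f s + g s)"
proof (rule mero_quotientE[OF assms(1)], rule mero_quotientE[OF assms(2)])
  fix u v u' v'
  assume u: "\<And>z. z \<in> W \<Longrightarrow> holomorphic_at u z" "\<And>z. z \<in> W \<Longrightarrow> holomorphic_at v z"
    "\<And>z. z \<in> W \<Longrightarrow> regular_point z \<Longrightarrow> v z \<noteq> 0" "\<And>z. z \<in> W \<Longrightarrow> regular_point z \<Longrightarrow> f z = u z / v z"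
    and u': "\<And>z. z \<in> W \<Longrightarrow> holomorphic_at u' z" "\<And>z. z \<in> W \<Longrightarrow> holomorphic_at v' z"
    "\<And>z. z \<in> W \<Longrightarrow> regular_point z \<Longrightarrow> v' z \<noteq> 0" "\<And>z. z \<in> W \<Longrightarrow> regular_point z \<Longrightarrow> g z = u' z / v' z"
  show ?thesis
  proof (rule mero_quotientI[of W "\<lambda>z. u z * v' z + u' z * v z" "\<lambda>z. v z * v' z"])
    show "holomorphic_at (\<lambda>z. u z * v' z + u' z * v z) z" "holomorphic_at (\<lambda>z. v z * v' z) z" if "z \<in> W" for z
      by (intro holomorphic_at_add holomorphic_at_mult u u' that)+
    show "v z * v' z \<noteq> 0" "f z + g z = (u z * v' z + u' z * v z) / (v z * v' z)" if "z \<in> W" "regular_point z" for z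
      using u(3,4)[OF that] u'(3,4)[OF that] by (simp_all add: add_frac_eq)
  qed
qed

lemma mero_quotient_mult:
  assumes "mero_quotient W f" "mero_quotient W g" shows "mero_quotient W (\<lambda>s. f s * g s)"
proof (rule mero_quotientE[OF assms(1)], rule mero_quotientE[OF assms(2)])
  fix u v u' v'
  assume u: "\<And>z. z \<in> W \<Longrightarrow> holomorphic_at u z" "\<And>z. z \<in> W \<Longrightarrow> holomorphic_at v z"
    "\<And>z. z \<in> W \<Longrightarrow> regular_point z \<Longrightarrow> v z \<noteq> 0" "\<And>z. z \<in> W \<Longrightarrow> regular_point z \<Longrightarrow> f z = u z / v z"
    and u': "\<And>z. z \<in> W \<Longrightarrow> holomorphic_at u' z" "\<And>z. z \<in> W \<Longrightarrow> holomorphic_at v' z"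
    "\<And>z. z \<in> W \<Longrightarrow> regular_point z \<Longrightarrow> v' z \<noteq> 0" "\<And>z. z \<in> W \<Longrightarrow> regular_point z \<Longrightarrow> g z = u' z / v' z"
  show ?thesis
  proof (rule mero_quotientI[of W "\<lambda>z. u z * u' z" "\<lambda>z. v z * v' z"])
    show "holomorphic_at (\<lambda>z. u z * u' z) z" "holomorphic_at (\<lambda>z. v z * v' z) z" if "z \<in> W" for z
      by (intro holomorphic_at_mult u u' that)+
    show "v z * v' z \<noteq> 0" "f z * g z = (u z * u' z) / (v z * v' z)" if "z \<in> W" "regular_point z" for z
      using u(3,4)[OF that] u'(3,4)[OF that] by simp_all
  qed
qed

lemma mero_quotient_sum: "(\<And>i. i \<in> I \<Longrightarrow> mero_quotient W (f i)) \<Longrightarrow> mero_quotient W (\<lambda>s. \<Sum>i\<in>I. f i s)"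
proof (induction I rule: infinite_finite_induct)
  case (insert i I)
  then show ?case by (simp add: mero_quotient_add)
qed (auto intro!: mero_quotient_holomorphic holomorphic_at_const)

lemma mero_quotient_diff:
  assumes "mero_quotient W f" "mero_quotient W g" shows "mero_quotient W (\<lambda>s. f s - g s)"
proof -
  have "mero_quotient W (\<lambda>s. f s + (- 1) * g s)"
    by (intro mero_quotient_add mero_quotient_mult assms mero_quotient_holomorphic holomorphic_at_const)
  then show ?thesis by simp
qed

lemma mero_quotient_divide_\<Lambda>:
  assumes "mero_quotient W f" "J \<noteq> {}" shows "mero_quotient W (\<lambda>s. f s / \<Lambda> J s)"
proof -
  have "mero_quotient W (\<lambda>s. 1 / \<Lambda> J s)"
    by (rule mero_quotientI[of W "\<lambda>_. 1" "\<Lambda> J"]) (rule holomorphic_at_\<Lambda> holomorphic_at_const refl \<Lambda>_nonzero[OF _ assms(2)]; assumption)+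
  from mero_quotient_mult[OF assms(1) this] show ?thesis by simp
qed

lemma mero_quotient_cong:
  assumes "mero_quotient W f" "W' \<subseteq> W" "\<And>s. s \<in> W' \<Longrightarrow> regular_point s \<Longrightarrow> g s = f s" shows "mero_quotient W' g"
proof (rule mero_quotientE[OF assms(1)])
  fix u v
  assume u: "\<And>z. z \<in> W \<Longrightarrow> holomorphic_at u z" "\<And>z. z \<in> W \<Longrightarrow> holomorphic_at v z"
    "\<And>z. z \<in> W \<Longrightarrow> regular_point z \<Longrightarrow> v z \<noteq> 0" "\<And>z. z \<in> W \<Longrightarrow> regular_point z \<Longrightarrow> f z = u z / v z"
  show ?thesis
  proof (rule mero_quotientI[of W' u v])
    fix z assume "z \<in> W'"
    then have z: "z \<in> W" using assms(2) by blast
    show "holomorphic_at u z" "holomorphic_at v z" by (intro u z)+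
    show "v z \<noteq> 0" "g z = u z / v z" if "regular_point z"
      using u(3,4)[OF z that] assms(3)[OF \<open>z \<in> W'\<close> that] by simp_all
  qed
qed

lemma mero_quotient_shift:
  assumes "mero_quotient W f" "\<And>s. s \<in> W' \<Longrightarrow> s + shift i \<in> W" shows "mero_quotient W' (\<lambda>s. f (s + shift i))"
proof (rule mero_quotientE[OF assms(1)])
  fix u v
  assume u: "\<And>z. z \<in> W \<Longrightarrow> holomorphic_at u z" "\<And>z. z \<in> W \<Longrightarrow> holomorphic_at v z"
    "\<And>z. z \<in> W \<Longrightarrow> regular_point z \<Longrightarrow> v z \<noteq> 0" "\<And>z. z \<in> W \<Longrightarrow> regular_point z \<Longrightarrow> f z = u z / v z"
  show ?thesis
    by (rule mero_quotientI[of W' "\<lambda>s. u (s + shift i)" "\<lambda>s. v (s + shift i)"])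
       (intro holomorphic_at_shift u assms(2) regular_point_shift; assumption)+
qed

text \<open>Expanding the fraction by the local denominator forces the new denominator to vanish at
  every point that is not regular. Only then does the equation hold wherever the denominator is
  nonzero, as \<open>meromorphic_several_on\<close> demands.\<close>

lemma mero_quotient_imp_quotient:
  assumes q: "mero_quotient W f" "open W" "p \<in> W"
  obtains r u v where "r > 0" "\<And>z. z \<in> ball p r \<Longrightarrow> holomorphic_at u z \<and> holomorphic_at v z"
    "\<And>z. z \<in> ball p r \<Longrightarrow> regular_point z \<longleftrightarrow> v z \<noteq> 0" "\<And>z. z \<in> ball p r \<Longrightarrow> regular_point z \<Longrightarrow> f z = u z / v z"
proof -
  obtain u v where u: "\<And>z. z \<in> W \<Longrightarrow> holomorphic_at u z" "\<And>z. z \<in> W \<Longrightarrow> holomorphic_at v z"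
    "\<And>z. z \<in> W \<Longrightarrow> regular_point z \<Longrightarrow> v z \<noteq> 0" "\<And>z. z \<in> W \<Longrightarrow> regular_point z \<Longrightarrow> f z = u z / v z"
    using mero_quotientE[OF q(1)] by metis
  obtain h where h: "\<And>z. holomorphic_at h z" "\<And>z. z \<in> ball p 1 \<Longrightarrow> regular_point z \<longleftrightarrow> h z \<noteq> 0"
    using local_denominator[of p] by metis
  obtain \<rho> where \<rho>: "\<rho> > 0" "ball p \<rho> \<subseteq> W" using q(2,3) open_contains_ball by blast
  show ?thesis
  proof (rule that[of "min \<rho> 1" "\<lambda>z. u z * h z" "\<lambda>z. v z * h z"])
    fix z assume "z \<in> ball p (min \<rho> 1)"
    then have z: "z \<in> W" "z \<in> ball p 1" using \<rho>(2) by auto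
    show "holomorphic_at (\<lambda>z. u z * h z) z \<and> holomorphic_at (\<lambda>z. v z * h z) z" by (intro conjI holomorphic_at_mult u h z)
    show "regular_point z \<longleftrightarrow> v z * h z \<noteq> 0" using u(3)[OF z(1)] h(2)[OF z(2)] by auto
    show "f z = u z * h z / (v z * h z)" if "regular_point z" using u(4)[OF z(1) that] h(2)[OF z(2)] that by auto
  qed (use \<rho> in auto)
qed

lemma mero_quotient_imp_holomorphic_at:
  assumes q: "mero_quotient W f" "open W" "p \<in> W" "regular_point p"
  shows "holomorphic_at f p"
proof -
  obtain r u v where r: "r > 0" "\<And>z. z \<in> ball p r \<Longrightarrow> holomorphic_at u z \<and> holomorphic_at v z"
    "\<And>z. z \<in> ball p r \<Longrightarrow> regular_point z \<longleftrightarrow> v z \<noteq> 0" "\<And>z. z \<in> ball p r \<Longrightarrow> regular_point z \<Longrightarrow> f z = u z / v z"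
    using mero_quotient_imp_quotient[OF q(1-3)] by metis
  have "holomorphic_at (\<lambda>z. u z / v z) p" using r(1) r(2,3)[of p] q(4) by (intro holomorphic_at_divide) auto
  then show ?thesis
    by (rule holomorphic_at_transform_open[of _ _ "ball p r \<inter> {s. regular_point s}"])
       (use r q(4) open_regular_point in auto)
qed

text \<open>Agreement at regular points only leaves the values of \<open>F\<close> on the
  hyperplanes free; they are used later to match the series there.\<close>

lemma meromorphic_of_mero_quotient:
  fixes F :: "complex ^ 'k::finite option \<Rightarrow> complex"
  assumes q: "\<And>p. \<exists>W. open W \<and> p \<in> W \<and> mero_quotient W f" and F: "\<And>s. regular_point s \<Longrightarrow> F s = f s"
  shows "meromorphic_several_on F UNIV" "singularities F \<subseteq> \<Union> MT_hyperplanes"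
proof -
  show "meromorphic_several_on F UNIV" unfolding meromorphic_several_on_def
  proof (intro conjI ballI open_UNIV)
    fix p :: "complex ^ 'k option"
    obtain W where W: "open W" "p \<in> W" "mero_quotient W f" using q by blast
    obtain r u v where r: "r > 0" "\<And>z. z \<in> ball p r \<Longrightarrow> holomorphic_at u z \<and> holomorphic_at v z"
      "\<And>z. z \<in> ball p r \<Longrightarrow> regular_point z \<longleftrightarrow> v z \<noteq> 0" "\<And>z. z \<in> ball p r \<Longrightarrow> regular_point z \<Longrightarrow> f z = u z / v z"
      using mero_quotient_imp_quotient[OF W(3,1,2)] by metis
    show "\<exists>V g h. p \<in> V \<and> V \<subseteq> UNIV \<and> connected V \<and>
        holomorphic_several_on g V \<and> holomorphic_several_on h V \<and>
        (\<exists>z\<in>V. h z \<noteq> 0) \<and> (\<forall>z\<in>V. h z \<noteq> 0 \<longrightarrow> F z = g z / h z)"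
      using exists_regular_point[OF r(1), of p] r F
      by (intro exI[of _ "ball p r"] exI[of _ u] exI[of _ v]) (auto simp: holomorphic_several_on_iff)
  qed
  show "singularities F \<subseteq> \<Union> MT_hyperplanes"
  proof (rule ccontr)
    assume "\<not> singularities F \<subseteq> \<Union> MT_hyperplanes"
    then obtain p where p: "p \<in> singularities F" "regular_point p" by (auto simp: regular_point_iff)
    have "holomorphic_at F z" if "regular_point z" for z
    proof -
      obtain W where W: "open W" "z \<in> W" "mero_quotient W f" using q by blast
      show ?thesis
        by (rule holomorphic_at_transform_open[OF mero_quotient_imp_holomorphic_at[OF W(3,1,2) that] open_regular_point]) (use that F in auto)
    qed
    then have "holomorphic_several_on F {s. regular_point s}" by (simp add: holomorphic_several_on_iff open_regular_point)
    with p show False unfolding singularities_def by blast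
  qed
qed

section \<open>Continuation by iterating the relation\<close>

context regularised
begin

text \<open>The relation for \<open>M\<close> solved for \<open>M A s\<close>. For \<open>A = UNIV\<close> the linear form is \<open>s $ None\<close>, which
  cancels; this is why no hyperplanes with \<open>J = {}\<close> occur.\<close>

function G :: "nat \<Rightarrow> 'k set \<Rightarrow> complex ^ 'k option \<Rightarrow> complex" where
  "G 0 A s = M A s"
| "G (Suc N) A s = (if A = UNIV then \<Sum>i\<in>UNIV. G N A (s + shift i)
     else (s $ None * (\<Sum>i\<in>A. G N A (s + shift i)) - (\<Sum>j\<in>-A. G (Suc N) (insert j A) s)) / \<Lambda> (- A) s)"
  by pat_completeness auto
termination
proof (relation "measures [\<lambda>(N, A, s). N, \<lambda>(N, A, s). card (- A)]")
  fix N A and s :: "complex ^ 'k option" and j :: 'k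
  assume "j \<in> - A"
  then have "card (- insert j A) < card (- A)" by (intro psubset_card_mono) auto
  then show "((Suc N, insert j A, s), Suc N, A, s) \<in> measures [\<lambda>(N, A, s). N, \<lambda>(N, A, s). card (- A)]"
    by simp
qed auto

lemmas [simp del] = G.simps(2)

text \<open>The termination order of \<open>G\<close> as an induction rule in which, unlike in
  \<open>G.induct\<close>, the point \<open>s\<close> does not occur; so it also proves statements
  about \<open>G N A\<close> as a function on a region.\<close>

lemma level_induct [case_names step]:
  fixes N :: nat and A :: "'k set"
  assumes "\<And>N A. (\<And>N' A'. N' < N \<Longrightarrow> P N' A') \<Longrightarrow> (\<And>j. j \<in> - A \<Longrightarrow> P N (insert j A)) \<Longrightarrow> P N A"
  shows "P N A"
proof (induction N arbitrary: A rule: less_induct)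
  case (less N)
  note N = less
  show ?case
  proof (induction A rule: measure_induct_rule[where f = "\<lambda>A. card (- A)"])
    case (less A)
    show ?case
    proof (rule assms)
      fix j assume "j \<in> - A"
      then have "card (- insert j A) < card (- A)" by (intro psubset_card_mono) auto
      then show "P N (insert j A)" by (rule less)
    qed (rule N)
  qed
qed

text \<open>At level 0 this is \<open>M_relation\<close> solved for \<open>M A s\<close>; from there
  on both sides satisfy the same recursion, whose ingredients agree by induction.\<close>

lemma G_Suc_eq: "s \<in> region \<kappa> N A \<Longrightarrow> regular_point s \<Longrightarrow> G (Suc N) A s = G N A s"
proof (induction N A arbitrary: s rule: level_induct)
  case (step N A)
  have ins: "G (Suc N) (insert j A) s = G N (insert j A) s" if "j \<in> - A" for j
    by (rule step.IH(2)[OF that region_insert]) (rule step.prems)+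
  show ?case
  proof (cases N)
    case 0
    have s: "s \<in> region \<kappa> 0 A" using step.prems 0 by simp
    show ?thesis
    proof (cases "A = UNIV")
      case True
      have "Re (s $ None) > 0" using s by (auto simp: region_def intro: le_less_trans[rotated])
      then have "s $ None \<noteq> 0" by auto
      moreover have "s $ None * M UNIV s = s $ None * (\<Sum>i\<in>UNIV. M UNIV (s + shift i))"
        using M_relation[OF s] True by (simp add: \<Lambda>_def)
      ultimately show ?thesis using 0 True by (simp add: G.simps(2))
    next
      case False
      then have "\<Lambda> (- A) s \<noteq> 0" by (intro \<Lambda>_nonzero[OF step.prems(2)]) auto
      then show ?thesis using M_relation[OF s] False 0 ins by (simp add: G.simps(2) divide_eq_eq mult.commute)
    qed
  next
    case (Suc n)
    have sh: "G (Suc n) A (s + shift i) = G n A (s + shift i)" if "i \<in> A" for i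
      using Suc step.prems by (intro step.IH(1) region_shift regular_point_shift that) auto
    have s1: "(\<Sum>i\<in>A. G (Suc n) A (s + shift i)) = (\<Sum>i\<in>A. G n A (s + shift i))"
      by (intro sum.cong refl sh)
    have s2: "(\<Sum>j\<in>-A. G (Suc (Suc n)) (insert j A) s) = (\<Sum>j\<in>-A. G (Suc n) (insert j A) s)"
      by (intro sum.cong refl ins[unfolded Suc])
    show ?thesis unfolding Suc G.simps(2)[of "Suc n" A s] G.simps(2)[of n A s] using s1 s2 by auto
  qed
qed

lemma G_mero_quotient: "mero_quotient (region \<kappa> N A) (G N A)"
proof (induction N A rule: level_induct)
  case (step N A)
  show ?case
  proof (cases N)
    case 0
    have "G 0 A = M A" by (rule ext) simp
    then show ?thesis using 0 M_holomorphic_at by (simp add: mero_quotient_holomorphic)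
  next
    case (Suc n)
    have ins: "mero_quotient (region \<kappa> N A) (G N (insert j A))" if "j \<in> - A" for j
      by (rule mero_quotient_cong[OF step.IH(2)[OF that]]) (auto intro: region_insert)
    have sh: "mero_quotient (region \<kappa> N A) (\<lambda>s. G n A (s + shift i))" if "i \<in> A" for i
      by (rule mero_quotient_shift[OF step.IH(1)]) (use Suc region_shift[OF _ that] in auto)
    show ?thesis
    proof (cases "A = UNIV")
      case True
      then have "G N A = (\<lambda>s. \<Sum>i\<in>UNIV. G n A (s + shift i))" using Suc by (intro ext) (simp add: G.simps(2))
      moreover have "mero_quotient (region \<kappa> N A) (\<lambda>s. \<Sum>i\<in>UNIV. G n A (s + shift i))"
        using True by (intro mero_quotient_sum sh) simp
      ultimately show ?thesis by simp
    next
      case False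
      have "mero_quotient (region \<kappa> N A) (\<lambda>s. (s $ None * (\<Sum>i\<in>A. G n A (s + shift i)) - (\<Sum>j\<in>-A. G N (insert j A) s)) / \<Lambda> (- A) s)"
        using False by (intro mero_quotient_divide_\<Lambda> mero_quotient_diff mero_quotient_mult mero_quotient_sum sh ins mero_quotient_holomorphic holomorphic_at_coord) auto
      moreover have "G N A = (\<lambda>s. (s $ None * (\<Sum>i\<in>A. G n A (s + shift i)) - (\<Sum>j\<in>-A. G N (insert j A) s)) / \<Lambda> (- A) s)"
        using False Suc by (intro ext) (simp add: G.simps(2))
      ultimately show ?thesis by simp
    qed
  qed
qed

text \<open>The sequence is eventually constant at every regular point, so the limit selects the
  stable value without a choice of \<open>\<kappa>\<close> and \<open>N\<close>.\<close>

definition G_lim :: "complex ^ 'k option \<Rightarrow> complex" where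
  "G_lim s = lim (\<lambda>N. G N {} s)"

lemma G_lim_eq:
  assumes s: "s \<in> region \<kappa> N {}" "regular_point s" shows "G_lim s = G N {} s"
proof -
  have "s \<in> region \<kappa> (N + n) {} \<and> G (N + n) {} s = G N {} s" for n
    by (induction n) (use s region_Suc G_Suc_eq in auto)
  then have "eventually (\<lambda>n. G n {} s = G N {} s) sequentially"
    unfolding eventually_sequentially by (metis le_iff_add)
  then show ?thesis unfolding G_lim_def by (intro limI tendsto_eventually)
qed

lemma G_lim_M: "s \<in> region \<kappa> 0 {} \<Longrightarrow> regular_point s \<Longrightarrow> G_lim s = M {} s"
  using G_lim_eq[of s \<kappa> 0] by simp

lemma G_lim_mero_quotient: "\<exists>W. open W \<and> p \<in> W \<and> mero_quotient W G_lim"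
proof -
  \<comment> \<open>Every point lies in some region: \<open>\<kappa>\<close> is chosen first, for
    the coordinates \<open>Some j\<close>, and then \<open>N\<close> makes up for the loss
    \<open>\<kappa> * CARD('k)\<close> in the coordinate \<open>None\<close>.\<close>
  define B where "B = 2 + (\<Sum>i\<in>UNIV. norm (p $ i))"
  obtain \<kappa> :: nat where k: "B < real \<kappa>" using reals_Archimedean2 by blast
  obtain N :: nat where N: "real (\<kappa> * CARD('k)) + B < real N" using reals_Archimedean2 by blast
  have "\<bar>Re (p $ i)\<bar> \<le> B - 2" for i
    unfolding B_def using member_le_sum[of i UNIV "\<lambda>i. norm (p $ i)"] abs_Re_le_cmod[of "p $ i"] by simp
  then have "2 - real \<kappa> < Re (p $ Some j)" "Re (p $ None) > real (\<kappa> * CARD('k)) - real N" for j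
    using k N by (smt (verit))+
  then have "p \<in> region \<kappa> N {}" by (simp add: region_def)
  moreover have "mero_quotient (region \<kappa> N {}) G_lim"
    using G_lim_eq by (intro mero_quotient_cong[OF G_mero_quotient]) auto
  ultimately show ?thesis using open_region by blast
qed

end

section \<open>Decomposition into residue classes\<close>

locale residue_classes =
  fixes a :: "'k::finite \<Rightarrow> nat" and Q :: nat
  assumes a_pos: "\<And>j. a j \<ge> 1" and Q_pos: "Q \<ge> 1"
begin

lemma progression: "progression (a j) Q"
  using a_pos Q_pos by unfold_locales

sublocale regularised "\<lambda>j. progression.F (a j) Q" "\<lambda>j. progression.H (a j) Q"
proof
  fix j :: 'k
  interpret progression "a j" Q by (rule progression)
  show "F x holomorphic_on UNIV" if "x > 0" for x by (rule F_holomorphic[OF that])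
  show "((\<lambda>x. F x s) has_vector_derivative - F x (s - 1)) (at x)" if "x > 0" for x s
    by (rule F_has_vector_derivative[OF that])
  show "H x s = (1 - s) * F x s - of_real x * F x (s - 1)" if "x > 0" for x s by (rule H_eq[OF that])
  show "\<exists>C\<ge>0. \<forall>s x. 2 - real \<kappa> \<le> Re s \<longrightarrow> 0 < x \<longrightarrow> norm (F x s) \<le> C / x ^ \<kappa> * exp (- (x / 4))" for \<kappa>
  proof (intro exI[of _ "fact \<kappa> * 2 ^ \<kappa> * Z2"] conjI allI impI)
    show "fact \<kappa> * 2 ^ \<kappa> * Z2 \<ge> 0" using Z2_nonneg by simp
    fix s :: complex and x :: real assume *: "2 - real \<kappa> \<le> Re s" "0 < x"
    have "norm (F x s) \<le> fact \<kappa> * 2 ^ \<kappa> * Z2 / x ^ \<kappa> * exp (- (x / 2))" by (rule norm_F_le[OF *])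
    also have "\<dots> \<le> fact \<kappa> * 2 ^ \<kappa> * Z2 / x ^ \<kappa> * exp (- (x / 4))"
      using * Z2_nonneg by (intro mult_left_mono) auto
    finally show "norm (F x s) \<le> fact \<kappa> * 2 ^ \<kappa> * Z2 / x ^ \<kappa> * exp (- (x / 4))" .
  qed
  show "\<exists>C\<ge>0. \<forall>s x. norm s \<le> R \<longrightarrow> 0 < x \<longrightarrow> norm (H x s) \<le> C * exp (- (x / 4))" if "R \<ge> 0" for R
    by (rule H_bound[OF that])
qed

definition nodes :: "('k \<Rightarrow> nat) \<Rightarrow> 'k \<Rightarrow> real" where "nodes n j = real (a j + Q * n j)"

definition coeff :: "complex ^ 'k option \<Rightarrow> ('k \<Rightarrow> nat) \<Rightarrow> complex" where
  "coeff s n = (\<Prod>j\<in>UNIV. of_real (nodes n j) powr (- (s $ Some j)))"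

lemma nodes_eq: "nodes n j = progression.node (a j) Q (n j)"
  using progression.node_def[OF progression] by (simp add: nodes_def)

lemma nodes_ge: "nodes n j \<ge> 1"
  unfolding nodes_eq by (rule progression.node_ge_1[OF progression])

lemma sum_nodes_ge: "(\<Sum>j\<in>UNIV. nodes n j) \<ge> 1"
proof -
  have "nodes n undefined \<le> (\<Sum>j\<in>UNIV. nodes n j)"
    by (rule member_le_sum) (auto intro: order_trans[OF zero_le_one nodes_ge])
  then show ?thesis using nodes_ge[of n undefined] by linarith
qed

lemma PiE_UNIV_UNIV: "PiE UNIV (\<lambda>_. UNIV) = UNIV"
  by (auto simp: PiE_def extensional_def)

lemma coeff_integrable:
  assumes "s \<in> region 0 0 {}" shows "integrable (count_space UNIV) (coeff s)"
proof -
  have "Infinite_Set_Sum.abs_summable_on (\<lambda>m. complex_of_real (real (a j + Q * m)) powr (- (s $ Some j))) UNIV" for j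
  proof -
    interpret progression "a j" Q by (rule progression)
    have "norm (of_real (node m) powr (- (s $ Some j))) \<le> node m powr (-2)" for m
    proof -
      have "Re (s $ Some j) \<ge> 2" using assms by (simp add: region_def less_imp_le)
      then show ?thesis using node_ge_1[of m] by (simp add: norm_powr_real_powr powr_mono)
    qed
    then have "summable (\<lambda>m. norm (complex_of_real (node m) powr (- (s $ Some j))))"
      by (intro summable_comparison_test'[OF summable_node]) simp
    then show ?thesis unfolding abs_summable_on_nat_iff' node_def .
  qed
  then have "Infinite_Set_Sum.abs_summable_on
      (\<lambda>n. \<Prod>j\<in>UNIV. complex_of_real (real (a j + Q * n j)) powr (- (s $ Some j))) (PiE UNIV (\<lambda>_. UNIV))"
    by (intro abs_summable_on_prod_PiE) auto
  then show ?thesis unfolding abs_summable_on_def PiE_UNIV_UNIV coeff_def[abs_def] nodes_def .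
qed

lemma F_product:
  assumes x: "x > 0" and s: "s \<in> region 0 0 {}"
  shows "(LINT n|count_space UNIV. coeff s n * of_real (exp (- ((\<Sum>j\<in>UNIV. nodes n j) * x)))) = \<Phi> {} x s"
proof -
  define f where "f j m = psi_deriv 0 (s $ Some j + 1) (of_real x) (of_real (real (a j + Q * m)))" for j m
  have f: "Infinite_Set_Sum.abs_summable_on (f j) UNIV" "infsetsum (f j) UNIV = progression.F (a j) Q x (s $ Some j)" for j
  proof -
    interpret progression "a j" Q by (rule progression)
    have "Re (s $ Some j) \<ge> 2 - real 0" using s by (auto simp: region_def less_imp_le)
    from norm_term_le[OF this, of "of_real x"] x
    have "summable (\<lambda>m. norm (psi_deriv 0 (s $ Some j + 1) (of_real x) (of_real (node m))))"
      by (intro summable_comparison_test'[OF summable_mult[OF summable_node], of 0 _ "exp (- (x / 2))"])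
        (simp del: psi_deriv.simps)
    then show 1: "Infinite_Set_Sum.abs_summable_on (f j) UNIV" unfolding f_def abs_summable_on_nat_iff' node_def .
    show "infsetsum (f j) UNIV = F x (s $ Some j)"
      unfolding infsetsum_nat'[OF 1] F_def S_def node_def f_def ..
  qed
  have "coeff s n * of_real (exp (- ((\<Sum>j\<in>UNIV. nodes n j) * x))) = (\<Prod>j\<in>UNIV. f j (n j))" for n
    by (simp add: f_def coeff_def nodes_def prod.distrib exp_of_real[symmetric] sum_distrib_right exp_sum sum_negf[symmetric] del: of_nat_add of_nat_mult)
  then have "(LINT n|count_space UNIV. coeff s n * of_real (exp (- ((\<Sum>j\<in>UNIV. nodes n j) * x)))) =
     infsetsum (\<lambda>n. \<Prod>j\<in>UNIV. f j (n j)) (PiE UNIV (\<lambda>_. UNIV))"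
    unfolding infsetsum_def PiE_UNIV_UNIV by simp
  also have "\<dots> = (\<Prod>j\<in>UNIV. infsetsum (f j) UNIV)"
    by (rule infsetsum_prod_PiE) (use f in auto)
  finally show ?thesis by (simp add: f(2) \<Phi>_def K_def)
qed

text \<open>Euler's integral for \<open>Gamma\<close> turns each term into a Mellin integral, and
  Fubini exchanges sum and integral. In \<open>region 0 0 {}\<close> the coefficients alone are
  absolutely summable.\<close>

lemma M_has_sum:
  assumes s: "s \<in> region 0 0 {}"
  shows "((\<lambda>n. coeff s n * of_real (\<Sum>j\<in>UNIV. nodes n j) powr (- (s $ None))) has_sum M {} s) UNIV"
proof -
  define T where "T n = (\<Sum>j\<in>UNIV. nodes n j)" for n
  have T: "T n \<ge> 1" "T n > 0" for n using sum_nodes_ge[of n] by (auto simp: T_def)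
  have s0: "Re (s $ None) > 0" using s by (simp add: region_def)
  define g where "g n x = indicator {0<..} x *\<^sub>R (complex_of_real x powr (s $ None - 1) * of_real (exp (- (T n * x))))" for n x
  define f where "f n x = g n x * coeff s n" for n x
  have int_g: "integrable lborel (g n)" and val_g: "(LINT x|lborel. g n x) = Gamma (s $ None) / of_real (T n) powr (s $ None)" for n
    using set_integral_Gamma[OF s0 T(2)[of n]] unfolding set_integrable_def set_lebesgue_integral_def g_def by auto
  \<comment> \<open>Since \<open>T n \<ge> 1\<close>, the function \<open>b\<close> dominates all
    the kernels at once, and the dependence on \<open>n\<close> is left to
    \<open>coeff\<close>.\<close>
  define b where "b x = indicator {0<..} x *\<^sub>R (x powr (Re (s $ None) - 1) * exp (- (1 * x)))" for x :: real
  have int_b: "integrable lborel b"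
    using set_integrable_Gamma_real[OF s0, of 1] unfolding set_integrable_def b_def by simp
  have gb: "norm (g n x) \<le> b x" for n x
    using T(1)[of n] by (auto simp: g_def b_def indicator_def norm_mult norm_powr_real_powr intro!: mult_left_mono)
  interpret pair_sigma_finite "count_space (UNIV :: ('k \<Rightarrow> nat) set)" "lborel :: real measure"
    by (intro pair_sigma_finite.intro sigma_finite_measure_count_space_countable lborel.sigma_finite_measure_axioms) auto
  have int_norm: "(LINT x|lborel. norm (f n x)) \<le> integral\<^sup>L lborel b * norm (coeff s n)" for n
  proof -
    have "(LINT x|lborel. norm (f n x)) \<le> (LINT x|lborel. b x * norm (coeff s n))"
      using int_g[of n] int_b gb unfolding f_def norm_mult by (intro integral_mono) (auto intro!: mult_right_mono)
    then show ?thesis by simp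
  qed
  have "integrable (count_space UNIV \<Otimes>\<^sub>M lborel) (\<lambda>(n, x). f n x)"
  proof (rule Fubini_integrable)
    show "(\<lambda>(n, x). f n x) \<in> borel_measurable (count_space UNIV \<Otimes>\<^sub>M lborel)"
      by (rule measurable_pair_measure_countable1) (use int_g in \<open>auto simp: f_def\<close>)
    show "integrable (count_space UNIV) (\<lambda>n. LINT x|lborel. norm (case (n, x) of (n, x) \<Rightarrow> f n x))"
      using integrable_mult_right[OF integrable_norm[OF coeff_integrable[OF s]], of "integral\<^sup>L lborel b"]
      by (rule Bochner_Integration.integrable_bound) (use int_norm in \<open>auto intro!: AE_I2 order_trans[OF _ abs_ge_self]\<close>)
    show "AE n in count_space UNIV. integrable lborel (\<lambda>x. case (n, x) of (n, x) \<Rightarrow> f n x)"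
      using int_g by (auto simp: f_def)
  qed
  from Fubini_integral[OF this] integrable_fst[OF this]
  have fub: "(LINT x|lborel. LINT n|count_space UNIV. f n x) = (LINT n|count_space UNIV. LINT x|lborel. f n x)"
    and int_n: "integrable (count_space UNIV) (\<lambda>n. LINT x|lborel. f n x)" by auto
  have inner: "(LINT x|lborel. f n x) = Gamma (s $ None) * (coeff s n * of_real (T n) powr (- (s $ None)))" for n
    unfolding f_def using val_g[of n] by (simp add: powr_minus field_simps)
  have outer: "(LINT n|count_space UNIV. f n x) = indicator {0<..} x *\<^sub>R \<phi> {} s x" for x
  proof (cases "x > 0")
    case True
    then have "(LINT n|count_space UNIV. f n x) = of_real x powr (s $ None - 1) *
      (LINT n|count_space UNIV. coeff s n * of_real (exp (- ((\<Sum>j\<in>UNIV. nodes n j) * x))))"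
      unfolding f_def g_def T_def by (subst integral_mult_right_zero[symmetric]) (simp add: mult_ac)
    then show ?thesis using F_product[OF True s] True by (simp add: \<phi>_def)
  qed (simp add: f_def g_def)
  have "Gamma (s $ None) \<noteq> 0" using s0 by (auto simp: Gamma_eq_zero_iff elim!: nonpos_Ints_cases)
  then have \<Gamma>: "rGamma (s $ None) * Gamma (s $ None) = 1" by (simp add: rGamma_inverse_Gamma)
  have "integrable (count_space UNIV) (\<lambda>n. rGamma (s $ None) * (LINT x|lborel. f n x))" using int_n by simp
  then have abs: "Infinite_Set_Sum.abs_summable_on (\<lambda>n. coeff s n * of_real (T n) powr (- (s $ None))) UNIV"
    unfolding inner mult.assoc[symmetric] \<Gamma> abs_summable_on_def by simp
  have "M {} s = rGamma (s $ None) * (LINT n|count_space UNIV. LINT x|lborel. f n x)"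
    unfolding M_def set_lebesgue_integral_def outer[symmetric] fub ..
  also have "\<dots> = infsetsum (\<lambda>n. coeff s n * of_real (T n) powr (- (s $ None))) UNIV"
    unfolding inner infsetsum_def integral_mult_right_zero by (simp only: mult.assoc[symmetric] \<Gamma> mult_1)
  also have "\<dots> = infsum (\<lambda>n. coeff s n * of_real (T n) powr (- (s $ None))) UNIV"
    by (rule infsetsum_infsum[OF abs])
  finally have "M {} s = infsum (\<lambda>n. coeff s n * of_real (T n) powr (- (s $ None))) UNIV" .
  moreover have "(\<lambda>n. coeff s n * of_real (T n) powr (- (s $ None))) summable_on UNIV"
    by (rule abs_summable_summable[OF iffD2[OF abs_summable_equivalent abs]])
  ultimately show ?thesis unfolding T_def by (simp add: has_sum_infsum)
qed

definition Z :: "complex ^ 'k option \<Rightarrow> complex" where "Z = G_lim"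

lemma Z_mero_quotient: "\<exists>W. open W \<and> p \<in> W \<and> mero_quotient W Z"
  unfolding Z_def by (rule G_lim_mero_quotient)

lemma has_sum_Z:
  assumes "s \<in> region 0 0 {}" "regular_point s"
  shows "((\<lambda>n. coeff s n * of_real (\<Sum>j\<in>UNIV. nodes n j) powr (- (s $ None))) has_sum Z s) UNIV"
  using M_has_sum[OF assms(1)] G_lim_M[OF assms] by (simp add: Z_def)

lemma summable_terms:
  assumes "s \<in> region 0 0 {}"
  shows "(\<lambda>n. coeff s n * of_real (\<Sum>j\<in>UNIV. nodes n j) powr (- (s $ None))) summable_on UNIV"
  using M_has_sum[OF assms] has_sum_imp_summable by blast

end

lemma mero_quotient_locally_sum:
  assumes "finite I" "\<And>i p. i \<in> I \<Longrightarrow> \<exists>W. open W \<and> p \<in> W \<and> mero_quotient W (f i)"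
  shows "\<exists>W. open W \<and> p \<in> W \<and> mero_quotient W (\<lambda>s. \<Sum>i\<in>I. c i * f i s)"
proof -
  have "\<forall>i\<in>I. \<exists>W. open W \<and> p \<in> W \<and> mero_quotient W (f i)" using assms(2) by blast
  from bchoice[OF this] obtain W where "\<forall>i\<in>I. open (W i) \<and> p \<in> W i \<and> mero_quotient (W i) (f i)" ..
  then have W: "\<And>i. i \<in> I \<Longrightarrow> open (W i)" "\<And>i. i \<in> I \<Longrightarrow> p \<in> W i" "\<And>i. i \<in> I \<Longrightarrow> mero_quotient (W i) (f i)"
    by blast+
  have "mero_quotient (\<Inter>i\<in>I. W i) (\<lambda>s. \<Sum>i\<in>I. c i * f i s)"
  proof (rule mero_quotient_sum)
    fix i assume i: "i \<in> I"
    have "mero_quotient (\<Inter>i\<in>I. W i) (f i)" by (rule mero_quotient_cong[OF W(3)[OF i]]) (use i in auto)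
    then show "mero_quotient (\<Inter>i\<in>I. W i) (\<lambda>s. c i * f i s)" by (rule mero_quotient_mult[OF mero_quotient_holomorphic[OF holomorphic_at_const]])
  qed
  moreover have "open (\<Inter>i\<in>I. W i)" using assms(1) W(1) by (intro open_INT) auto
  ultimately show ?thesis using W(2) by (intro exI[of _ "\<Inter>i\<in>I. W i"]) auto
qed

section \<open>Reduction of the character sums to arithmetic progressions\<close>

locale MT_data =
  fixes q :: "'k::finite option \<Rightarrow> nat" and X :: "'k option \<Rightarrow> nat \<Rightarrow> complex"
  assumes dirichlet: "\<And>i. dirichlet_character (q i) (X i)"
begin

definition Q :: nat where "Q = (\<Prod>i\<in>UNIV. q i)"

text \<open>Representatives start at 1 instead of 0, so that the progressions consist of positive
  numbers and together exhaust the range \<open>m j \<ge> 1\<close>.\<close>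

definition residues :: "('k \<Rightarrow> nat) set" where "residues = PiE UNIV (\<lambda>_. {1..Q})"

definition weight :: "('k \<Rightarrow> nat) \<Rightarrow> complex" where
  "weight a = (\<Prod>j\<in>UNIV. X (Some j) (a j)) * X None (\<Sum>j\<in>UNIV. a j)"

definition points :: "('k \<Rightarrow> nat) \<Rightarrow> ('k \<Rightarrow> nat) \<Rightarrow> 'k \<Rightarrow> nat" where
  "points a n = (\<lambda>j. a j + Q * n j)"

definition L :: "complex ^ 'k option \<Rightarrow> complex" where
  "L s = (\<Sum>a\<in>residues. weight a * residue_classes.Z a Q s)"

lemma Q_pos: "Q \<ge> 1"
proof -
  have "q i > 0" for i using dirichlet by (simp add: dirichlet_character_def)
  then show ?thesis unfolding Q_def by (metis One_nat_def Suc_leI prod_pos)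
qed

lemma finite_residues: "finite residues"
  unfolding residues_def by (intro finite_PiE) auto

lemma residuesD: "a \<in> residues \<Longrightarrow> 1 \<le> a j" "a \<in> residues \<Longrightarrow> a j \<le> Q"
  unfolding residues_def by auto

lemma residue_classes: "a \<in> residues \<Longrightarrow> residue_classes a Q"
  by unfold_locales (use residuesD Q_pos in auto)

lemma X_periodic: "X i (n + Q * m) = X i n"
proof -
  have per: "X i (n + q i) = X i n" for n using dirichlet[of i] by (simp add: dirichlet_character_def)
  have *: "X i (n + q i * l) = X i n" for l
    by (induction l) (use per in \<open>simp_all add: add.assoc[symmetric] add.commute[of "q i"]\<close>)
  have "q i dvd Q" unfolding Q_def by (intro dvd_prodI) auto
  then obtain r where "Q = q i * r" by blast
  then show ?thesis using *[of "r * m"] by (simp add: mult.assoc)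
qed

lemma MT_term_points:
  assumes "a \<in> residues"
  shows "MT_term X s (points a n) = weight a * (residue_classes.coeff a Q s n *
     of_real (\<Sum>j\<in>UNIV. residue_classes.nodes a Q n j) powr (- (s $ None)))"
proof -
  interpret residue_classes a Q by (rule residue_classes[OF assms])
  have "X None (\<Sum>j\<in>UNIV. points a n j) = X None (\<Sum>j\<in>UNIV. a j)"
    unfolding points_def sum.distrib sum_distrib_left[symmetric] by (rule X_periodic)
  moreover have "complex_of_nat (points a n j) = of_real (nodes n j)" for j
    by (simp add: points_def nodes_def)
  moreover have "complex_of_nat (\<Sum>j\<in>UNIV. points a n j) = of_real (\<Sum>j\<in>UNIV. nodes n j)"
    by (simp add: points_def nodes_def)
  ultimately show ?thesis
    unfolding MT_term_def weight_def coeff_def powr_minus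
    by (simp add: X_periodic points_def[of a n] prod_inversef[symmetric] divide_inverse o_def mult_ac)
qed

lemma points_inj: "inj (points a)"
  unfolding inj_def points_def using Q_pos by (auto simp: fun_eq_iff)

lemma points_disjoint:
  assumes "a \<in> residues" "b \<in> residues" "points a n = points b n'"
  shows "a = b"
proof
  fix j
  \<comment> \<open>Subtracting 1 moves the representatives to the range in which \<open>mod\<close>
    recovers them.\<close>
  have "(c j - 1 + Q * l) mod Q = c j - 1" if "c \<in> residues" for c :: "'k \<Rightarrow> nat" and l
  proof -
    have "c j - 1 < Q" using residuesD[OF that, of j] by linarith
    then show ?thesis by (simp only: mod_mult_self2 mod_less)
  qed
  moreover have "a j - 1 + Q * n j = b j - 1 + Q * n' j"
    using fun_cong[OF assms(3), of j] residuesD(1)[OF assms(1), of j] residuesD(1)[OF assms(2), of j]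
    unfolding points_def by linarith
  ultimately have "a j - 1 = b j - 1" using assms by metis
  then show "a j = b j" using residuesD(1)[OF assms(1), of j] residuesD(1)[OF assms(2), of j] by linarith
qed

lemma disjoint_points:
  assumes "a \<in> residues" "b \<in> residues" "a \<noteq> b"
  shows "range (points a) \<inter> range (points b) = {}"
proof (rule ccontr)
  assume "range (points a) \<inter> range (points b) \<noteq> {}"
  then obtain n n' where "points a n = points b n'" by blast
  with points_disjoint[OF assms(1,2)] assms(3) show False by blast
qed

lemma points_cover: "{m. \<forall>j. m j \<ge> 1} = (\<Union>a\<in>residues. range (points a))"
proof (intro equalityI subsetI)
  fix m :: "'k \<Rightarrow> nat" assume "m \<in> {m. \<forall>j. m j \<ge> 1}"
  then have m: "m j \<ge> 1" for j by simp
  define a where "a = (\<lambda>j. (m j - 1) mod Q + 1)"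
  define n where "n = (\<lambda>j. (m j - 1) div Q)"
  have "(m j - 1) mod Q < Q" for j using Q_pos by simp
  then have "a \<in> residues" unfolding residues_def a_def by (auto simp: PiE_def extensional_def Suc_leI)
  moreover have "points a n = m" unfolding points_def a_def n_def
  proof
    fix j show "(m j - 1) mod Q + 1 + Q * ((m j - 1) div Q) = m j"
      using m[of j] mod_mult_div_eq[of "m j - 1" Q] by linarith
  qed
  ultimately show "m \<in> (\<Union>a\<in>residues. range (points a))" by blast
qed (use residuesD(1) in \<open>auto simp: points_def intro: trans_le_add1\<close>)

lemma MT_has_sum:
  assumes "s \<in> region 0 0 {}" "regular_point s"
  shows "(MT_term X s has_sum L s) {m. \<forall>j. m j \<ge> 1}"
  unfolding points_cover L_def
proof (rule sum_has_sum[OF finite_residues])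
  fix a assume a: "a \<in> residues"
  show "(MT_term X s has_sum (weight a * residue_classes.Z a Q s)) (range (points a))"
    unfolding has_sum_reindex[OF points_inj] o_def MT_term_points[OF a]
    by (rule has_sum_cmult_right[OF residue_classes.has_sum_Z[OF residue_classes[OF a] assms]])
qed (rule disjoint_points)

lemma region_subset_domain: "region 0 0 {} \<subseteq> MT_domain X"
proof
  fix s :: "complex ^ 'k option" assume s: "s \<in> region 0 0 {}"
  have "MT_term X s summable_on range (points a)" if a: "a \<in> residues" for a
    unfolding summable_on_reindex[OF points_inj] o_def MT_term_points[OF a]
    by (rule summable_on_cmult_right[OF residue_classes.summable_terms[OF residue_classes[OF a] s]])
  then have "MT_term X s summable_on (\<Union>a\<in>residues. range (points a))"
    by (rule summable_on_finite_union_disjoint[OF finite_residues _ disjoint_points])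
  then show "s \<in> MT_domain X" unfolding MT_domain_def mem_Collect_eq points_cover .
qed

lemma L_mero_quotient: "\<exists>W. open W \<and> p \<in> W \<and> mero_quotient W L"
  unfolding L_def[abs_def]
  by (rule mero_quotient_locally_sum[OF finite_residues]) (rule residue_classes.Z_mero_quotient[OF residue_classes])

end

section \<open>Agreement on the whole domain of convergence\<close>

text \<open>Its norm is at least 1 for \<open>Re z \<ge> 0\<close> and positive \<open>m j\<close>,
  so moving along the diagonal direction only shrinks the terms.\<close>

definition ray_factor :: "('k::finite \<Rightarrow> nat) \<Rightarrow> complex \<Rightarrow> complex" where
  "ray_factor m z = (\<Prod>j\<in>UNIV. of_nat (m j) powr z) * of_nat (\<Sum>j\<in>UNIV. m j) powr z"

lemma MT_term_ray: "MT_term X (s + z *s 1) m = MT_term X s m / ray_factor m z"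
  by (simp add: MT_term_def ray_factor_def powr_add prod.distrib)

lemma ray_factor_holomorphic:
  assumes "\<And>j. m j \<ge> 1" shows "ray_factor m holomorphic_on A"
proof -
  have "m j \<noteq> 0" for j using assms[of j] by simp
  moreover have "(\<Sum>j\<in>UNIV. m j) \<noteq> 0" using \<open>\<And>j. m j \<noteq> 0\<close> by (simp add: sum_eq_0_iff)
  ultimately show ?thesis unfolding ray_factor_def[abs_def] of_nat_sum[symmetric]
    by (intro holomorphic_intros) (simp_all del: of_nat_sum)
qed

lemma norm_ray_factor_ge:
  assumes "\<And>j. m j \<ge> 1" "Re z \<ge> 0" shows "norm (ray_factor m z) \<ge> 1"
proof -
  have *: "norm (of_nat k powr z) \<ge> 1" if "k \<ge> 1" for k :: nat
  proof -
    have "norm (of_nat k powr z) = real k powr Re z"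
      using norm_powr_real_powr[of "real k" z] that by simp
    then show ?thesis using that assms(2) by (simp add: ge_one_powr_ge_zero)
  qed
  have "(1::nat) \<le> m undefined" by (rule assms)
  also have "\<dots> \<le> (\<Sum>j\<in>UNIV. m j)" by (rule member_le_sum) auto
  finally have "norm (of_nat (\<Sum>j\<in>UNIV. m j) powr z) \<ge> 1" by (rule *)
  moreover have "(\<Prod>j\<in>UNIV. norm (of_nat (m j) powr z)) \<ge> 1" by (intro prod_ge_1 * assms)
  ultimately show ?thesis unfolding ray_factor_def norm_mult prod_norm[symmetric]
    using mult_mono[of 1 _ 1] by fastforce
qed

text \<open>The slope is nonzero for every \<open>J\<close>, so each form vanishes at a single
  \<open>z\<close> and the diagonal line meets the hyperplanes in a countable set.\<close>

lemma \<Lambda>_ray: "\<Lambda> J (s + z *s 1) = \<Lambda> J s + of_nat (Suc (card J)) * z"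
  by (simp add: \<Lambda>_def sum.distrib sum_subtractf algebra_simps)

context MT_data
begin

text \<open>Summability of complex terms is absolute, so the terms at \<open>s\<close> are a
  majorant on the whole closed half-plane, including the boundary point
  \<open>z = 0\<close>.\<close>

lemma L_MT_ray:
  assumes s: "s \<in> MT_domain X"
  shows "continuous_on {z. Re z \<ge> 0} (\<lambda>z. L_MT X (s + z *s 1))"
    and "(\<lambda>z. L_MT X (s + z *s 1)) holomorphic_on {z. Re z > 0}"
proof -
  define D where "D = {m :: 'k \<Rightarrow> nat. \<forall>j. m j \<ge> 1}"
  define f where "f m z = MT_term X s m / ray_factor m z" for m z
  have g: "L_MT X (s + z *s 1) = (\<Sum>\<^sub>\<infinity>m\<in>D. f m z)" for z
    unfolding L_MT_def D_def f_def MT_term_ray ..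
  have "MT_term X s summable_on D" using s by (simp add: MT_domain_def D_def)
  then have sm: "(\<lambda>m. norm (MT_term X s m)) summable_on D"
    using summable_on_iff_abs_summable_on_complex by blast
  have U: "uniform_limit {z. Re z \<ge> 0} (\<lambda>A z. \<Sum>m\<in>A. f m z) (\<lambda>z. \<Sum>\<^sub>\<infinity>m\<in>D. f m z) (finite_subsets_at_top D)"
  proof (rule Weierstrass_m_test_general[OF _ sm])
    fix m z assume "m \<in> D" "z \<in> {z. Re z \<ge> 0}"
    then have "norm (ray_factor m z) \<ge> 1" by (intro norm_ray_factor_ge) (auto simp: D_def)
    then show "norm (f m z) \<le> norm (MT_term X s m)"
      unfolding f_def norm_divide using frac_le[of "norm (MT_term X s m)" "norm (MT_term X s m)" 1 "norm (ray_factor m z)"]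
      by simp
  qed
  have hol: "(\<lambda>z. \<Sum>m\<in>A. f m z) holomorphic_on {z. Re z \<ge> 0}" if "A \<subseteq> D" for A
    unfolding f_def
  proof (intro holomorphic_intros)
    fix m assume "m \<in> A"
    then have m: "m j \<ge> 1" for j using that by (auto simp: D_def)
    show "ray_factor m holomorphic_on {z. Re z \<ge> 0}" by (rule ray_factor_holomorphic[OF m])
    show "ray_factor m z \<noteq> 0" if "z \<in> {z. Re z \<ge> 0}" for z
    proof -
      have "norm (ray_factor m z) \<ge> 1" using that by (intro norm_ray_factor_ge m) simp
      then show ?thesis by auto
    qed
  qed
  have ev: "\<forall>\<^sub>F A in finite_subsets_at_top D. A \<subseteq> D"
    by (auto simp: eventually_finite_subsets_at_top)
  show "continuous_on {z. Re z \<ge> 0} (\<lambda>z. L_MT X (s + z *s 1))" unfolding g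
    by (rule uniform_limit_theorem[OF eventually_mono[OF ev holomorphic_on_imp_continuous_on[OF hol]] U]) simp_all
  have "open {z. Re z > 0}" by (rule open_halfspace_Re_gt)
  show "(\<lambda>z. L_MT X (s + z *s 1)) holomorphic_on {z. Re z > 0}" unfolding g
    unfolding holomorphic_on_open[OF \<open>open {z. Re z > 0}\<close>]
  proof
    fix z assume "z \<in> {z. Re z > 0}"
    then obtain r where r: "r > 0" "cball z r \<subseteq> {z. Re z > 0}"
      using \<open>open {z. Re z > 0}\<close> open_contains_cball by blast
    then have r': "cball z r \<subseteq> {z. Re z \<ge> 0}" by auto
    have ev': "\<forall>\<^sub>F A in finite_subsets_at_top D. continuous_on (cball z r) (\<lambda>z. \<Sum>m\<in>A. f m z) \<and> (\<lambda>z. \<Sum>m\<in>A. f m z) holomorphic_on ball z r"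
      using ev
    proof eventually_elim
      case (elim A)
      show ?case
        using holomorphic_on_subset[OF hol[OF elim] r'] ball_subset_cball
        by (meson holomorphic_on_imp_continuous_on holomorphic_on_subset)
    qed
    have "(\<lambda>z. \<Sum>\<^sub>\<infinity>m\<in>D. f m z) holomorphic_on ball z r"
      by (rule holomorphic_uniform_limit[OF ev' uniform_limit_on_subset[OF U r']]) auto
    then show "\<exists>f'. ((\<lambda>z. \<Sum>\<^sub>\<infinity>m\<in>D. f m z) has_field_derivative f') (at z)"
      using r(1) by (auto simp: holomorphic_on_open)
  qed
qed

text \<open>The domain may have boundary points, and it may exceed the region in which the Mellin
  representation holds. It is however closed under adding \<open>z (1, \<dots>, 1)\<close> with \<open>Re z \<ge> 0\<close>; on this
  half-plane the identity theorem applies, and \<open>s\<close> itself is reached as \<open>z \<rightarrow> 0\<close>.\<close>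

lemma L_MT_eq_L:
  assumes s: "s \<in> MT_domain X" "regular_point s"
  shows "L_MT X s = L s"
proof -
  define f where "f z = L_MT X (s + z *s 1)" for z
  define g where "g z = L (s + z *s 1)" for z
  define T where "T = (\<Union>J\<in>-{{}}. \<Union>l. {- (\<Lambda> J s + of_nat l) / of_nat (Suc (card J))})"
  have countable: "countable T" unfolding T_def by (intro countable_UN) auto
  have regular_point_iff_T: "regular_point (s + z *s 1) \<longleftrightarrow> z \<notin> T" for z
  proof -
    have "\<Lambda> J (s + z *s 1) + of_nat l = 0 \<longleftrightarrow> z = - (\<Lambda> J s + of_nat l) / of_nat (Suc (card J))" for J l
    proof -
      have n: "complex_of_nat (Suc (card J)) \<noteq> 0" by (rule of_nat_neq_0)
      have "\<Lambda> J (s + z *s 1) + of_nat l = 0 \<longleftrightarrow> of_nat (Suc (card J)) * z = - (\<Lambda> J s + of_nat l)"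
        unfolding \<Lambda>_ray by (metis add.commute add.assoc add_eq_0_iff2)
      also have "\<dots> \<longleftrightarrow> z = - (\<Lambda> J s + of_nat l) / of_nat (Suc (card J))"
        using n by (auto simp: field_simps simp del: of_nat_Suc)
      finally show ?thesis .
    qed
    then have "regular_point (s + z *s 1) \<longleftrightarrow> (\<forall>J l. J \<noteq> {} \<longrightarrow> z \<noteq> - (\<Lambda> J s + of_nat l) / of_nat (Suc (card J)))"
      unfolding regular_point_def by simp
    also have "\<dots> \<longleftrightarrow> z \<notin> T" unfolding T_def by (simp only: UN_iff Compl_iff singleton_iff UNIV_I bex_simps Bex_def) blast
    finally show ?thesis .
  qed
  have op: "open {z. regular_point (s + z *s 1)}"
  proof -
    have "continuous_on UNIV (\<lambda>z. s + z *s (1 :: complex ^ 'k option))"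
      by (intro continuous_at_imp_continuous_on ballI has_derivative_continuous[OF has_derivative_line])
    from open_vimage[OF open_regular_point this] show ?thesis by (simp add: vimage_def)
  qed
  have gd: "g field_differentiable (at z)" if "regular_point (s + z *s 1)" for z
  proof -
    obtain W where "open W" "s + z *s 1 \<in> W" "mero_quotient W L" using L_mero_quotient by blast
    from mero_quotient_imp_holomorphic_at[OF this(3,1,2) that] show ?thesis
      unfolding g_def[abs_def] by (rule holomorphic_at_line_fd)
  qed
  \<comment> \<open>Removing a countable set does not disconnect the half-plane, so the identity
    theorem remains applicable.\<close>
  define \<Omega> where "\<Omega> = {z. Re z > 0} - T"
  have \<Omega>_eq: "\<Omega> = {z. Re z > 0} \<inter> {z. regular_point (s + z *s 1)}" by (auto simp: \<Omega>_def regular_point_iff_T)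
  have open_\<Omega>: "open \<Omega>" unfolding \<Omega>_eq by (intro open_Int op open_halfspace_Re_gt)
  have conn: "connected \<Omega>" unfolding \<Omega>_def
    by (rule connected_open_diff_countable[OF _ open_halfspace_Re_gt _ countable])
       (auto intro: convex_connected convex_halfspace_Re_gt)
  \<comment> \<open>\<open>Re z > C\<close> pushes the real part of every coordinate above 2, the
    threshold of \<open>region 0 0 {}\<close>.\<close>
  define C where "C = 3 + (\<Sum>i\<in>UNIV. norm (s $ i))"
  have C: "s + z *s 1 \<in> region 0 0 {}" if "Re z > C" for z
  proof -
    have "\<bar>Re (s $ i)\<bar> \<le> C - 3" for i
      unfolding C_def using member_le_sum[of i UNIV "\<lambda>i. norm (s $ i)"] abs_Re_le_cmod[of "s $ i"] by simp
    then have "Re (s $ i) + Re z > 2" for i using that by (smt (verit))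
    then show ?thesis unfolding region_def by (auto intro: less_trans[of 0 2])
  qed
  have "C \<ge> 0" unfolding C_def by (intro add_nonneg_nonneg sum_nonneg) auto
  define \<Omega>' where "\<Omega>' = {z. Re z > C} \<inter> {z. regular_point (s + z *s 1)}"
  have open_\<Omega>': "open \<Omega>'" unfolding \<Omega>'_def by (intro open_Int op open_halfspace_Re_gt)
  have ne: "\<Omega>' \<noteq> {}"
  proof
    assume "\<Omega>' = {}"
    then have "complex_of_real ` {C<..<C + 1} \<subseteq> T" unfolding \<Omega>'_def regular_point_iff_T
      by (force simp: set_eq_iff)
    then have "countable (complex_of_real ` {C<..<C + 1})" using countable countable_subset by blast
    then have "countable {C<..<C + 1}" by (rule countable_image_inj_on) (simp add: inj_on_def)
    then show False using uncountable_open_interval[of C "C + 1"] by simp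
  qed
  have sub: "\<Omega>' \<subseteq> \<Omega>" using \<open>C \<ge> 0\<close> by (auto simp: \<Omega>'_def \<Omega>_eq)
  have fg: "f z = g z" if "z \<in> \<Omega>" for z
  proof (rule analytic_continuation_open[OF open_\<Omega>' open_\<Omega> ne conn sub _ _ _ that])
    show "f holomorphic_on \<Omega>" unfolding f_def[abs_def]
      by (rule holomorphic_on_subset[OF L_MT_ray(2)[OF s(1)]]) (auto simp: \<Omega>_def)
    show "g holomorphic_on \<Omega>" 
      unfolding holomorphic_on_def \<Omega>_eq by (intro ballI field_differentiable_at_within[OF gd]) simp
    fix w assume "w \<in> \<Omega>'"
    then have "s + w *s 1 \<in> region 0 0 {}" "regular_point (s + w *s 1)" using C by (auto simp: \<Omega>'_def)
    from MT_has_sum[OF this] show "f w = g w" by (simp add: f_def g_def L_MT_def infsumI)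
  qed
  have f0: "((\<lambda>t. f (of_real t)) \<longlongrightarrow> f 0) (at_right 0)"
  proof -
    have "continuous_on {0..} (\<lambda>t. f (of_real t))"
      unfolding f_def[abs_def]
      by (rule continuous_on_compose2[OF L_MT_ray(1)[OF s(1)]]) (auto intro!: continuous_intros)
    then have "((\<lambda>t. f (of_real t)) \<longlongrightarrow> f (of_real 0)) (at 0 within {0..})"
      unfolding continuous_on_def by (rule bspec) simp
    then have "((\<lambda>t. f (of_real t)) \<longlongrightarrow> f (of_real 0)) (at_right 0)"
      by (rule tendsto_within_subset) auto
    then show ?thesis by simp
  qed
  have g0: "((\<lambda>t. g (of_real t)) \<longlongrightarrow> g 0) (at_right 0)"
  proof -
    have "isCont g 0" using gd[of 0] s(2) field_differentiable_imp_continuous_at by simp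
    moreover have "(complex_of_real \<longlongrightarrow> 0) (at_right 0)" by (auto intro!: tendsto_eq_intros)
    ultimately show ?thesis by (rule isCont_tendsto_compose)
  qed
  have "\<forall>\<^sub>F t in at_right 0. f (of_real t) = g (of_real t)"
  proof -
    have "0 \<in> {z. regular_point (s + z *s 1)}" using s(2) by simp
    then obtain r where r: "r > 0" "ball 0 r \<subseteq> {z. regular_point (s + z *s 1)}" using op open_contains_ball by blast
    have "of_real t \<in> \<Omega>" if "0 < t" "t < r" for t
      using r(2) that by (auto simp: \<Omega>_eq subset_iff)
    then show ?thesis using r(1) fg by (auto simp: eventually_at_right_field intro!: exI[of _ r])
  qed
  from Lim_transform_eventually[OF f0 this] have "((\<lambda>t. g (of_real t)) \<longlongrightarrow> f 0) (at_right 0)" .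
  from tendsto_unique[OF _ this g0] have "f 0 = g 0" by simp
  then show ?thesis by (simp add: f_def g_def)
qed

end

theorem theorem2p3:
  fixes q :: "'k::finite option \<Rightarrow> nat" and X :: "'k option \<Rightarrow> nat \<Rightarrow> complex"
  assumes "\<And>i. primitive_dirichlet_character (q i) (X i)"
  shows "interior (MT_domain X) \<noteq> {} \<and>
         countable (MT_hyperplanes :: (complex ^ ('k option)) set set) \<and>
         (\<forall>H \<in> (MT_hyperplanes :: (complex ^ ('k option)) set set). complex_hyperplane H) \<and>
         (\<exists>F :: complex ^ ('k option) \<Rightarrow> complex.
            meromorphic_several_on F UNIV \<and>
            (\<forall>s \<in> MT_domain X. F s = L_MT X s) \<and>
            singularities F \<subseteq> \<Union> MT_hyperplanes)"
proof (intro conjI ballI)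
  interpret MT_data q X
    using assms by unfold_locales (simp add: primitive_dirichlet_character_def)
  have "(\<chi> i. 3) \<in> (region 0 0 {} :: (complex ^ 'k option) set)" by (simp add: region_def)
  then show "interior (MT_domain X) \<noteq> {}"
    using interior_maximal[OF region_subset_domain open_region] by blast
  show "countable (MT_hyperplanes :: (complex ^ ('k option)) set set)"
  proof -
    have eq: "MT_hyperplanes = (\<Union>J\<in>-{{}}. range (MT_hyperplane J :: nat \<Rightarrow> (complex ^ 'k option) set))"
      by (auto simp: MT_hyperplanes_def)
    show ?thesis unfolding eq by (intro countable_UN countable_image) (simp_all add: countable_finite)
  qed
  show "complex_hyperplane H" if HM: "H \<in> MT_hyperplanes" for H :: "(complex ^ 'k option) set"
  proof -
    obtain J :: "'k set" and l where H: "H = MT_hyperplane J l" using HM unfolding MT_hyperplanes_def by blast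
    define c :: "complex ^ 'k option" where "c = (\<chi> i. case i of None \<Rightarrow> 1 | Some j \<Rightarrow> if j \<in> J then 1 else 0)"
    have "c $ None = 1" by (simp add: c_def)
    then have "c \<noteq> 0" by (metis zero_index zero_neq_one)
    moreover have "(\<Sum>i\<in>UNIV. c $ i * s $ i) = (\<Sum>j\<in>J. s $ Some j) + s $ None" for s
    proof -
      have "(\<Sum>i\<in>UNIV. c $ i * s $ i) = s $ None + (\<Sum>j\<in>UNIV. (if j \<in> J then 1 else 0) * s $ Some j)"
        unfolding UNIV_option_conv by (subst sum.insert) (auto simp: c_def sum.reindex)
      also have "(\<Sum>j\<in>UNIV. (if j \<in> J then 1 else 0) * s $ Some j) = (\<Sum>j\<in>J. s $ Some j)"
        by (intro sum.mono_neutral_cong_right) auto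
      finally show ?thesis by simp
    qed
    ultimately show ?thesis unfolding complex_hyperplane_def H MT_hyperplane_def
      by (intro exI[of _ c] exI[of _ "of_nat (card J) - of_nat l"]) simp
  qed
  \<comment> \<open>The series has to be matched even at points of the domain that lie on a
    hyperplane, where \<open>L\<close> carries no information. At regular points both branches
    agree, which is all that \<open>meromorphic_of_mero_quotient\<close> asks for.\<close>
  define F where "F s = (if s \<in> MT_domain X then L_MT X s else L s)" for s
  have FL: "F s = L s" if "regular_point s" for s using L_MT_eq_L that by (simp add: F_def)
  have "meromorphic_several_on F UNIV" "singularities F \<subseteq> \<Union> MT_hyperplanes"
    by (rule meromorphic_of_mero_quotient[OF L_mero_quotient], erule FL)+
  moreover have "\<forall>s\<in>MT_domain X. F s = L_MT X s" by (simp add: F_def)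
  ultimately show "\<exists>F. meromorphic_several_on F UNIV \<and> (\<forall>s\<in>MT_domain X. F s = L_MT X s) \<and> singularities F \<subseteq> \<Union> MT_hyperplanes"
    by blast
qed

end
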